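(* Let $n\geqslant 1$ be an integer, let $\ell>0$, and let $p,q>1$ satisfy $$\big[((\ell+1)n-1)p-2\ell(p-1)-2\big](q-1)<4.$$ Let $u_0\in H^1(\mathbb{R}^n)$ and $u_1\in L^2(\mathbb{R}^n)$ be nonnegative, not both trivial and compactly supported functions with supports contained in $B_R$ for some $R>0$. For $\varepsilon>0$ let $$u\in \mathcal{C}([0,T), H^1(\mathbb{R}^n)) \cap \mathcal{C}^1([0,T), L^2(\mathbb{R}^n))\cap L^q_{\mathrm{loc}}((0,T)\times \mathbb{R}^n)\quad\text{such that}\quad \partial_t u \in L^p_{\mathrm{loc}}((0,T)\times \mathbb{R}^n)$$ be an energy solution with lifespan $T=T(\varepsilon)$ to the Cauchy problem $$\begin{cases} \partial_t^2 u- t^{2\ell}\Delta u =|\partial_t u|^p+|u|^q, & x\in \mathbb{R}^n,\ t>0,\\ u(0,x)=\varepsilon u_0(x), & x\in \mathbb{R}^n,\\ \partial_t u(0,x)=\varepsilon u_1(x), & x\in \mathbb{R}^n,\end{cases}$$ satisfying the support condition $\operatorname{supp} u(t,\cdot)\subset B_{R+t^{\ell+1}/(\ell+1)}$ for any $t\in(0,T)$. Then there exists a positive constant $\varepsilon_0=\varepsilon_0(n,\ell,p,q,u_0,u_1,R)$ such that for any $\varepsilon\in (0,\varepsilon_0]$ the energy solution $u$ blows up in finite time. Furthermore, the upper bound estimate for the lifespan $$T(\varepsilon)\leqslant C \varepsilon^{-\frac{p(q-1)}{\theta(n,\ell,p,q)}}$$ holds, where the positive constant $C$ is independent of $\varepsilon$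 and $$\theta(n,\ell,p,q)= 2 -\tfrac 12 \big[((\ell+1)n-1)p-2\ell(p-1)-2\big](q-1).$$
   Context: $B_r$ denotes the ball in $\mathbb{R}^n$ of radius $r$ around the origin. $\mathcal{C}^\infty_0([0,T)\times\mathbb{R}^n)$ denotes the $\mathcal{C}^\infty$ functions whose support is contained in a compact set $\mathcal{K}\subset[0,T)\times\mathbb{R}^n$. Energy solution: for $u_0\in H^1(\mathbb{R}^n)$, $u_1\in L^2(\mathbb{R}^n)$, a function $u$ is an energy solution of the Cauchy problem on $[0,T)$ if $u\in \mathcal{C}([0,T), H^1(\mathbb{R}^n)) \cap \mathcal{C}^1([0,T), L^2(\mathbb{R}^n))\cap L^q_{\mathrm{loc}}((0,T)\times \mathbb{R}^n)$ with $\partial_t u \in L^p_{\mathrm{loc}}((0,T)\times \mathbb{R}^n)$, $u(0,\cdot)=\varepsilon u_0$ in $H^1(\mathbb{R}^n)$, and $$\int_{\mathbb{R}^n} \partial_t u(t,x) \psi(t,x)\,\mathrm{d}x -\int_0^t\! \int_{\mathbb{R}^n} \partial_t u(s,x) \psi_t(s,x)\,\mathrm{d}x\,\mathrm{d}s + \int_0^t\! \int_{\mathbb{R}^n} s^{2\ell}\nabla u(s,x) \cdot \nabla \psi(s,x)\,\mathrm{d}x\,\mathrm{d}s$$ $$=\varepsilon \int_{\mathbb{R}^n} u_1(x) \psi(0,x)\,\mathrm{d}x+ \int_0^t\! \int_{\mathbb{R}^n} \big(|\partial_t u(s,x)|^p+|u(s,x)|^q\big) \psi(s,x)\,\mathrm{d}x\,\mathrm{d}s$$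 for any $\psi\in\mathcal{C}^\infty_0([0,T)\times\mathbb{R}^n)$ and any $t\in(0,T)$. The lifespan $T(\varepsilon)$ is the maximal existence time of the energy solution; blow-up in finite time means $T(\varepsilon)<\infty$. *)

theory Defs
  imports "HOL-Analysis.Analysis"
begin

(* Elements of L^2, H^1, L^q_loc are represented by Borel functions, identified up to
   equality almost everywhere; every Lebesgue class has such a representative. *)


(* Derivatives are taken within S, so this is smoothness up to the boundary. It is used for
   S = UNIV and for S = [0,T) x R^n only, where derivatives within S are unique. *)

primrec Ck_on :: "nat \<Rightarrow> 'a::real_normed_vector set \<Rightarrow> ('a \<Rightarrow> 'b::real_normed_vector) \<Rightarrow> bool" where
  "Ck_on 0 S f \<longleftrightarrow> continuous_on S f"
| "Ck_on (Suc k) S f \<longleftrightarrow> (\<forall>x\<in>S. f differentiable (at x within S)) \<and>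
     (\<forall>v. Ck_on k S (\<lambda>x. frechet_derivative f (at x within S) v))"

definition smooth_on :: "'a::real_normed_vector set \<Rightarrow> ('a \<Rightarrow> 'b::real_normed_vector) \<Rightarrow> bool" where
  "smooth_on S f \<longleftrightarrow> (\<forall>k. Ck_on k S f)"

(* The class C^infinity_0(S). *)

definition test_functions :: "'a::euclidean_space set \<Rightarrow> ('a \<Rightarrow> real) set" where
  "test_functions S =
     {\<phi>. smooth_on S \<phi> \<and> (\<exists>K. compact K \<and> K \<subseteq> S \<and> support_on S \<phi> \<subseteq> K)}"

definition grad :: "(real ^ 'n \<Rightarrow> real) \<Rightarrow> real ^ 'n::finite \<Rightarrow> real ^ 'n" where
  "grad f x = (\<chi> i. frechet_derivative f (at x) (axis i 1))"


definition L2 :: "('a::euclidean_space \<Rightarrow> 'b::euclidean_space) set" where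
  "L2 = {f. f \<in> borel_measurable lborel \<and> integrable lborel (\<lambda>x. (norm (f x))\<^sup>2)}"

definition L2_norm :: "('a::euclidean_space \<Rightarrow> 'b::euclidean_space) \<Rightarrow> real" where
  "L2_norm f = sqrt (LINT x|lborel. (norm (f x))\<^sup>2)"

definition is_weak_gradient ::
    "(real ^ 'n \<Rightarrow> real) \<Rightarrow> (real ^ 'n::finite \<Rightarrow> real ^ 'n) \<Rightarrow> bool" where
  "is_weak_gradient f g \<longleftrightarrow> g \<in> L2 \<and>
     (\<forall>\<phi>\<in>test_functions UNIV.
        (LINT x|lborel. f x *\<^sub>R grad \<phi> x) = - (LINT x|lborel. \<phi> x *\<^sub>R g x))"

definition weak_grad :: "(real ^ 'n \<Rightarrow> real) \<Rightarrow> real ^ 'n::finite \<Rightarrow> real ^ 'n" where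
  "weak_grad f = (SOME g. is_weak_gradient f g)"

definition H1 :: "(real ^ 'n::finite \<Rightarrow> real) set" where
  "H1 = {f \<in> L2. \<exists>g. is_weak_gradient f g}"

definition H1_norm :: "(real ^ 'n::finite \<Rightarrow> real) \<Rightarrow> real" where
  "H1_norm f = sqrt ((L2_norm f)\<^sup>2 + (L2_norm (weak_grad f))\<^sup>2)"

definition Lp_loc :: "real \<Rightarrow> 'a::euclidean_space set \<Rightarrow> ('a \<Rightarrow> real) \<Rightarrow> bool" where
  "Lp_loc r \<Omega> f \<longleftrightarrow> set_borel_measurable lborel \<Omega> f \<and>
     (\<forall>K. compact K \<and> K \<subseteq> \<Omega> \<longrightarrow> set_integrable lborel K (\<lambda>z. \<bar>f z\<bar> powr r))"

(* Support of an almost-everywhere class: the complement of the largest open set on which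
   f vanishes almost everywhere. *)

definition ess_support :: "('a::euclidean_space \<Rightarrow> real) \<Rightarrow> 'a set" where
  "ess_support f = {x. \<forall>r>0. \<not> (AE y in lborel. y \<in> ball x r \<longrightarrow> f y = 0)}"


definition continuous_in_L2 ::
    "real set \<Rightarrow> (real \<Rightarrow> 'a::euclidean_space \<Rightarrow> real) \<Rightarrow> bool" where
  "continuous_in_L2 I u \<longleftrightarrow> (\<forall>t\<in>I. u t \<in> L2) \<and>
     (\<forall>t\<in>I. ((\<lambda>s. L2_norm (\<lambda>x. u s x - u t x)) \<longlongrightarrow> 0) (at t within I))"

definition continuous_in_H1 ::
    "real set \<Rightarrow> (real \<Rightarrow> real ^ 'n::finite \<Rightarrow> real) \<Rightarrow> bool" where
  "continuous_in_H1 I u \<longleftrightarrow> (\<forall>t\<in>I. u t \<in> H1) \<and>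
     (\<forall>t\<in>I. ((\<lambda>s. H1_norm (\<lambda>x. u s x - u t x)) \<longlongrightarrow> 0) (at t within I))"

(* u is a C^1 curve in L^2 on I with derivative ut, i.e. difference quotients converge in
   the L^2 norm. *)

definition C1_in_L2 ::
    "real set \<Rightarrow> (real \<Rightarrow> 'a::euclidean_space \<Rightarrow> real) \<Rightarrow> (real \<Rightarrow> 'a \<Rightarrow> real) \<Rightarrow> bool" where
  "C1_in_L2 I u ut \<longleftrightarrow> (\<forall>t\<in>I. u t \<in> L2) \<and> continuous_in_L2 I ut \<and>
     (\<forall>t\<in>I. ((\<lambda>s. L2_norm (\<lambda>x. (u s x - u t x) / (s - t) - ut t x)) \<longlongrightarrow> 0) (at t within I))"


definition half_open_interval :: "ereal \<Rightarrow> real set" where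
  "half_open_interval T = {t. 0 \<le> t \<and> ereal t < T}"

definition open_interval :: "ereal \<Rightarrow> real set" where
  "open_interval T = {t. 0 < t \<and> ereal t < T}"

(* Energy solution on [0,T), 0 < T <= infinity. The requirement u_tt = ... holds in the weak
   form; the initial condition for ut is part of it. Integrability of the nonlinear term is
   stated explicitly, since L^p_loc, L^q_loc only refer to the open time interval and the
   integral of a non-integrable function is 0 in HOL-Analysis. *)

definition energy_solution ::
    "real \<Rightarrow> real \<Rightarrow> real \<Rightarrow> real \<Rightarrow> (real ^ 'n \<Rightarrow> real) \<Rightarrow> (real ^ 'n \<Rightarrow> real) \<Rightarrow> ereal
     \<Rightarrow> (real \<Rightarrow> real ^ 'n::finite \<Rightarrow> real) \<Rightarrow> bool" where
  "energy_solution l p q \<epsilon> u0 u1 T u \<longleftrightarrow> 0 < T \<and>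
     (\<exists>ut. continuous_in_H1 (half_open_interval T) u \<and>
        C1_in_L2 (half_open_interval T) u ut \<and>
        Lp_loc q (open_interval T \<times> UNIV) (\<lambda>(t, x). u t x) \<and>
        Lp_loc p (open_interval T \<times> UNIV) (\<lambda>(t, x). ut t x) \<and>
        (AE x in lborel. u 0 x = \<epsilon> * u0 x) \<and>
        (\<forall>\<psi>\<in>test_functions (half_open_interval T \<times> UNIV). \<forall>t\<in>open_interval T.
           set_integrable lborel ({0<..<t} \<times> UNIV)
             (\<lambda>(s, x). (\<bar>ut s x\<bar> powr p + \<bar>u s x\<bar> powr q) * \<psi> (s, x)) \<and>
           (LINT x|lborel. ut t x * \<psi> (t, x))
           - (LINT s:{0<..<t}|lborel. LINT x|lborel. ut s x * deriv (\<lambda>\<tau>. \<psi> (\<tau>, x)) s)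
           + (LINT s:{0<..<t}|lborel. LINT x|lborel.
                s powr (2 * l) * (weak_grad (u s) x \<bullet> grad (\<lambda>y. \<psi> (s, y)) x))
           = \<epsilon> * (LINT x|lborel. u1 x * \<psi> (0, x))
           + (LINT s:{0<..<t}|lborel. LINT x|lborel.
                (\<bar>ut s x\<bar> powr p + \<bar>u s x\<bar> powr q) * \<psi> (s, x))))"

(* T is the maximal existence time of u: no energy solution on a longer interval extends u. *)

definition energy_solution_with_lifespan ::
    "real \<Rightarrow> real \<Rightarrow> real \<Rightarrow> real \<Rightarrow> (real ^ 'n \<Rightarrow> real) \<Rightarrow> (real ^ 'n \<Rightarrow> real) \<Rightarrow> ereal
     \<Rightarrow> (real \<Rightarrow> real ^ 'n::finite \<Rightarrow> real) \<Rightarrow> bool" where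
  "energy_solution_with_lifespan l p q \<epsilon> u0 u1 T u \<longleftrightarrow>
     energy_solution l p q \<epsilon> u0 u1 T u \<and>
     (\<forall>T' v. energy_solution l p q \<epsilon> u0 u1 T' v \<longrightarrow> T \<le> T' \<longrightarrow>
        (\<forall>t\<in>half_open_interval T. AE x in lborel. v t x = u t x) \<longrightarrow> T' = T)"

definition theta :: "nat \<Rightarrow> real \<Rightarrow> real \<Rightarrow> real \<Rightarrow> real" where
  "theta n l p q =
     2 - 1 / 2 * (((l + 1) * real n - 1) * p - 2 * l * (p - 1) - 2) * (q - 1)"

end

theory Submission
  imports Defs
begin

text \<open>
  Let \<open>\<phi>(x)\<close> be the power series in \<open>\<bar>x\<bar>\<^sup>2\<close> that solves \<open>\<Delta>\<phi> = \<phi>\<close>, \<open>\<phi>(0) = 1\<close>; it is bounded by a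
  multiple of \<open>r powr (- (n - 1) / 2) * exp r\<close>, \<open>r = \<bar>x\<bar>\<close>. Testing the equation with \<open>\<phi>\<close> shows that
  \<open>\<integral> u \<phi>\<close> is a supersolution of \<open>y'' = t powr (2 * l) * y\<close>, so \<open>\<integral> u\<^sub>t \<phi>\<close> is at least
  \<open>c * \<epsilon> * t powr (l / 2) * exp (t powr (l + 1) / (l + 1))\<close> for \<open>t \<ge> 1\<close>. By the power mean inequality on
  the support of \<open>u(t)\<close>, \<open>P(t) = \<integral> (\<bar>u\<^sub>t\<bar>\<^sup>p + \<bar>u\<bar>\<^sup>q)\<close> then dominates both \<open>c * \<epsilon> powr p * t powr \<mu>\<close> and
  \<open>c * t powr (- \<beta>) * U\<^sup>q\<close>, where \<open>U = \<integral> u\<close> satisfies \<open>U'' = P\<close>. If the solution exists up to \<open>\<tau>\<close>, the first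
  bound gives \<open>U(\<tau> / 2) \<ge> A = c * \<epsilon> powr p * \<tau> powr (\<mu> + 2)\<close>. On \<open>[\<tau> / 2, \<tau>]\<close> the second one reads
  \<open>U'' \<ge> K * U\<^sup>q\<close> with \<open>K = c * \<tau> powr (- \<beta>)\<close>, whose solutions starting at \<open>A\<close> blow up within a time
  proportional to \<open>1 / sqrt (K * A powr (q - 1))\<close>. Hence \<open>\<tau>\<^sup>2 * K * A powr (q - 1)\<close> is bounded, that is,
  \<open>\<tau> powr \<theta> * \<epsilon> powr (p * (q - 1))\<close> is bounded.
\<close>

section \<open>Smooth functions and cutoffs\<close>

text \<open>The exponent \<theta> rests on one saving. At the edge
  \<open>\<rho> = R + t powr (l + 1) / (l + 1)\<close> of the support, \<phi> is about
  \<open>\<rho> powr (- (n - 1) / 2) * exp \<rho>\<close>, and it decays exponentially inwards. In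
  the mean for \<open>\<integral> u\<^sub>t \<phi>\<close> only a layer of bounded width counts, of
  volume \<open>\<rho> ^ (n - 1)\<close>, whereas the mean for \<open>\<integral> u\<close> costs
  the whole ball. The lower bound for \<open>\<integral> u\<^sub>t \<phi>\<close> contains exactly
  \<open>exp (\<rho> - R)\<close>, so the exponentials cancel and only powers are left. Regularity
  shapes the rest. Neither 1 nor \<phi> has compact support, so both are cut off outside the light
  cone and after time \<tau>. The moments are merely C^1 in time and the source is controlled for
  almost every time only, so each second-order inequality is used in integrated form. The exact
  solutions of \<open>y'' = t powr (2 * l) * y\<close> are Bessel-type functions; an explicit
  subsolution with the right growth replaces them. It is singular at 0, which is why that comparison
  starts at time 1.\<close>

lemma Ck_on_SucI:
  assumes "\<And>x. (f has_derivative D x) (at x)" and "\<And>v. Ck_on k UNIV (\<lambda>x. D x v)"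
  shows "Ck_on (Suc k) UNIV f"
proof -
  have "frechet_derivative f (at x) = D x" for x
    using frechet_derivative_at[OF assms(1)] by simp
  then show ?thesis
    using assms by (auto simp: differentiable_def)
qed

lemma Ck_on_SucD:
  assumes "Ck_on (Suc k) UNIV f"
  shows "(f has_derivative frechet_derivative f (at x)) (at x)"
    and "Ck_on k UNIV (\<lambda>x. frechet_derivative f (at x) v)"
  using assms by (auto simp: frechet_derivative_works)

lemma Ck_on_Suc_imp: "Ck_on (Suc k) UNIV f \<Longrightarrow> Ck_on k UNIV f"
proof (induction k arbitrary: f)
  case 0
  then show ?case
    by (auto intro!: differentiable_imp_continuous_on simp: differentiable_on_def)
next
  case (Suc k)
  show ?case
    by (rule Ck_on_SucI[OF Ck_on_SucD(1)[OF Suc.prems]]) (rule Suc.IH[OF Ck_on_SucD(2)[OF Suc.prems]])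
qed

lemma Ck_on_const [intro]: "Ck_on k UNIV (\<lambda>x. c)"
proof (induction k arbitrary: c)
  case (Suc k)
  show ?case by (rule Ck_on_SucI[where D = "\<lambda>x v. 0"]) (auto intro: Suc)
qed auto

lemma Ck_on_bounded_linear:
  assumes "bounded_linear f" shows "Ck_on k UNIV f"
proof (cases k)
  case 0
  then show ?thesis using assms by (simp add: linear_continuous_on)
next
  case (Suc j)
  show ?thesis unfolding Suc
    by (rule Ck_on_SucI[where D = "\<lambda>x. f"]) (auto intro: bounded_linear_imp_has_derivative assms)
qed

lemma Ck_on_add:
  assumes "Ck_on k UNIV f" "Ck_on k UNIV g"
  shows "Ck_on k UNIV (\<lambda>x. f x + g x)"
  using assms
proof (induction k arbitrary: f g)
  case 0
  then show ?case by (simp add: continuous_on_add)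
next
  case (Suc k)
  show ?case
    by (rule Ck_on_SucI[OF has_derivative_add[OF Ck_on_SucD(1)[OF Suc.prems(1)] Ck_on_SucD(1)[OF Suc.prems(2)]]])
      (intro Suc.IH Ck_on_SucD(2) Suc.prems)
qed

lemma Ck_on_mult:
  fixes f g :: "'a::real_normed_vector \<Rightarrow> real"
  assumes "Ck_on k UNIV f" "Ck_on k UNIV g"
  shows "Ck_on k UNIV (\<lambda>x. f x * g x)"
  using assms
proof (induction k arbitrary: f g)
  case 0
  then show ?case by (simp add: continuous_on_mult)
next
  case (Suc k)
  show ?case
    by (rule Ck_on_SucI[OF has_derivative_mult[OF Ck_on_SucD(1)[OF Suc.prems(1)] Ck_on_SucD(1)[OF Suc.prems(2)]]])
      (intro Ck_on_add Suc.IH Ck_on_SucD(2)[OF Suc.prems(1)] Ck_on_SucD(2)[OF Suc.prems(2)] Ck_on_Suc_imp[OF Suc.prems(1)]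
        Ck_on_Suc_imp[OF Suc.prems(2)])
qed

lemma Ck_on_inverse:
  fixes f :: "'a::real_normed_vector \<Rightarrow> real"
  assumes "Ck_on k UNIV f" "\<And>x. f x \<noteq> 0"
  shows "Ck_on k UNIV (\<lambda>x. inverse (f x))"
  using assms(1)
proof (induction k)
  case 0
  then show ?case using assms(2) by (simp add: continuous_on_inverse)
next
  case (Suc k)
  have 1: "Ck_on k UNIV (\<lambda>x. inverse (f x))"
    using Suc Ck_on_Suc_imp by blast
  show ?case
  proof (rule Ck_on_SucI)
    show "((\<lambda>x. inverse (f x)) has_derivative
        (\<lambda>h. (-1) * (inverse (f x) * frechet_derivative f (at x) h * inverse (f x)))) (at x)" for x
      using Deriv.has_derivative_inverse[OF assms(2) Ck_on_SucD(1)[OF Suc.prems], of x] by simp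
    show "Ck_on k UNIV (\<lambda>x. (-1) * (inverse (f x) * frechet_derivative f (at x) v * inverse (f x)))" for v
      by (intro Ck_on_mult 1 Ck_on_SucD(2)[OF Suc.prems] Ck_on_const)
  qed
qed

lemma Ck_on_Suc_real:
  assumes "\<And>x. (F has_real_derivative F' x) (at x)" "Ck_on k UNIV F'"
  shows "Ck_on (Suc k) UNIV F"
  by (rule Ck_on_SucI[where D = "\<lambda>x v. F' x * v"])
    (use assms in \<open>auto intro: Ck_on_mult simp: has_field_derivative_def\<close>)

lemma Ck_on_compose_real:
  fixes f :: "'a::real_normed_vector \<Rightarrow> real" and F :: "real \<Rightarrow> real"
  assumes "Ck_on k UNIV F" "Ck_on k UNIV f"
  shows "Ck_on k UNIV (\<lambda>x. F (f x))"
  using assms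
proof (induction k arbitrary: F)
  case 0
  then show ?case using continuous_on_compose2[of UNIV F UNIV f] by simp
next
  case (Suc k)
  \<comment> \<open>\<open>Ck_on\<close> controls a derivative along fixed vectors only, whereas the
    chain rule feeds \<open>F\<close> the varying direction
    \<open>frechet_derivative f (at x) h\<close>. That direction is a real number, so linearity
    pulls it out.\<close>
  have "frechet_derivative F (at y) = (\<lambda>h. h * frechet_derivative F (at y) 1)" for y
  proof
    show "frechet_derivative F (at y) h = h * frechet_derivative F (at y) 1" for h
      using linear_scale[OF has_derivative_linear[OF Ck_on_SucD(1)[OF Suc.prems(1)]], of y h 1] by simp
  qed
  then have F: "(F has_derivative (\<lambda>h. h * frechet_derivative F (at y) 1)) (at y)" for y
    using Ck_on_SucD(1)[OF Suc.prems(1), of y] by metis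
  show ?case
  proof (rule Ck_on_SucI)
    show "((\<lambda>x. F (f x)) has_derivative
       (\<lambda>h. frechet_derivative f (at x) h * frechet_derivative F (at (f x)) 1)) (at x)" for x
      using has_derivative_compose[OF Ck_on_SucD(1)[OF Suc.prems(2)] F] .
    show "Ck_on k UNIV (\<lambda>x. frechet_derivative f (at x) v * frechet_derivative F (at (f x)) 1)" for v
      by (rule Ck_on_mult[OF Ck_on_SucD(2)[OF Suc.prems(2)]
          Suc.IH[OF Ck_on_SucD(2)[OF Suc.prems(1)] Ck_on_Suc_imp[OF Suc.prems(2)]]])
  qed
qed

lemma Ck_on_compose_bounded_linear:
  assumes "bounded_linear L" "Ck_on k UNIV f"
  shows "Ck_on k UNIV (\<lambda>x. f (L x))"
  using assms(2)
proof (induction k arbitrary: f)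
  case 0
  then show ?case
    using continuous_on_compose2[of UNIV f UNIV L] linear_continuous_on[OF assms(1)] by simp
next
  case (Suc k)
  show ?case
    by (rule Ck_on_SucI[OF has_derivative_compose[OF bounded_linear_imp_has_derivative[OF assms(1)] Ck_on_SucD(1)[OF Suc.prems]]])
     (rule Suc.IH[OF Ck_on_SucD(2)[OF Suc.prems]])
qed

lemma Ck_on_inner_self: "Ck_on k UNIV (\<lambda>x::'a::real_inner. x \<bullet> x)"
proof (cases k)
  case 0
  then show ?thesis by (simp add: continuous_on_inner)
next
  case (Suc j)
  show ?thesis unfolding Suc
  proof (rule Ck_on_SucI)
    show "((\<lambda>x::'a. x \<bullet> x) has_derivative (\<lambda>h. 2 * (x \<bullet> h))) (at x)" for x
      by (auto intro!: derivative_eq_intros simp: inner_commute)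
    show "Ck_on j UNIV (\<lambda>x. 2 * (x \<bullet> v))" for v :: 'a
      by (intro Ck_on_mult Ck_on_const Ck_on_bounded_linear bounded_linear_inner_left)
  qed
qed

text \<open>The last hypothesis says that from every point of \<open>S\<close> one can move a little
  along each coordinate axis inside \<open>S\<close>. This makes derivatives within \<open>S\<close>
  unique, so those of \<open>g\<close> are restrictions of those of \<open>f\<close>. It is the
  bridge to smoothness up to the initial time.\<close>

lemma Ck_on_subset:
  assumes "Ck_on k UNIV f" "\<And>x. x \<in> S \<Longrightarrow> f x = g x"
    and S: "\<And>x i e. x \<in> S \<Longrightarrow> i \<in> Basis \<Longrightarrow> 0 < e \<Longrightarrow> \<exists>d. 0 < \<bar>d\<bar> \<and> \<bar>d\<bar> < e \<and> x + d *\<^sub>R i \<in> S"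
  shows "Ck_on k S (g :: 'a::euclidean_space \<Rightarrow> 'b::real_normed_vector)"
  using assms(1,2)
proof (induction k arbitrary: f g)
  case 0
  then have "continuous_on S f" using continuous_on_subset[of UNIV f S] by simp
  then show ?case using 0 continuous_on_cong[OF refl, of S f g] by auto
next
  case (Suc k)
  have g: "(g has_derivative frechet_derivative f (at x)) (at x within S)" if "x \<in> S" for x
    using has_derivative_at_withinI[OF Ck_on_SucD(1)[OF Suc.prems(1)]]
    by (rule has_derivative_transform_within[OF _ zero_less_one]) (use that Suc.prems in auto)
  have "frechet_derivative g (at x within S) = frechet_derivative f (at x)" if "x \<in> S" for x
    by (rule frechet_derivative_unique_within[OF _ g[OF that]])
      (use g[OF that] S that in \<open>auto simp: differentiable_def frechet_derivative_works[symmetric]\<close>)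
  then have "Ck_on k S (\<lambda>x. frechet_derivative g (at x within S) v)" for v
    by (intro Suc.IH[OF Ck_on_SucD(2)[OF Suc.prems(1), of v]]) auto
  then show ?case using g by (auto simp: differentiable_def)
qed

lemma Ck_on_power_series:
  fixes a :: "nat \<Rightarrow> real"
  assumes "\<And>x. summable (\<lambda>n. a n * x ^ n)"
  shows "Ck_on k UNIV (\<lambda>x. \<Sum>n. a n * x ^ n)"
  using assms
proof (induction k arbitrary: a)
  case 0
  then show ?case
    using termdiffs_strong_converges_everywhere[of a, THEN DERIV_isCont]
    by (auto intro!: continuous_at_imp_continuous_on)
next
  case (Suc k)
  show ?case
    by (rule Ck_on_Suc_real[OF termdiffs_strong_converges_everywhere[OF Suc.prems]])
      (intro Suc.IH termdiff_converges_all Suc.prems)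
qed

section \<open>A function that is flat at the origin, and the cutoffs made from it\<close>

lemma power_div_fact_le_exp:
  fixes x :: real
  assumes "x \<ge> 0" shows "x ^ m / fact m \<le> exp x"
proof -
  have "(\<Sum>k\<in>{m}. x ^ k / fact k) \<le> (\<Sum>k. x ^ k / fact k)"
    using summable_exp_generic[of x] assms
    by (intro sum_le_suminf) (auto simp: divide_inverse_commute scaleR_conv_of_real)
  then show ?thesis using assms by (simp add: exp_def divide_inverse_commute scaleR_conv_of_real)
qed

text \<open>The whole family over \<open>m\<close> is treated at once because its span is closed
  under differentiation; smoothness of each member is then a plain induction.\<close>

lemma DERIV_exp_minus_inverse:
  fixes x :: real
  defines "h \<equiv> \<lambda>m (x::real). if 0 < x then inverse x ^ m * exp (- inverse x) else 0"
  shows "(h m has_real_derivative h (m + 2) x - real m * h (m + 1) x) (at x)"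
proof (cases x "0::real" rule: linorder_cases)
  case less
  have "((\<lambda>x. 0) has_real_derivative 0) (at x)" by simp
  then have "(h m has_real_derivative 0) (at x)"
    by (rule has_field_derivative_transform_within_open[where S = "{..<0}"]) (use less in \<open>auto simp: h_def\<close>)
  then show ?thesis using less by (simp add: h_def)
next
  case greater
  \<comment> \<open>For \<open>m = 0\<close> the subtraction in the exponent is truncated, but the
    factor \<open>real m\<close> is then 0.\<close>
  have 1: "real m * inverse x ^ (m - Suc 0) * inverse x ^ 2 = real m * inverse x ^ (m + 1)"
    by (cases m) (auto simp: power2_eq_square mult_ac)
  have "((\<lambda>x. inverse x ^ m * exp (- inverse x)) has_real_derivative
      - (real m * inverse x ^ (m - Suc 0) * inverse x ^ 2) * exp (- inverse x)
      + inverse x ^ m * (exp (- inverse x) * inverse x ^ 2)) (at x)"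
    using greater by (auto intro!: derivative_eq_intros simp: power2_eq_square)
  then have "((\<lambda>x. inverse x ^ m * exp (- inverse x)) has_real_derivative
      h (m + 2) x - real m * h (m + 1) x) (at x)"
    unfolding 1 using greater by (simp add: h_def power_add power2_eq_square algebra_simps)
  then show ?thesis
    by (rule has_field_derivative_transform_within_open[where S = "{0<..}"]) (use greater in \<open>auto simp: h_def\<close>)
next
  case equal
  \<comment> \<open>One term of the exponential series suffices. Of its \<open>m + 2\<close> powers,
    \<open>m\<close> compensate \<open>inverse y ^ m\<close>; the other two make the difference
    quotient at 0 of order \<bar>y\<bar>.\<close>
  have small: "\<bar>h m y\<bar> \<le> fact (m + 2) * y\<^sup>2" for y
  proof (cases "y > 0")
    case True
    have "inverse y ^ (m + 2) * exp (- inverse y) \<le> fact (m + 2)"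
      using power_div_fact_le_exp[of "inverse y" "m + 2"] True
      by (simp add: divide_le_eq exp_minus field_simps del: fact_Suc power_Suc add_2_eq_Suc' power_inverse)
    then have "inverse y ^ (m + 2) * exp (- inverse y) * y\<^sup>2 \<le> fact (m + 2) * y\<^sup>2"
      by (intro mult_right_mono) auto
    moreover have "inverse y ^ (m + 2) * y\<^sup>2 = inverse y ^ m"
      using True by (simp add: power_add field_simps power2_eq_square)
    ultimately have "inverse y ^ m * exp (- inverse y) \<le> fact (m + 2) * y\<^sup>2"
      by (metis mult.assoc mult.commute)
    then show ?thesis using True by (simp add: h_def del: fact_Suc)
  qed (simp add: h_def)
  have "((\<lambda>y. h m y / y) \<longlongrightarrow> 0) (at 0)"
  proof (rule Lim_null_comparison)
    show "\<forall>\<^sub>F y in at 0. norm (h m y / y) \<le> fact (m + 2) * \<bar>y\<bar>"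
    proof (intro eventually_at_filter[THEN iffD2] always_eventually allI impI)
      fix y :: real assume "y \<noteq> 0"
      then show "norm (h m y / y) \<le> fact (m + 2) * \<bar>y\<bar>"
        using small[of y] by (simp add: abs_divide pos_divide_le_eq mult.assoc power2_eq_square del: fact_Suc)
    qed
    show "((\<lambda>y. fact (m + 2) * \<bar>y\<bar> :: real) \<longlongrightarrow> 0) (at 0)"
      by (auto intro!: tendsto_eq_intros)
  qed
  then show ?thesis using equal by (simp add: h_def has_field_derivative_iff)
qed

lemma Ck_on_exp_minus_inverse:
  "Ck_on k UNIV (\<lambda>x::real. if 0 < x then inverse x ^ m * exp (- inverse x) else 0)"
proof (induction k arbitrary: m)
  case 0
  show ?case unfolding Ck_on.simps
    by (intro continuous_at_imp_continuous_on ballI DERIV_isCont[OF DERIV_exp_minus_inverse])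
next
  case (Suc k)
  have "Ck_on k UNIV (\<lambda>x::real. (if 0 < x then inverse x ^ (m + 2) * exp (- inverse x) else 0) +
      (- real m) * (if 0 < x then inverse x ^ (m + 1) * exp (- inverse x) else 0))"
    by (intro Ck_on_add Ck_on_mult Ck_on_const Suc)
  then show ?case
    by (intro Ck_on_Suc_real[OF DERIV_exp_minus_inverse]) simp
qed

text \<open>With \<open>h\<close> the flat function, the cutoff is
  \<open>h (b - x) / (h (x - a) + h (b - x))\<close>. As \<open>a < b\<close>, the two arguments are
  never both nonpositive, so the denominator is positive. Sums and inverses replace differences and
  quotients to match the closure rules for \<open>Ck_on\<close>.\<close>

lemma smooth_cutoff:
  fixes a b :: real
  assumes "a < b"
  obtains \<eta> :: "real \<Rightarrow> real" where "\<And>k. Ck_on k UNIV \<eta>" "\<And>x. x \<le> a \<Longrightarrow> \<eta> x = 1"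
    "\<And>x. b \<le> x \<Longrightarrow> \<eta> x = 0" "\<And>x. 0 \<le> \<eta> x" "\<And>x. \<eta> x \<le> 1"
proof
  define h where "h \<equiv> \<lambda>x::real. if 0 < x then inverse x ^ 0 * exp (- inverse x) else 0"
  have h: "Ck_on k UNIV h" for k
    unfolding h_def by (rule Ck_on_exp_minus_inverse)
  have ha: "Ck_on k UNIV (\<lambda>x. h (x + - a))" "Ck_on k UNIV (\<lambda>x. h (b + (-1) * x))" for k
    by (intro Ck_on_compose_real[OF h] Ck_on_add Ck_on_mult Ck_on_const
      Ck_on_bounded_linear[OF bounded_linear_ident])+
  have pos: "0 < h (x + - a) + h (b + (-1) * x)" for x
    using assms by (auto simp: h_def add_pos_pos)
  let ?\<eta> = "\<lambda>x. h (b + (-1) * x) * inverse (h (x + - a) + h (b + (-1) * x))"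
  show "Ck_on k UNIV ?\<eta>" for k
    by (intro Ck_on_mult Ck_on_inverse Ck_on_add ha less_imp_neq[OF pos, symmetric])
  show "?\<eta> x = 1" if "x \<le> a" for x
    using that assms by (simp add: h_def)
  show "?\<eta> x = 0" if "b \<le> x" for x
    using that by (simp add: h_def)
  have nn: "h x \<ge> 0" for x by (simp add: h_def)
  show "0 \<le> ?\<eta> x" for x
    using nn pos[of x] by (intro mult_nonneg_nonneg) (auto intro: less_imp_le)
  show "?\<eta> x \<le> 1" for x
    unfolding divide_inverse[symmetric] by (subst divide_le_eq_1_pos[OF pos]) (use nn[of "x + - a"] in linarith)
qed

section \<open>Radial test functions and weak gradients\<close>

lemma ereal_le_less_trans: "a \<le> b \<Longrightarrow> ereal b < T \<Longrightarrow> ereal a < T"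
  by (rule le_less_trans[of _ "ereal b"]) simp_all

lemma test_functions_UNIV_I:
  assumes "\<And>k. Ck_on k UNIV g" and "\<And>x. r < norm x \<Longrightarrow> g x = 0"
  shows "g \<in> test_functions UNIV"
  unfolding test_functions_def smooth_on_def support_on_def
  using assms by (auto intro!: exI[of _ "cball 0 r"] simp: not_less[symmetric])

lemma Ck_on_half_open_cylinder:
  fixes f :: "real \<times> 'a::euclidean_space \<Rightarrow> real"
  assumes "Ck_on k UNIV f"
  shows "Ck_on k (half_open_interval T \<times> UNIV) f"
proof (rule Ck_on_subset[OF assms refl])
  fix z i :: "real \<times> 'a" and e :: real
  assume z: "z \<in> half_open_interval T \<times> UNIV" and i: "i \<in> Basis" and e: "e > 0"
  then obtain t where t: "fst z < t" "ereal t < T"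
    using ereal_dense2[of "ereal (fst z)" T] by (auto simp: half_open_interval_def)
  \<comment> \<open>A positive \<open>d\<close> never crosses the initial time, and the second bound
    keeps the point below \<open>T\<close>.\<close>
  define d where "d = min (e / 2) (t - fst z)"
  have "z + d *\<^sub>R i \<in> half_open_interval T \<times> UNIV"
  proof -
    have "fst i = 0 \<or> fst i = 1"
      using i by (auto simp: Basis_prod_def)
    moreover have "fst z + d \<le> t" "0 < d"
      using t e by (auto simp: d_def)
    ultimately have "fst z \<le> fst (z + d *\<^sub>R i)" "fst (z + d *\<^sub>R i) \<le> t"
      using t by auto
    then show ?thesis
      using z t ereal_le_less_trans by (auto simp: half_open_interval_def mem_Times_iff)
  qed
  moreover have "0 < d" "d < e" using t e by (auto simp: d_def)
  ultimately show "\<exists>d. 0 < \<bar>d\<bar> \<and> \<bar>d\<bar> < e \<and> z + d *\<^sub>R i \<in> half_open_interval T \<times> UNIV"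
    by (intro exI[of _ d]) auto
qed

lemma test_functions_cylinder_I:
  fixes \<eta> :: "real \<Rightarrow> real" and g :: "'a::euclidean_space \<Rightarrow> real"
  assumes \<eta>: "\<And>k. Ck_on k UNIV \<eta>" "\<And>s. b \<le> s \<Longrightarrow> \<eta> s = 0" "ereal b < T"
    and g: "\<And>k. Ck_on k UNIV g" "\<And>x. r < norm x \<Longrightarrow> g x = 0"
  shows "(\<lambda>z. \<eta> (fst z) * g (snd z)) \<in> test_functions (half_open_interval T \<times> UNIV)"
proof -
  have "Ck_on k UNIV (\<lambda>z. \<eta> (fst z) * g (snd z))" for k
    by (intro Ck_on_mult Ck_on_compose_bounded_linear[OF bounded_linear_fst]
      Ck_on_compose_bounded_linear[OF bounded_linear_snd] \<eta> g)
  moreover have "compact ({0..b} \<times> cball (0::'a) r)"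
    by (intro compact_Times) auto
  moreover have "{0..b} \<times> cball (0::'a) r \<subseteq> half_open_interval T \<times> UNIV"
    using \<eta>(3) ereal_le_less_trans by (auto simp: half_open_interval_def)
  moreover have "support_on (half_open_interval T \<times> UNIV) (\<lambda>z. \<eta> (fst z) * g (snd z))
      \<subseteq> {0..b} \<times> cball 0 r"
    using \<eta>(2) g(2) by (force simp: support_on_def half_open_interval_def not_le[symmetric])
  ultimately show ?thesis
    unfolding test_functions_def smooth_on_def
    by (blast intro: Ck_on_half_open_cylinder)
qed

lemma grad_eqI:
  assumes "(f has_derivative D) (at x)"
  shows "grad f x = (\<chi> i. D (axis i 1))"
  using frechet_derivative_at[OF assms] by (simp add: grad_def)

lemma DERIV_eq_on_open:
  assumes "(F has_real_derivative a) (at x)" "(G has_real_derivative b) (at x)"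
    and "open S" "x \<in> S" "\<And>y. y \<in> S \<Longrightarrow> F y = G y"
  shows "a = b"
  using has_field_derivative_transform_within_open[OF assms(1,3-5)] assms(2) by (blast intro: DERIV_unique)

lemma has_derivative_radial:
  fixes x :: "'a::real_inner"
  assumes "\<And>s. (G has_real_derivative G1 s) (at s)"
  shows "((\<lambda>x. G (x \<bullet> x)) has_derivative (\<lambda>h. 2 * G1 (x \<bullet> x) * (x \<bullet> h))) (at x)"
proof -
  have "((\<lambda>x::'a. x \<bullet> x) has_derivative (\<lambda>h. 2 * (x \<bullet> h))) (at x)"
    by (auto intro!: derivative_eq_intros simp: inner_commute)
  from has_derivative_compose[OF this assms[unfolded has_field_derivative_def]]
  show ?thesis by (simp add: mult_ac)
qed

lemma grad_radial:
  fixes x :: "real ^ 'n::finite"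
  assumes "\<And>s. (G has_real_derivative G1 s) (at s)"
  shows "grad (\<lambda>x. G (x \<bullet> x)) x = (2 * G1 (x \<bullet> x)) *\<^sub>R x"
  using grad_eqI[OF has_derivative_radial[OF assms]]
  by (simp add: vec_eq_iff inner_axis)

text \<open>The function is the i-th partial derivative of \<open>G (x \<bullet> x)\<close>. The
  i-th components of these gradients add up to the Laplacian
  \<open>2 * n * G1 + 4 * \<bar>x\<bar>\<^sup>2 * G2\<close> in dimension n.\<close>

lemma grad_radial_component:
  fixes x :: "real ^ 'n::finite"
  assumes "\<And>s. (G1 has_real_derivative G2 s) (at s)"
  shows "grad (\<lambda>x. 2 * G1 (x \<bullet> x) * x $ i) x =
    (4 * G2 (x \<bullet> x) * x $ i) *\<^sub>R x + (2 * G1 (x \<bullet> x)) *\<^sub>R axis i 1"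
proof -
  have "((\<lambda>x. 2 * G1 (x \<bullet> x) * x $ i) has_derivative
     (\<lambda>h. 2 * G1 (x \<bullet> x) * h $ i + 2 * (2 * G2 (x \<bullet> x) * (x \<bullet> h)) * x $ i)) (at x)"
    by (intro has_derivative_mult has_derivative_mult_right has_derivative_radial assms
      bounded_linear_imp_has_derivative bounded_linear_vec_nth)
  from grad_eqI[OF this] show ?thesis
    by (simp add: vec_eq_iff inner_axis algebra_simps) (auto simp: axis_def)
qed

lemma Ck_on_radial:
  fixes G :: "real \<Rightarrow> real"
  assumes "Ck_on k UNIV G"
  shows "Ck_on k UNIV (\<lambda>x::'a::real_inner. G (x \<bullet> x))"
  using Ck_on_compose_real[OF assms Ck_on_inner_self] .

lemma Ck_on_real_derivative:
  assumes "\<And>k. Ck_on k UNIV G" "\<And>s. (G has_real_derivative G1 s) (at s)"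
  shows "Ck_on k UNIV G1"
proof -
  have "frechet_derivative G (at s) 1 = G1 s" for s
    using frechet_derivative_at[OF assms(2)[unfolded has_field_derivative_def]] by (metis mult.right_neutral)
  then show ?thesis
    using Ck_on_SucD(2)[OF assms(1), of k 1] by simp
qed

section \<open>Pairings in L^2 and integration by parts\<close>

lemma
  fixes f :: "'a::euclidean_space \<Rightarrow> 'b::euclidean_space" and g :: "'a \<Rightarrow> real"
  assumes f: "f \<in> L2" and g: "g \<in> L2"
  shows L2_integrable_scaleR: "integrable lborel (\<lambda>x. g x *\<^sub>R f x)"
    and L2_Cauchy_Schwarz: "norm (LINT x|lborel. g x *\<^sub>R f x) \<le> L2_norm g * L2_norm f"
proof -
  have [measurable]: "f \<in> borel_measurable lborel" "g \<in> borel_measurable lborel"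
    and fi: "integrable lborel (\<lambda>x. (norm (f x))\<^sup>2)" and gi: "integrable lborel (\<lambda>x. (g x)\<^sup>2)"
    using f g by (auto simp: L2_def)
  have am: "\<bar>g x\<bar> * norm (f x) \<le> ((norm (f x))\<^sup>2 + (g x)\<^sup>2) / 2" for x
    using sum_squares_bound[of "\<bar>g x\<bar>" "norm (f x)"] by (simp add: power2_eq_square)
  have ni: "integrable lborel (\<lambda>x. \<bar>g x\<bar> * norm (f x))"
    by (rule Bochner_Integration.integrable_bound[where f = "\<lambda>x. ((norm (f x))\<^sup>2 + (g x)\<^sup>2) / 2"])
      (use fi gi am in \<open>auto intro!: order_trans[OF am]\<close>)
  show "integrable lborel (\<lambda>x. g x *\<^sub>R f x)"
    by (rule Bochner_Integration.integrable_bound[OF ni]) auto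
  define I where "I = (LINT x|lborel. \<bar>g x\<bar> * norm (f x))"
  define A where "A = (LINT x|lborel. (g x)\<^sup>2)"
  define B where "B = (LINT x|lborel. (norm (f x))\<^sup>2)"
  \<comment> \<open>A form in two variables avoids dividing by \<open>A\<close> or \<open>B\<close>:
    the choices \<open>(B, I)\<close> and \<open>(I, A)\<close> give
    \<open>B * (A * B - I\<^sup>2) \<ge> 0\<close> and
    \<open>A * (A * B - I\<^sup>2) \<ge> 0\<close>, and only \<open>A = B = 0\<close> needs a
    separate argument.\<close>
  have quad: "0 \<le> c\<^sup>2 * A - 2 * c * d * I + d\<^sup>2 * B" for c d
  proof -
    have "0 \<le> (LINT x|lborel. (c * \<bar>g x\<bar> - d * norm (f x))\<^sup>2)" by simp
    also have "\<dots> = (LINT x|lborel. c\<^sup>2 * (g x)\<^sup>2 - 2 * c * d * (\<bar>g x\<bar> * norm (f x)) + d\<^sup>2 * (norm (f x))\<^sup>2)"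
      by (intro Bochner_Integration.integral_cong refl) (simp add: power2_diff power_mult_distrib mult_ac)
    also have "\<dots> = c\<^sup>2 * A - 2 * c * d * I + d\<^sup>2 * B"
      unfolding A_def B_def I_def using fi gi ni by simp
    finally show ?thesis .
  qed
  have AB: "0 \<le> A" "0 \<le> B" by (auto simp: A_def B_def)
  have I0: "0 \<le> I" by (auto simp: I_def)
  have "I\<^sup>2 \<le> A * B"
  proof (cases "B = 0 \<and> A = 0")
    case True
    then show ?thesis using quad[of 1 1] I0 by simp
  next
    case False
    have "0 \<le> B * (A * B - I\<^sup>2)" "0 \<le> A * (A * B - I\<^sup>2)"
      using quad[of B I] quad[of I A] by (simp_all add: power2_eq_square algebra_simps)
    then show ?thesis
      using False AB by (auto simp: zero_le_mult_iff)
  qed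
  then have "I \<le> sqrt A * sqrt B"
    by (simp add: real_le_rsqrt flip: real_sqrt_mult)
  moreover have "norm (LINT x|lborel. g x *\<^sub>R f x) \<le> I"
    unfolding I_def using integral_norm_bound[of lborel "\<lambda>x. g x *\<^sub>R f x"] by simp
  ultimately show "norm (LINT x|lborel. g x *\<^sub>R f x) \<le> L2_norm g * L2_norm f"
    by (simp add: L2_norm_def A_def B_def)
qed

lemma continuous_compact_support_integrable:
  fixes f :: "'a::euclidean_space \<Rightarrow> 'b::euclidean_space"
  assumes "continuous_on UNIV f" "\<And>x. r < norm x \<Longrightarrow> f x = 0"
  shows "integrable lborel f"
proof -
  have "integrable lborel (\<lambda>x. indicator (cball 0 r) x *\<^sub>R f x)"
    by (intro borel_integrable_compact continuous_on_subset[OF assms(1)]) auto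
  moreover have "(\<lambda>x. indicator (cball 0 r) x *\<^sub>R f x) = f"
    using assms(2) by (auto simp: indicator_def fun_eq_iff)
  ultimately show ?thesis by simp
qed

lemma continuous_compact_support_L2:
  fixes f :: "'a::euclidean_space \<Rightarrow> 'b::euclidean_space"
  assumes "continuous_on UNIV f" "\<And>x. r < norm x \<Longrightarrow> f x = 0"
  shows "f \<in> L2"
proof -
  have "integrable lborel (\<lambda>x. (norm (f x))\<^sup>2)"
    by (rule continuous_compact_support_integrable[of _ r]) (use assms in \<open>auto intro!: continuous_intros\<close>)
  then show ?thesis
    using assms(1) by (auto simp: L2_def intro: borel_measurable_continuous_onI)
qed

lemma weak_gradI: "u \<in> H1 \<Longrightarrow> is_weak_gradient u (weak_grad u)"
  using someI_ex[of "is_weak_gradient u"] by (auto simp: H1_def weak_grad_def)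

text \<open>A weak gradient comes with vector-valued identities, one for each scalar test function.
  Here the test functions are the partial derivatives of \<open>G (x \<bullet> x)\<close>; the i-th
  coordinate of the identity for the i-th of them is kept, and the sum over i moves the Laplacian
  onto the radial function.\<close>

lemma weak_grad_radial:
  fixes u :: "real ^ 'n::finite \<Rightarrow> real" and G G1 G2 :: "real \<Rightarrow> real"
  assumes u: "u \<in> H1"
    and G: "\<And>k. Ck_on k UNIV G" "\<And>s. (G has_real_derivative G1 s) (at s)"
    and G2: "\<And>s. (G1 has_real_derivative G2 s) (at s)"
    and supp: "\<And>s. b < s \<Longrightarrow> G s = 0" and b: "b > 0"
  shows "(LINT x|lborel. weak_grad u x \<bullet> grad (\<lambda>y. G (y \<bullet> y)) x) =
    - (LINT x|lborel. u x * (2 * CARD('n) * G1 (x \<bullet> x) + 4 * (x \<bullet> x) * G2 (x \<bullet> x)))"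
proof -
  have supp1: "G1 s = 0" if "b < s" for s
    using DERIV_eq_on_open[of G "G1 s" s "\<lambda>_. 0" 0 "{b<..}"] G(2) that supp by auto
  have supp2: "G2 s = 0" if "b < s" for s
    using DERIV_eq_on_open[of G1 "G2 s" s "\<lambda>_. 0" 0 "{b<..}"] G2 that supp1 by auto
  have out: "b < x \<bullet> x" if "sqrt b < norm x" for x :: "real ^ 'n"
    using power_strict_mono[OF that, of 2] b by (simp add: power2_norm_eq_inner)
  have CG1: "Ck_on k UNIV G1" for k by (rule Ck_on_real_derivative[OF G])
  have CG2: "Ck_on k UNIV G2" for k by (rule Ck_on_real_derivative[OF CG1 G2])
  have cont: "continuous_on UNIV (\<lambda>x::real^'n. G1 (x \<bullet> x))" "continuous_on UNIV (\<lambda>x::real^'n. G2 (x \<bullet> x))"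
    using Ck_on_radial[OF CG1, of 0] Ck_on_radial[OF CG2, of 0] by auto
  define w where "w = weak_grad u"
  have w: "w \<in> L2" and uL: "u \<in> L2"
    using weak_gradI[OF u] u by (auto simp: w_def is_weak_gradient_def H1_def)
  let ?d = "\<lambda>i x::real^'n. 2 * G1 (x \<bullet> x) * x $ i"
  have "Ck_on k UNIV (?d i)" for k i
    by (rule Ck_on_mult[OF Ck_on_mult[OF Ck_on_const Ck_on_radial[OF CG1]]
        Ck_on_bounded_linear[OF bounded_linear_vec_nth]])
  then have dt: "?d i \<in> test_functions UNIV" for i
    by (rule test_functions_UNIV_I[where r = "sqrt b"]) (simp add: supp1 out)
  have dc: "continuous_on UNIV (?d i)" for i
    by (intro continuous_intros cont)
  have gd: "grad (?d i) x = (4 * G2 (x \<bullet> x) * x $ i) *\<^sub>R x + (2 * G1 (x \<bullet> x)) *\<^sub>R axis i 1" for i x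
    by (rule grad_radial_component[OF G2])
  have int1: "integrable lborel (\<lambda>x. u x *\<^sub>R grad (?d i) x)" for i
    unfolding gd
    by (intro L2_integrable_scaleR uL continuous_compact_support_L2[where r = "sqrt b"] continuous_intros cont)
      (simp add: supp1 supp2 out)
  have int2: "integrable lborel (\<lambda>x. ?d i x *\<^sub>R w x)" for i
    by (intro L2_integrable_scaleR w continuous_compact_support_L2[where r = "sqrt b"] dc)
      (simp add: supp1 out)
  have comp: "(LINT x|lborel. u x * (4 * G2 (x \<bullet> x) * (x $ i)\<^sup>2 + 2 * G1 (x \<bullet> x))) = - (LINT x|lborel. ?d i x * w x $ i)" for i
  proof -
    have "(LINT x|lborel. u x *\<^sub>R grad (?d i) x) = - (LINT x|lborel. ?d i x *\<^sub>R w x)"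
      using weak_gradI[OF u] dt[of i] by (simp add: is_weak_gradient_def w_def)
    then have "(LINT x|lborel. u x *\<^sub>R grad (?d i) x) \<bullet> axis i 1 = - ((LINT x|lborel. ?d i x *\<^sub>R w x) \<bullet> axis i 1)"
      by simp
    also have "(LINT x|lborel. u x *\<^sub>R grad (?d i) x) \<bullet> axis i 1 = (LINT x|lborel. (u x *\<^sub>R grad (?d i) x) \<bullet> axis i 1)"
      by (rule integral_inner_left[symmetric]) (rule int1)
    also have "(LINT x|lborel. ?d i x *\<^sub>R w x) \<bullet> axis i 1 = (LINT x|lborel. (?d i x *\<^sub>R w x) \<bullet> axis i 1)"
      by (rule integral_inner_left[symmetric]) (rule int2)
    finally show ?thesis
      unfolding gd by (simp add: inner_axis inner_add_left power2_eq_square mult_ac)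
  qed
  have ci1: "integrable lborel (\<lambda>x. u x * (4 * G2 (x \<bullet> x) * (x $ i)\<^sup>2 + 2 * G1 (x \<bullet> x)))" for i
    using integrable_inner_left[of "axis i 1", OF int1[of i]]
    unfolding gd by (simp add: inner_axis inner_add_left power2_eq_square mult_ac)
  have ci2: "integrable lborel (\<lambda>x. ?d i x * w x $ i)" for i
    using integrable_inner_left[of "axis i 1", OF int2[of i]]
    by (simp add: inner_axis mult_ac)
  have "(LINT x|lborel. w x \<bullet> grad (\<lambda>y. G (y \<bullet> y)) x) = (LINT x|lborel. (\<Sum>i\<in>UNIV. ?d i x * w x $ i))"
    unfolding grad_radial[OF G(2)] by (simp add: inner_vec_def sum_distrib_left mult_ac)
  also have "\<dots> = (\<Sum>i\<in>UNIV. LINT x|lborel. ?d i x * w x $ i)"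
    by (rule Bochner_Integration.integral_sum) (rule ci2)
  also have "\<dots> = - (\<Sum>i\<in>UNIV. LINT x|lborel. u x * (4 * G2 (x \<bullet> x) * (x $ i)\<^sup>2 + 2 * G1 (x \<bullet> x)))"
    unfolding comp by (simp add: sum_negf)
  also have "(\<Sum>i\<in>UNIV. LINT x|lborel. u x * (4 * G2 (x \<bullet> x) * (x $ i)\<^sup>2 + 2 * G1 (x \<bullet> x)))
     = (LINT x|lborel. (\<Sum>i\<in>UNIV. u x * (4 * G2 (x \<bullet> x) * (x $ i)\<^sup>2 + 2 * G1 (x \<bullet> x))))"
    by (rule Bochner_Integration.integral_sum[symmetric]) (rule ci1)
  also have "\<dots> = (LINT x|lborel. u x * (2 * CARD('n) * G1 (x \<bullet> x) + 4 * (x \<bullet> x) * G2 (x \<bullet> x)))"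
  proof (intro Bochner_Integration.integral_cong refl)
    fix x :: "real ^ 'n"
    have "(\<Sum>i\<in>UNIV. u x * (4 * G2 (x \<bullet> x) * (x $ i)\<^sup>2 + 2 * G1 (x \<bullet> x))) =
        u x * (4 * G2 (x \<bullet> x) * (\<Sum>i\<in>UNIV. (x $ i)\<^sup>2) + CARD('n) * (2 * G1 (x \<bullet> x)))"
      by (simp add: sum.distrib sum_distrib_left[symmetric])
    also have "(\<Sum>i\<in>UNIV. (x $ i)\<^sup>2) = x \<bullet> x"
      by (simp add: inner_vec_def power2_eq_square)
    finally show "(\<Sum>i\<in>UNIV. u x * (4 * G2 (x \<bullet> x) * (x $ i)\<^sup>2 + 2 * G1 (x \<bullet> x))) =
        u x * (2 * CARD('n) * G1 (x \<bullet> x) + 4 * (x \<bullet> x) * G2 (x \<bullet> x))"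
      by (simp add: algebra_simps)
  qed
  finally show ?thesis by (simp add: w_def)
qed

section \<open>The radial eigenfunction of the Laplacian\<close>

text \<open>In dimension n = m + 1 the Laplacian multiplies
  \<open>\<bar>x\<bar> ^ (2 * k + 2)\<close> by
  \<open>(2 * k + 2) * (2 * k + n) / \<bar>x\<bar>\<^sup>2\<close>, and the factors undo this. The
  resulting function of r = \<bar>x\<bar> is the mean of \<open>exp (x \<bullet> w)\<close> over
  unit vectors \<open>w\<close>, a multiple of r^(1 - n/2) times the modified Bessel function of
  order n/2 - 1; for \<open>m = 0\<close> it is cosh.\<close>

definition bessel_coeff :: "nat \<Rightarrow> nat \<Rightarrow> real" where
  "bessel_coeff m k = (\<Prod>j<k. 1 / (2 * (real j + 1) * (2 * real j + real m + 1)))"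

definition bessel :: "nat \<Rightarrow> real \<Rightarrow> real" where
  "bessel m s = (\<Sum>k. bessel_coeff m k * s ^ k)"

lemma bessel_coeff_pos: "bessel_coeff m k > 0"
  unfolding bessel_coeff_def by (intro prod_pos) auto

lemma bessel_coeff_Suc:
  "2 * (real k + 1) * (2 * real k + real m + 1) * bessel_coeff m (Suc k) = bessel_coeff m k"
proof -
  have "2 * (real k + 1) * (2 * real k + real m + 1) \<noteq> 0" by simp
  then show ?thesis by (simp add: bessel_coeff_def)
qed

lemma bessel_coeff_le: "bessel_coeff m k \<le> 1 / fact k"
proof (induction k)
  case 0
  then show ?case by (simp add: bessel_coeff_def)
next
  case (Suc k)
  have "bessel_coeff m (Suc k) = bessel_coeff m k * (1 / (2 * (real k + 1) * (2 * real k + real m + 1)))"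
    by (simp add: bessel_coeff_def)
  also have "\<dots> \<le> 1 / fact k * (1 / (real k + 1))"
  proof (rule mult_mono[OF Suc.IH])
    have "(real k + 1) * 1 \<le> (real k + 1) * (2 * (2 * real k + real m + 1))"
      by (intro mult_left_mono) auto
    then have "real k + 1 \<le> 2 * (real k + 1) * (2 * real k + real m + 1)"
      by (simp only: mult.assoc mult.left_commute mult_1_right)
    then show "1 / (2 * (real k + 1) * (2 * real k + real m + 1)) \<le> 1 / (real k + 1)"
      by (intro divide_left_mono mult_pos_pos) auto
  qed auto
  finally show ?case by (simp add: add.commute mult.commute)
qed

lemma summable_bessel: "summable (\<lambda>k. bessel_coeff m k * s ^ k)"
proof (rule summable_comparison_test)
  show "summable (\<lambda>k. inverse (fact k) * \<bar>s\<bar> ^ k)" by (rule summable_exp)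
  have "norm (bessel_coeff m k * s ^ k) \<le> inverse (fact k) * \<bar>s\<bar> ^ k" for k
    using mult_right_mono[OF bessel_coeff_le[of m k], of "\<bar>s\<bar> ^ k"] bessel_coeff_pos[of m k]
    by (simp add: abs_mult power_abs inverse_eq_divide)
  then show "\<exists>N. \<forall>k\<ge>N. norm (bessel_coeff m k * s ^ k) \<le> inverse (fact k) * \<bar>s\<bar> ^ k"
    by blast
qed

lemma Ck_on_bessel: "Ck_on k UNIV (bessel m)"
  using Ck_on_power_series[OF summable_bessel] by (simp add: bessel_def[abs_def])

lemma bessel_ge_1: "0 \<le> s \<Longrightarrow> 1 \<le> bessel m s"
  unfolding bessel_def
  using sum_le_suminf[OF summable_bessel[of m s], of "{0}"] bessel_coeff_pos[of m]
  by (simp add: bessel_coeff_def less_imp_le)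

text \<open>With \<open>s = \<bar>x\<bar>\<^sup>2\<close> in dimension \<open>m + 1\<close> this ODE says that
  \<open>bessel m (\<bar>x\<bar>\<^sup>2)\<close> is a positive eigenfunction of the Laplacian with eigenvalue 1.\<close>

lemma bessel_ODE:
  obtains F1 F2 where "\<And>s. (bessel m has_real_derivative F1 s) (at s)"
    "\<And>s. (F1 has_real_derivative F2 s) (at s)"
    "\<And>s. 2 * real (m + 1) * F1 s + 4 * s * F2 s = bessel m s"
proof
  let ?a = "bessel_coeff m"
  let ?F1 = "\<lambda>s. \<Sum>k. diffs ?a k * s ^ k" and ?F2 = "\<lambda>s. \<Sum>k. diffs (diffs ?a) k * s ^ k"
  have sum1: "summable (\<lambda>k. diffs ?a k * s ^ k)" for s
    by (rule termdiff_converges_all[OF summable_bessel])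
  have sum2: "summable (\<lambda>k. diffs (diffs ?a) k * s ^ k)" for s
    by (rule termdiff_converges_all[OF sum1])
  show "(bessel m has_real_derivative ?F1 s) (at s)" for s
    unfolding bessel_def[abs_def] by (rule termdiffs_strong_converges_everywhere[OF summable_bessel])
  show "(?F1 has_real_derivative ?F2 s) (at s)" for s
    by (rule termdiffs_strong_converges_everywhere[OF sum1])
  show "2 * real (m + 1) * ?F1 s + 4 * s * ?F2 s = bessel m s" for s
  proof -
    have "(\<lambda>k. real (Suc k) * diffs ?a (Suc k) * s ^ Suc k) sums (s * ?F2 s)"
      using sums_mult[OF summable_sums[OF sum2], of s s] by (simp add: diffs_def mult_ac)
    then have "(\<lambda>k. real k * diffs ?a k * s ^ k) sums (s * ?F2 s)"
      by (subst (asm) sums_Suc_iff) simp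
    from sums_add[OF sums_mult[OF summable_sums[OF sum1], of "2 * real (m + 1)" s] sums_mult[OF this, of 4]]
    have "(\<lambda>k. 2 * real (m + 1) * (diffs ?a k * s ^ k) + 4 * (real k * diffs ?a k * s ^ k)) sums
      (2 * real (m + 1) * ?F1 s + 4 * s * ?F2 s)" by (simp add: mult_ac)
    moreover have "2 * real (m + 1) * (diffs ?a k * s ^ k) + 4 * (real k * diffs ?a k * s ^ k) = ?a k * s ^ k" for k
      using bessel_coeff_Suc[of k m, symmetric] by (simp add: diffs_def algebra_simps)
    ultimately show ?thesis
      unfolding bessel_def by (simp add: sums_iff)
  qed
qed

section \<open>Growth of the eigenfunction\<close>

lemma sum_power_div_fact_le_exp:
  fixes r :: real
  assumes "0 \<le> r"
  shows "(\<Sum>k<K. r ^ (2 * k + m) / fact (2 * k + m)) \<le> exp r"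
proof -
  have "(\<Sum>k<K. r ^ (2 * k + m) / fact (2 * k + m)) \<le> (\<Sum>j<2 * K + m. r ^ j / fact j)"
  proof (induction K)
    case 0
    then show ?case using assms by (simp add: sum_nonneg)
  next
    case (Suc K)
    then show ?case using assms by (simp add: add_increasing2 del: fact_Suc power_Suc)
  qed
  also have "\<dots> \<le> (\<Sum>j. r ^ j / fact j)"
    using assms summable_exp_generic[of r]
    by (intro sum_le_suminf) (auto simp: divide_inverse_commute)
  finally show ?thesis
    by (simp add: exp_def divide_inverse_commute)
qed

text \<open>The numbers \<open>b k = fact (2 * k) * bessel_coeff m k\<close> are the even moments of
  a coordinate on the unit sphere, and the claim is that they decay like
  \<open>k powr (- m / 2)\<close>. They satisfy \<open>b (k + 1) = b k * X / (X + m)\<close> with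
  \<open>X = 2 * k + 1\<close>, so the induction comes down to
  \<open>X * (X + m + 1) \<le> (X + 1) * (X + m)\<close>, whose sides differ by
  \<open>m\<close>.\<close>

lemma bessel_coeff_sq_le: "(fact (2 * k) * bessel_coeff m k)\<^sup>2 * fact (2 * k + m) \<le> fact m * fact (2 * k)"
proof (induction k)
  case 0
  then show ?case by (simp add: bessel_coeff_def)
next
  case (Suc k)
  define b where "b = fact (2 * k) * bessel_coeff m k"
  define X where "X = 2 * real k + 1"
  have X: "X > 0" by (simp add: X_def)
  have "fact (2 * Suc k) * bessel_coeff m (Suc k) = (X + 1) * X * fact (2 * k) * bessel_coeff m (Suc k)"
    by (simp add: X_def algebra_simps)
  also have "\<dots> * (X + m) = X * b"
    using bessel_coeff_Suc[of k m, symmetric] by (simp add: X_def b_def algebra_simps)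
  finally have 1: "fact (2 * Suc k) * bessel_coeff m (Suc k) = X * b / (X + m)"
    using X by (simp add: field_simps)
  have 2: "fact (2 * Suc k + m) = (X + m + 1) * (X + m) * fact (2 * k + m)"
    by (simp add: X_def algebra_simps)
  have 3: "(fact (2 * Suc k) :: real) = (X + 1) * X * fact (2 * k)"
    by (simp add: X_def algebra_simps)
  have "(X * b / Y)\<^sup>2 * ((Y + 1) * Y * f) = (b\<^sup>2 * f) * (X\<^sup>2 * (Y + 1) / Y)" if "Y > 0" for Y f :: real
    using that by (simp add: power2_eq_square field_simps)
  from this[of "X + m"] have "(X * b / (X + m))\<^sup>2 * ((X + m + 1) * (X + m) * fact (2 * k + m)) =
      (b\<^sup>2 * fact (2 * k + m)) * (X\<^sup>2 * (X + m + 1) / (X + m))"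
    using X by simp
  also have "\<dots> \<le> (fact m * fact (2 * k)) * (X * (X + 1))"
  proof (rule mult_mono)
    show "b\<^sup>2 * fact (2 * k + m) \<le> fact m * fact (2 * k)"
      using Suc.IH by (simp add: b_def)
    have "X * (X + m + 1) \<le> (X + 1) * (X + m)"
      by (simp add: algebra_simps)
    then have "X * (X * (X + m + 1)) \<le> X * ((X + 1) * (X + m))"
      using X by (intro mult_left_mono) auto
    then show "X\<^sup>2 * (X + m + 1) / (X + m) \<le> X * (X + 1)"
      using X by (simp add: pos_divide_le_eq power2_eq_square mult_ac)
  qed (use X in auto)
  finally show ?case unfolding 1 unfolding 2 3 by (simp add: mult_ac)
qed

text \<open>The series is the sum of \<open>P k * b k\<close>, with \<open>P k\<close> from the
  exponential series. Cauchy-Schwarz with weights \<open>P k\<close> leaves the sum of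
  \<open>P k\<close>, at most \<open>exp r\<close>, and the sum of
  \<open>P k * (b k)\<^sup>2\<close>. By the decay of \<open>b k\<close>, \<open>r ^ m\<close> times
  the latter is again bounded by terms of the exponential series. No Bessel asymptotics
  enter.\<close>

lemma bessel_sq_growth:
  assumes "0 \<le> r"
  shows "r ^ m * (bessel m (r\<^sup>2))\<^sup>2 \<le> fact m * exp (2 * r)"
proof -
  define S where "S = (\<lambda>K. \<Sum>k<K. bessel_coeff m k * (r\<^sup>2) ^ k)"
  have "(\<lambda>K. r ^ m * (S K)\<^sup>2) \<longlonglongrightarrow> r ^ m * (bessel m (r\<^sup>2))\<^sup>2"
    unfolding S_def bessel_def
    by (intro tendsto_intros summable_LIMSEQ summable_bessel)
  moreover have "r ^ m * (S K)\<^sup>2 \<le> fact m * exp (2 * r)" for K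
  proof -
    define P where "P = (\<lambda>k. r ^ (2 * k) / fact (2 * k))"
    define b where "b = (\<lambda>k. fact (2 * k) * bessel_coeff m k)"
    have PB: "P k * b k = bessel_coeff m k * (r\<^sup>2) ^ k" for k
      by (simp add: P_def b_def power_mult)
    have P: "P k \<ge> 0" for k using assms by (simp add: P_def)
    have "S K = (\<Sum>k<K. sqrt (P k) * (sqrt (P k) * b k))"
      unfolding S_def
    proof (rule sum.cong)
      fix k
      have "sqrt (P k) * (sqrt (P k) * b k) = P k * b k"
        using P[of k] by (simp flip: mult.assoc)
      then show "bessel_coeff m k * (r\<^sup>2) ^ k = sqrt (P k) * (sqrt (P k) * b k)"
        using PB by simp
    qed simp
    then have "(S K)\<^sup>2 \<le> (\<Sum>k<K. (sqrt (P k))\<^sup>2) * (\<Sum>k<K. (sqrt (P k) * b k)\<^sup>2)"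
      using Cauchy_Schwarz_ineq_sum by metis
    also have "\<dots> = (\<Sum>k<K. P k) * (\<Sum>k<K. P k * (b k)\<^sup>2)"
      using P by (simp add: power_mult_distrib)
    finally have "r ^ m * (S K)\<^sup>2 \<le> r ^ m * ((\<Sum>k<K. P k) * (\<Sum>k<K. P k * (b k)\<^sup>2))"
      using assms by (intro mult_left_mono) auto
    also have "\<dots> = (\<Sum>k<K. P k) * (\<Sum>k<K. r ^ m * (P k * (b k)\<^sup>2))"
      by (simp add: sum_distrib_left mult_ac)
    also have "\<dots> \<le> exp r * (\<Sum>k<K. fact m * (r ^ (2 * k + m) / fact (2 * k + m)))"
    proof (rule mult_mono[OF _ sum_mono])
      show "sum P {..<K} \<le> exp r"
        using sum_power_div_fact_le_exp[OF assms, of 0 K] by (simp add: P_def)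
      fix k
      have "r ^ (2 * k + m) * ((b k)\<^sup>2 * fact (2 * k + m)) \<le> r ^ (2 * k + m) * (fact m * fact (2 * k))"
        using bessel_coeff_sq_le[of k m] assms by (intro mult_left_mono) (auto simp: b_def)
      then show "r ^ m * (P k * (b k)\<^sup>2) \<le> fact m * (r ^ (2 * k + m) / fact (2 * k + m))"
        by (simp add: P_def power_add field_simps)
    qed (use assms P in \<open>auto intro!: sum_nonneg\<close>)
    also have "\<dots> \<le> exp r * (fact m * exp r)"
      unfolding sum_distrib_left[symmetric]
      by (intro mult_left_mono sum_power_div_fact_le_exp assms) auto
    finally show ?thesis by (simp add: mult_exp_exp mult_ac)
  qed
  ultimately show ?thesis
    using LIMSEQ_le_const2 by blast
qed

text \<open>The moments \<open>b k\<close> are at most 1. This covers small \<open>r\<close>, where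
  the factor \<open>r ^ m\<close> makes the previous bound worthless.\<close>

lemma bessel_le_exp:
  assumes "0 \<le> r"
  shows "bessel m (r\<^sup>2) \<le> exp r"
  unfolding bessel_def
proof (rule suminf_le_const[OF summable_bessel])
  fix K
  have b: "fact (2 * k) * bessel_coeff m k \<le> 1" for k
  proof (induction k)
    case (Suc k)
    have "fact (2 * Suc k) * bessel_coeff m (Suc k) * (2 * real k + m + 1) = (2 * real k + 1) * (fact (2 * k) * bessel_coeff m k)"
      using bessel_coeff_Suc[of k m, symmetric] by (simp add: algebra_simps)
    also have "\<dots> \<le> (2 * real k + m + 1) * 1"
      using Suc bessel_coeff_pos[of m k] by (intro mult_mono) (auto intro: less_imp_le)
    finally have "fact (2 * Suc k) * bessel_coeff m (Suc k) * (2 * real k + m + 1) \<le> 1 * (2 * real k + m + 1)"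
      by simp
    then show ?case
      by (rule mult_right_le_imp_le) simp
  qed (simp add: bessel_coeff_def)
  have "(\<Sum>k<K. bessel_coeff m k * (r\<^sup>2) ^ k) \<le> (\<Sum>k<K. r ^ (2 * k + 0) / fact (2 * k + 0))"
  proof (rule sum_mono)
    fix k
    have "r ^ (2 * k) * (fact (2 * k) * bessel_coeff m k) \<le> r ^ (2 * k) * 1"
      by (intro mult_left_mono b) (use assms in auto)
    then show "bessel_coeff m k * (r\<^sup>2) ^ k \<le> r ^ (2 * k + 0) / fact (2 * k + 0)"
      by (simp add: field_simps flip: power_mult)
  qed
  also have "\<dots> \<le> exp r" by (rule sum_power_div_fact_le_exp[OF assms])
  finally show "(\<Sum>k<K. bessel_coeff m k * (r\<^sup>2) ^ k) \<le> exp r" .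
qed

text \<open>Either \<open>r\<close> or \<open>\<rho> - r\<close> is at least
  \<open>\<rho> / 2\<close>. In the first case \<open>r ^ m\<close> pays for
  \<open>\<rho> ^ m\<close>; in the second \<open>exp (\<rho> - r)\<close> does, at the price of
  half of the exponential decay away from the edge: \<open>exp (\<rho> + r)\<close> stands in place
  of \<open>exp (2 * r)\<close>.\<close>

lemma bessel_growth:
  assumes "0 \<le> r" "r \<le> \<rho>"
  shows "\<rho> ^ m * (bessel m (r\<^sup>2))\<^sup>2 \<le> 2 ^ (m + 1) * fact m * exp (\<rho> + r)"
proof -
  have b: "0 \<le> (bessel m (r\<^sup>2))\<^sup>2" by simp
  have "\<rho> ^ m \<le> (2 * max r (\<rho> - r)) ^ m"
    using assms by (intro power_mono) (auto simp: max_def)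
  also have "\<dots> \<le> 2 ^ m * (r ^ m + (\<rho> - r) ^ m)"
    using assms by (auto simp: power_mult_distrib max_def)
  also have "\<dots> \<le> 2 ^ m * (r ^ m + fact m * exp (\<rho> - r))"
    using power_div_fact_le_exp[of "\<rho> - r" m] assms by (simp add: field_simps)
  finally have "\<rho> ^ m * (bessel m (r\<^sup>2))\<^sup>2 \<le> 2 ^ m * (r ^ m + fact m * exp (\<rho> - r)) * (bessel m (r\<^sup>2))\<^sup>2"
    by (rule mult_right_mono[OF _ b])
  also have "\<dots> = 2 ^ m * (r ^ m * (bessel m (r\<^sup>2))\<^sup>2 + fact m * exp (\<rho> - r) * (bessel m (r\<^sup>2))\<^sup>2)"
    by (simp add: algebra_simps)
  also have "\<dots> \<le> 2 ^ m * (fact m * exp (2 * r) + fact m * exp (\<rho> - r) * (exp r)\<^sup>2)"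
    using bessel_sq_growth[OF assms(1), of m] bessel_le_exp[OF assms(1), of m] bessel_ge_1[of "r\<^sup>2" m]
    by (intro mult_left_mono add_mono power_mono) auto
  also have "\<dots> \<le> 2 ^ m * (fact m * exp (\<rho> + r) + fact m * exp (\<rho> + r))"
    using assms by (intro mult_left_mono add_mono) (auto simp: mult_exp_exp power2_eq_square)
  finally show ?thesis by simp
qed

section \<open>Integral inequalities\<close>

lemma measure_cball_0:
  "measure lborel (cball (0::'a::euclidean_space) r) = unit_ball_vol (DIM('a)) * max r 0 ^ DIM('a)"
  by (cases "r \<ge> 0") (auto simp: content_cball max_def)

text \<open>The ball is cut into shells of width 1. The shell at depth k has weight at most
  \<open>exp (- k / 2)\<close> and volume of order \<open>\<rho> ^ m\<close>, and the weights form a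
  geometric series. The point is the power \<open>m\<close> instead of the dimension
  \<open>m + 1\<close>.\<close>

lemma exp_shell_integral:
  fixes \<rho> :: real
  assumes "0 \<le> \<rho>" and dim: "DIM('a::euclidean_space) = Suc m"
  shows "integrable lborel (\<lambda>x::'a. indicator (cball 0 \<rho>) x * exp (- (\<rho> - norm x) / 2))"
    and "(LINT x::'a|lborel. indicator (cball 0 \<rho>) x * exp (- (\<rho> - norm x) / 2)) \<le>
      unit_ball_vol (Suc m) * Suc m / (1 - exp (- 1 / 2)) * \<rho> ^ m"
proof -
  have "integrable lborel (\<lambda>x::'a. indicator (cball 0 \<rho>) x *\<^sub>R exp (- (\<rho> - norm x) / 2))"
    by (intro borel_integrable_compact continuous_intros) auto
  then show int: "integrable lborel (\<lambda>x::'a. indicator (cball 0 \<rho>) x * exp (- (\<rho> - norm x) / 2))"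
    by simp
  define D where "D = (\<lambda>k (x::'a). indicator (cball 0 (\<rho> - real k)) x - indicator (cball 0 (\<rho> - real k - 1)) x :: real)"
  \<comment> \<open>Beyond this depth the radii are negative and the shells empty, so a finite sum
    is enough.\<close>
  obtain K :: nat where K: "\<rho> < K" using reals_Archimedean2 by blast
  have cb: "emeasure lborel (cball (0::'a) r) < top" for r
    using emeasure_bounded_finite[of "cball (0::'a) r"] by simp
  have D0: "D k x \<ge> 0" for k x by (auto simp: D_def indicator_def)
  have Dint: "integrable lborel (D k)" for k
    unfolding D_def by (intro Bochner_Integration.integrable_diff integrable_real_indicator) (auto simp: cb)
  have pt: "indicator (cball 0 \<rho>) x * exp (- (\<rho> - norm x) / 2) \<le> (\<Sum>k<K. exp (- 1 / 2) ^ k * D k x)" for x :: 'a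
  proof (cases "x \<in> cball 0 \<rho>")
    case True
    define k where "k = nat \<lfloor>\<rho> - norm x\<rfloor>"
    have "0 \<le> \<rho> - norm x" using True by simp
    then have k: "real k \<le> \<rho> - norm x" "\<rho> - norm x < real k + 1"
      unfolding k_def by linarith+
    have "real k < K" using k(1) K norm_ge_zero[of x] by linarith
    then have "k \<in> {..<K}" by simp
    then have "exp (- 1 / 2) ^ k * D k x \<le> (\<Sum>k<K. exp (- 1 / 2) ^ k * D k x)"
      by (intro member_le_sum) (auto intro!: mult_nonneg_nonneg D0)
    moreover have "exp (- (\<rho> - norm x) / 2) \<le> exp (- 1 / 2) ^ k * D k x"
    proof -
      have "exp (- 1 / 2) ^ k = exp (- real k / 2)"
        by (simp flip: exp_of_nat_mult)
      then show ?thesis using k by (simp add: D_def)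
    qed
    ultimately have "exp (- (\<rho> - norm x) / 2) \<le> (\<Sum>k<K. exp (- 1 / 2) ^ k * D k x)"
      by (rule order_trans[rotated])
    then show ?thesis using True by simp
  qed (auto intro!: sum_nonneg mult_nonneg_nonneg D0)
  have Dle: "(LINT x|lborel. D k x) \<le> unit_ball_vol (Suc m) * (Suc m * \<rho> ^ m)" for k
  proof -
    define a where "a = max (\<rho> - real k) 0"
    define b where "b = max (\<rho> - real k - 1) 0"
    have ab: "0 \<le> b" "b \<le> a" "a - b \<le> 1" "a \<le> \<rho>" using assms by (auto simp: a_def b_def)
    have "a ^ Suc m - b ^ Suc m = (a - b) * (\<Sum>i<Suc m. b ^ (Suc m - Suc i) * a ^ i)"
      by (rule power_diff_sumr2)
    also have "\<dots> \<le> 1 * (\<Sum>i<Suc m. \<rho> ^ m)"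
    proof (intro mult_mono sum_mono)
      fix i assume "i \<in> {..<Suc m}"
      then have "b ^ (Suc m - Suc i) * a ^ i \<le> \<rho> ^ (Suc m - Suc i) * \<rho> ^ i"
        using ab by (intro mult_mono power_mono) auto
      also have "\<dots> = \<rho> ^ m" using \<open>i \<in> _\<close> by (simp flip: power_add)
      finally show "b ^ (Suc m - Suc i) * a ^ i \<le> \<rho> ^ m" .
    qed (use ab in \<open>auto intro!: sum_nonneg simp del: sum.lessThan_Suc\<close>)
    finally have *: "a ^ Suc m - b ^ Suc m \<le> Suc m * \<rho> ^ m" by simp
    have "(LINT x|lborel. D k x) = measure lborel (cball (0::'a) (\<rho> - real k)) - measure lborel (cball (0::'a) (\<rho> - real k - 1))"
      unfolding D_def by (subst Bochner_Integration.integral_diff) (auto simp: cb less_top)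
    also have "\<dots> = unit_ball_vol (Suc m) * (a ^ Suc m - b ^ Suc m)"
      unfolding measure_cball_0 dim a_def b_def by (simp add: right_diff_distrib)
    also have "\<dots> \<le> unit_ball_vol (Suc m) * (Suc m * \<rho> ^ m)"
      using * by (intro mult_left_mono) auto
    finally show ?thesis .
  qed
  have "(LINT x::'a|lborel. indicator (cball 0 \<rho>) x * exp (- (\<rho> - norm x) / 2)) \<le>
      (LINT x|lborel. (\<Sum>k<K. exp (- 1 / 2) ^ k * D k x))"
    by (intro integral_mono int pt) (auto intro!: Dint)
  also have "\<dots> = (\<Sum>k<K. exp (- 1 / 2) ^ k * (LINT x|lborel. D k x))"
    by (subst Bochner_Integration.integral_sum) (auto intro!: Dint)
  also have "\<dots> \<le> (\<Sum>k<K. exp (- 1 / 2) ^ k * (unit_ball_vol (Suc m) * (Suc m * \<rho> ^ m)))"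
    by (intro sum_mono mult_left_mono Dle) auto
  also have "\<dots> = (\<Sum>k<K. exp (- 1 / 2) ^ k) * (unit_ball_vol (Suc m) * (Suc m * \<rho> ^ m))"
    by (simp add: sum_distrib_right)
  also have "\<dots> \<le> 1 / (1 - exp (- 1 / 2)) * (unit_ball_vol (Suc m) * (Suc m * \<rho> ^ m))"
  proof (intro mult_right_mono)
    have "(\<Sum>k<K. exp (- 1 / 2 :: real) ^ k) = (1 - exp (- 1 / 2) ^ K) / (1 - exp (- 1 / 2))"
      by (subst sum_gp_strict) auto
    also have "\<dots> \<le> 1 / (1 - exp (- 1 / 2))"
      by (intro divide_right_mono) auto
    finally show "(\<Sum>k<K. exp (- 1 / 2 :: real) ^ k) \<le> 1 / (1 - exp (- 1 / 2))" .
  qed (use assms in auto)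
  finally show "(LINT x::'a|lborel. indicator (cball 0 \<rho>) x * exp (- (\<rho> - norm x) / 2)) \<le>
      unit_ball_vol (Suc m) * Suc m / (1 - exp (- 1 / 2)) * \<rho> ^ m"
    by (simp add: mult_ac)
qed

lemma powr_ge_tangent:
  fixes h b p :: real
  assumes "h \<ge> 0" "b > 0" "p > 1"
  shows "p * b powr (p - 1) * h - (p - 1) * b powr p \<le> h powr p"
proof -
  have "h * b powr (p - 1) \<le> h powr p / p + (b powr (p - 1)) powr (p / (p - 1)) / (p / (p - 1))"
    by (rule Youngs_inequality) (use assms in \<open>auto simp: field_simps\<close>)
  also have "(b powr (p - 1)) powr (p / (p - 1)) = b powr p"
    using assms by (simp add: powr_powr)
  finally have "p * (h * b powr (p - 1)) \<le> p * (h powr p / p + b powr p / (p / (p - 1)))"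
    using assms by (intro mult_left_mono) auto
  also have "\<dots> = h powr p + (p - 1) * b powr p"
    using assms by (simp add: field_simps)
  finally show ?thesis by (simp add: mult_ac)
qed

text \<open>Jensen's inequality for the measure with density \<open>w\<close>, whose mass need not
  be 1: the tangent inequality is taken at the mean \<open>X / W\<close> and integrated. A vanishing
  left side is split off because the tangent point must be positive.\<close>

lemma weighted_power_mean:
  fixes h w :: "'a \<Rightarrow> real"
  assumes p: "p > 1" and w: "\<And>x. w x \<ge> 0" and h: "\<And>x. h x \<ge> 0"
    and int: "integrable M w" "integrable M (\<lambda>x. h x * w x)" "integrable M (\<lambda>x. h x powr p * w x)"
  shows "(LINT x|M. h x * w x) powr p \<le> (LINT x|M. h x powr p * w x) * (LINT x|M. w x) powr (p - 1)"
proof (cases "(LINT x|M. h x * w x) = 0")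
  case False
  define X where "X = (LINT x|M. h x * w x)"
  define W where "W = (LINT x|M. w x)"
  have "X > 0" using False w h unfolding X_def by (simp add: less_le)
  have "W \<noteq> 0"
  proof
    assume "W = 0"
    then have "AE x in M. w x = 0"
      using w int(1) by (simp add: W_def integral_nonneg_eq_0_iff_AE)
    then have "X = (LINT x|M. 0)"
      unfolding X_def using int(2) by (intro integral_cong_AE) auto
    then show False using \<open>X > 0\<close> by simp
  qed
  then have "W > 0" using w by (simp add: less_le W_def)
  define b where "b = X / W"
  have b: "b > 0" using \<open>X > 0\<close> \<open>W > 0\<close> by (simp add: b_def)
  have "(LINT x|M. p * b powr (p - 1) * (h x * w x) - (p - 1) * b powr p * w x) \<le> (LINT x|M. h x powr p * w x)"
  proof (rule integral_mono)
    fix x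
    show "p * b powr (p - 1) * (h x * w x) - (p - 1) * b powr p * w x \<le> h x powr p * w x"
      using mult_right_mono[OF powr_ge_tangent[OF h b p] w, of x] by (simp add: algebra_simps)
  qed (use int in auto)
  also have "(LINT x|M. p * b powr (p - 1) * (h x * w x) - (p - 1) * b powr p * w x) = p * b powr (p - 1) * X - (p - 1) * b powr p * W"
    using int by (simp add: X_def W_def)
  also have "\<dots> = b powr p * W"
  proof -
    have "b powr p = b powr (p - 1) * b" using b by (simp add: powr_diff)
    moreover have "X = b * W" using \<open>W > 0\<close> by (simp add: b_def)
    ultimately show ?thesis by (simp add: algebra_simps)
  qed
  finally have "b powr p * W * W powr (p - 1) \<le> (LINT x|M. h x powr p * w x) * W powr (p - 1)"
    by (intro mult_right_mono) auto
  moreover have "b powr p * W * W powr (p - 1) = X powr p"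
  proof -
    have "W * W powr (p - 1) = W powr p" using \<open>W > 0\<close> by (simp add: powr_diff)
    moreover have "b powr p * W powr p = X powr p"
      using \<open>W > 0\<close> \<open>X > 0\<close> by (simp add: b_def flip: powr_mult)
    ultimately show ?thesis by (simp add: mult.assoc)
  qed
  ultimately show ?thesis by (simp add: X_def W_def)
qed (use w h in auto)

text \<open>The complement of the support is a union of balls on which \<open>f\<close> vanishes
  almost everywhere. Lindelof's theorem leaves countably many of them, so the exceptional null sets
  can be collected.\<close>

lemma AE_zero_outside_ess_support:
  assumes "ess_support f \<subseteq> S" "closed S"
  shows "AE x in lborel. x \<notin> S \<longrightarrow> f x = 0"
proof -
  let ?F = "{ball x r | x r. r > 0 \<and> (AE y in lborel. y \<in> ball x r \<longrightarrow> f y = 0)}"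
  obtain F where F: "F \<subseteq> ?F" "countable F" "\<Union>F = \<Union>?F"
    using Lindelof[of ?F] by auto
  have "\<forall>B\<in>F. AE y in lborel. y \<in> B \<longrightarrow> f y = 0" using F(1) by auto
  then have "AE y in lborel. \<forall>B\<in>F. y \<in> B \<longrightarrow> f y = 0"
    by (subst AE_ball_countable[OF F(2)])
  then show ?thesis
  proof (rule AE_mp, intro AE_I2 impI)
    fix x assume *: "\<forall>B\<in>F. x \<in> B \<longrightarrow> f x = 0" "x \<notin> S"
    then obtain r where "r > 0" "AE y in lborel. y \<in> ball x r \<longrightarrow> f y = 0"
      using assms(1) by (auto simp: ess_support_def)
    then have "x \<in> \<Union>F" unfolding F(3) by (intro UnionI[of "ball x r"]) auto
    then show "f x = 0" using * by blast
  qed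
qed

text \<open>This is the comparison principle for \<open>D'' \<ge> w * D\<close> with one derivative
  only. If \<open>D\<close> became negative, it would lie above some
  \<open>- M * exp (\<kappa> * s)\<close> with \<open>M > 0\<close> and touch it at
  \<open>t1\<close>. As \<open>w \<le> \<kappa>\<^sup>2\<close>, the hypothesis on \<open>d\<close>
  makes \<open>D + M * exp (\<kappa> * s)\<close> nondecreasing up to \<open>t1\<close>; but it is
  positive at \<open>a\<close> and 0 at \<open>t1\<close>.\<close>

lemma integral_comparison_nonneg:
  fixes D d w :: "real \<Rightarrow> real"
  assumes "continuous_on {a..\<tau>} D" "0 \<le> D a"
    and w: "continuous_on {a..\<tau>} w" "\<And>s. s \<in> {a..\<tau>} \<Longrightarrow> 0 \<le> w s"
    and D: "\<And>t. a < t \<Longrightarrow> t < \<tau> \<Longrightarrow> (D has_real_derivative d t) (at t)"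
    and d: "\<And>t. a < t \<Longrightarrow> t < \<tau> \<Longrightarrow> integral {a..t} (\<lambda>s. w s * D s) \<le> d t"
    and t: "t \<in> {a..\<tau>}"
  shows "0 \<le> D t"
proof (rule ccontr)
  assume neg: "\<not> 0 \<le> D t"
  have ne: "{a..\<tau>} \<noteq> {}" using t by auto
  obtain B where B: "\<And>s. s \<in> {a..\<tau>} \<Longrightarrow> w s \<le> B"
    using continuous_attains_sup[OF compact_Icc ne w(1)] by blast
  \<comment> \<open>The summand 1 keeps \<kappa> positive when \<open>w\<close> vanishes.\<close>
  define \<kappa> where "\<kappa> = sqrt (\<bar>B\<bar> + 1)"
  have \<kappa>: "\<kappa> > 0" "w s \<le> \<kappa>\<^sup>2" if "s \<in> {a..\<tau>}" for s
    using B[OF that] by (auto simp: \<kappa>_def)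
  have \<kappa>0: "\<kappa> > 0" by (auto simp: \<kappa>_def)
  have "continuous_on {a..\<tau>} (\<lambda>s. D s * exp (- \<kappa> * s))"
    by (intro continuous_intros assms)
  then obtain t1 where t1: "t1 \<in> {a..\<tau>}"
    and min: "\<And>s. s \<in> {a..\<tau>} \<Longrightarrow> D t1 * exp (- \<kappa> * t1) \<le> D s * exp (- \<kappa> * s)"
    using continuous_attains_inf[OF compact_Icc ne] by blast
  define M where "M = - (D t1 * exp (- \<kappa> * t1))"
  have "D t * exp (- \<kappa> * t) < 0" using neg by (simp add: mult_less_0_iff)
  then have M: "M > 0" using min[OF t] by (simp add: M_def)
  have lower: "- M * exp (\<kappa> * s) \<le> D s" if "s \<in> {a..\<tau>}" for s
  proof -
    have "- M * exp (\<kappa> * s) \<le> D s * exp (- \<kappa> * s) * exp (\<kappa> * s)"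
      using min[OF that] by (intro mult_right_mono) (auto simp: M_def)
    then show ?thesis by (simp add: mult.assoc mult_exp_exp)
  qed
  have "D a + M * exp (\<kappa> * a) \<le> D t1 + M * exp (\<kappa> * t1)"
  proof (rule DERIV_nonneg_imp_increasing_open[where f = "\<lambda>x. D x + M * exp (\<kappa> * x)"])
    show "a \<le> t1" using t1 by simp
    show "continuous_on {a..t1} (\<lambda>x. D x + M * exp (\<kappa> * x))"
      using t1 by (intro continuous_intros continuous_on_subset[OF assms(1)]) auto
    fix x assume x: "a < x" "x < t1"
    have "integral {a..x} (\<lambda>s. - (\<kappa>\<^sup>2 * M) * exp (\<kappa> * s)) \<le> integral {a..x} (\<lambda>s. w s * D s)"
    proof (rule integral_le)
      show "(\<lambda>s. w s * D s) integrable_on {a..x}"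
        using x t1 by (intro integrable_continuous_real continuous_intros continuous_on_subset[OF assms(1)]
          continuous_on_subset[OF w(1)]) auto
      fix s assume s: "s \<in> {a..x}"
      then have s': "s \<in> {a..\<tau>}" using x t1 by auto
      have "w s * (M * exp (\<kappa> * s)) \<le> \<kappa>\<^sup>2 * (M * exp (\<kappa> * s))"
        using \<kappa>[OF s'] M by (intro mult_right_mono) auto
      moreover have "w s * (- M * exp (\<kappa> * s)) \<le> w s * D s"
        using lower[OF s'] w(2)[OF s'] by (intro mult_left_mono) auto
      ultimately show "- (\<kappa>\<^sup>2 * M) * exp (\<kappa> * s) \<le> w s * D s" by (simp add: mult_ac)
    qed (intro integrable_continuous_real continuous_intros)
    moreover have "((\<lambda>s. - (\<kappa>\<^sup>2 * M) * exp (\<kappa> * s)) has_integral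
        (- \<kappa> * M * exp (\<kappa> * x) - - \<kappa> * M * exp (\<kappa> * a))) {a..x}"
      using x by (intro fundamental_theorem_of_calculus)
        (auto intro!: derivative_eq_intros simp: power2_eq_square simp flip: has_real_derivative_iff_has_vector_derivative)
    moreover have "integral {a..x} (\<lambda>s. w s * D s) \<le> d x"
      using d x t1 by simp
    moreover have "0 \<le> \<kappa> * M * exp (\<kappa> * a)"
      using \<kappa>0 M by simp
    ultimately have "0 \<le> d x + \<kappa> * M * exp (\<kappa> * x)"
      by (auto dest!: integral_unique)
    then have "0 \<le> d x + M * (exp (\<kappa> * x) * \<kappa>)"
      by (simp add: mult_ac)
    moreover have "((\<lambda>x. D x + M * exp (\<kappa> * x)) has_real_derivative d x + M * (exp (\<kappa> * x) * \<kappa>)) (at x)"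
      using x t1 by (auto intro!: derivative_eq_intros D)
    ultimately show "\<exists>y. ((\<lambda>x. D x + M * exp (\<kappa> * x)) has_real_derivative y) (at x) \<and> 0 \<le> y"
      by blast
  qed
  moreover have "D t1 + M * exp (\<kappa> * t1) = 0"
    by (simp add: M_def mult.assoc mult_exp_exp)
  moreover have "0 < M * exp (\<kappa> * a)" using M by simp
  ultimately show False using assms(2) by linarith
qed

text \<open>\<open>U\<close> doubles from \<open>2 ^ j * A\<close> within a time proportional to
  \<open>2 powr (- j * (q - 1) / 2)\<close>, and these times are summable.\<close>

lemma superlinear_lifespan:
  fixes U V :: "real \<Rightarrow> real"
  assumes q: "q > 1" and K: "K > 0" and A: "A > 0" "A \<le> U a" and ab: "a \<le> b"
    and U: "\<And>t. a \<le> t \<Longrightarrow> t \<le> b \<Longrightarrow> (U has_real_derivative V t) (at t)"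
    and V0: "\<And>t. a \<le> t \<Longrightarrow> t \<le> b \<Longrightarrow> 0 \<le> V t"
    and V: "\<And>s t. a \<le> s \<Longrightarrow> s \<le> t \<Longrightarrow> t \<le> b \<Longrightarrow> K * U s powr q * (t - s) \<le> V t - V s"
  shows "b - a \<le> sqrt (2 / (K * A powr (q - 1))) / (1 - 2 powr (- (q - 1) / 2))"
proof (rule ccontr)
  \<comment> \<open>Under the constant acceleration \<open>K * A powr q\<close> the increase by
    \<open>A\<close> takes the time \<delta> with
    \<open>K * A powr q * \<delta>\<^sup>2 / 2 = A\<close>. Each further doubling is shorter by the
    factor \<open>x\<close>, so all of them fit into \<open>\<delta> / (1 - x)\<close>.\<close>
  define x :: real where "x = 2 powr (- (q - 1) / 2)"
  define \<delta> where "\<delta> = sqrt (2 / (K * A powr (q - 1)))"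
  have x: "0 < x" "x < 1" using q by (auto simp: x_def powr_less_one)
  have \<delta>: "\<delta> > 0" using K A by (simp add: \<delta>_def)
  assume "\<not> ?thesis"
  then have big: "\<delta> / (1 - x) < b - a" by (simp add: x_def \<delta>_def)
  define T where "T = (\<lambda>j. a + \<delta> * (\<Sum>i<j. x ^ i))"
  have Tb: "T j \<le> b" for j
  proof -
    have "(\<Sum>i<j. x ^ i) = (1 - x ^ j) / (1 - x)" using x by (simp add: sum_gp_strict)
    also have "\<dots> \<le> 1 / (1 - x)" using x by (intro divide_right_mono) auto
    finally have "\<delta> * (\<Sum>i<j. x ^ i) \<le> \<delta> * (1 / (1 - x))" using \<delta> by (intro mult_left_mono) auto
    then show ?thesis using big by (simp add: T_def)
  qed
  have Ta: "a \<le> T j" for j using \<delta> x by (simp add: T_def sum_nonneg)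
  have TS: "T (Suc j) = T j + \<delta> * x ^ j" for j by (simp add: T_def distrib_left)
  have grow: "2 ^ j * A \<le> U (T j)" for j
  proof (induction j)
    case 0
    then show ?case using A by (simp add: T_def)
  next
    case (Suc j)
    define B where "B = 2 ^ j * A"
    have B: "B > 0" using A by (simp add: B_def)
    have le: "T j \<le> T (Suc j)" using \<delta> x by (simp add: TS)
    have "U (T j) - K * B powr q * (T j - T j)\<^sup>2 / 2 \<le> U (T (Suc j)) - K * B powr q * (T (Suc j) - T j)\<^sup>2 / 2"
    proof (rule DERIV_nonneg_imp_nondecreasing[OF le])
      fix t assume t: "T j \<le> t" "t \<le> T (Suc j)"
      then have t': "a \<le> t" "t \<le> b" using Ta[of j] Tb[of "Suc j"] by auto
      have "((\<lambda>t. U t - K * B powr q * (t - T j)\<^sup>2 / 2) has_real_derivative V t - K * B powr q * (t - T j)) (at t)"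
        by (auto intro!: derivative_eq_intros U t')
      moreover have "K * B powr q * (t - T j) \<le> K * U (T j) powr q * (t - T j)"
        using K B q t Suc.IH by (intro mult_right_mono mult_left_mono powr_mono2) (auto simp: B_def)
      moreover have "\<dots> \<le> V t" using V[OF Ta t(1) t'(2)] V0[OF Ta Tb, of j] by linarith
      ultimately show "\<exists>y. ((\<lambda>t. U t - K * B powr q * (t - T j)\<^sup>2 / 2) has_real_derivative y) (at t) \<and> 0 \<le> y"
        by (intro exI[of _ "V t - K * B powr q * (t - T j)"]) auto
    qed
    then have "B + K * B powr q * (\<delta> * x ^ j)\<^sup>2 / 2 \<le> U (T (Suc j))"
      using Suc.IH by (simp add: TS B_def)
    moreover have "K * B powr q * (\<delta> * x ^ j)\<^sup>2 / 2 = B"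
    proof -
      have "(x ^ j)\<^sup>2 = 2 powr (- (q - 1) * j)"
        by (simp add: x_def powr_powr flip: powr_realpow powr_add power_mult)
      also have "\<dots> = (2 ^ j) powr (- (q - 1))"
        by (simp add: powr_powr mult.commute flip: powr_realpow)
      also have "\<dots> = 1 / (2 ^ j) powr (q - 1)" by (rule powr_minus_divide)
      finally have 1: "(x ^ j)\<^sup>2 = 1 / (2 ^ j) powr (q - 1)" .
      have 2: "\<delta>\<^sup>2 = 2 / (K * A powr (q - 1))" using K A by (simp add: \<delta>_def)
      have 3: "B powr (q - 1) = (2 ^ j) powr (q - 1) * A powr (q - 1)" using A by (simp add: B_def powr_mult)
      have 4: "B powr q = B * B powr (q - 1)" using B by (simp add: powr_diff)
      have "B powr (q - 1) > 0" using B by simp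
      then show ?thesis
        unfolding power_mult_distrib 1 2 4 using K A 3 by simp
    qed
    ultimately show ?case by (simp add: B_def mult_ac)
  qed
  \<comment> \<open>All times \<open>T j\<close> lie before \<open>b\<close>, so the finite value
    \<open>U b\<close> would exceed every \<open>2 ^ j * A\<close>.\<close>
  obtain j :: nat where j: "U b / A < 2 ^ j"
    using real_arch_pow[of 2 "U b / A"] by auto
  have "U (T j) \<le> U b"
    by (rule DERIV_nonneg_imp_nondecreasing[OF Tb])
      (use U V0 Ta[of j] in \<open>meson order_trans\<close>)
  with grow[of j] j A show False by (simp add: field_simps)
qed

text \<open>\<open>B t = t powr (l / 2) * exp (t powr (l + 1) / (l + 1))\<close> and \<open>A t = t powr (- 2 * l) * B' t\<close>
  satisfy \<open>A' \<le> B\<close>. Hence \<open>A\<close> is a subsolution of \<open>y'' = t powr (2 * l) * y\<close>, with which \<open>U\<close> is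
  compared from time 1 on.\<close>

lemma tricomi_growth:
  fixes U V :: "real \<Rightarrow> real"
  assumes l: "l > 0" and a: "a \<ge> 0" "U 0 = a" and b: "b \<ge> 0"
    and cont: "continuous_on {0..\<tau>} U"
    and U: "\<And>t. 0 < t \<Longrightarrow> t < \<tau> \<Longrightarrow> (U has_real_derivative V t) (at t)"
    and V: "\<And>t. 0 < t \<Longrightarrow> t \<le> \<tau> \<Longrightarrow> b + integral {0..t} (\<lambda>s. s powr (2 * l) * U s) \<le> V t"
    and t: "1 \<le> t" "t \<le> \<tau>"
  shows "(b + a / (2 * l + 1)) / ((l / 2 + 2) * exp (1 / (l + 1))) * (t powr (l / 2) * exp (t powr (l + 1) / (l + 1))) \<le> V t"
proof -
  have wcont: "continuous_on S (\<lambda>s. s powr (2 * l))" if "S \<subseteq> {0..}" for S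
    using l that by (intro continuous_on_powr' continuous_intros) auto
  have int: "(\<lambda>s. s powr (2 * l) * F s) integrable_on {x..y}"
    if "0 \<le> x" "y \<le> \<tau>" "continuous_on {x..y} F" for x y F
    using that by (intro integrable_continuous_real continuous_on_mult wcont) auto
  have int_mono: "integral {x..y} (\<lambda>s. s powr (2 * l) * F s) \<le> integral {x..y} (\<lambda>s. s powr (2 * l) * G s)"
    if "0 \<le> x" "y \<le> \<tau>" "continuous_on {x..y} F" "continuous_on {x..y} G" "\<And>s. x \<le> s \<Longrightarrow> s \<le> y \<Longrightarrow> F s \<le> G s" for x y F G
    by (rule integral_le[OF int[OF that(1,2,3)] int[OF that(1,2,4)]]) (auto intro!: mult_left_mono that(5))
  have sub: "continuous_on {x..y} U" if "0 \<le> x" "y \<le> \<tau>" for x y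
    using that by (intro continuous_on_subset[OF cont]) auto
  have nn: "0 \<le> a + b * s" if "0 \<le> s" for s using a b that by simp
  \<comment> \<open>A first comparison, from time 0 and with an affine function. It supplies the
    values at time 1 and on the unit interval that the second comparison starts from.\<close>
  have lower: "a + b * s \<le> U s" if "s \<in> {0..\<tau>}" for s
  proof -
    have "0 \<le> U s - (a + b * s)"
    proof (rule integral_comparison_nonneg[where D = "\<lambda>s. U s - (a + b * s)" and d = "\<lambda>s. V s - b" and a = 0 and \<tau> = \<tau> and w = "\<lambda>s. s powr (2 * l)"])
      fix r assume r: "0 < r" "r < \<tau>"
      show "((\<lambda>s. U s - (a + b * s)) has_real_derivative V r - b) (at r)"
        by (auto intro!: derivative_eq_intros U r)
      have ab: "continuous_on {0..r} (\<lambda>s. a + b * s)" by (intro continuous_intros)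
      have Ur: "continuous_on {0..r} U" by (rule sub) (use r in simp_all)
      have c: "continuous_on {0..r} (\<lambda>s. U s - (a + b * s))"
        by (rule continuous_on_diff[OF Ur ab])
      have "integral {0..r} (\<lambda>s. s powr (2 * l) * (U s - (a + b * s))) \<le> integral {0..r} (\<lambda>s. s powr (2 * l) * U s)"

      proof (rule int_mono[OF _ _ c Ur])
        show "U s - (a + b * s) \<le> U s" if "0 \<le> s" for s using nn[OF that] by linarith
      qed (use r in simp_all)
      then show "integral {0..r} (\<lambda>s. s powr (2 * l) * (U s - (a + b * s))) \<le> V r - b"
        using V[of r] r by simp
    qed (use that a in \<open>auto intro!: continuous_intros cont wcont\<close>)
    then show ?thesis by simp
  qed
  define E where "E = (\<lambda>t. exp (t powr (l + 1) / (l + 1)))"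
  define A where "A = (\<lambda>t. (l / 2 * t powr (- (3 * l / 2) - 1) + t powr (- (l / 2))) * E t)"
  define B where "B = (\<lambda>t. t powr (l / 2) * E t)"
  \<comment> \<open>Normalised so that \<open>k * A 1\<close> and \<open>k * B 1\<close> stay below
    \<open>a + b\<close> and \<open>b + a / (2 * l + 1)\<close>, the lower bounds for
    \<open>U\<close> and \<open>V\<close> at time 1; the denominator dominates both
    \<open>A 1\<close> and \<open>B 1\<close>.\<close>
  define k where "k = (b + a / (2 * l + 1)) / ((l / 2 + 2) * exp (1 / (l + 1)))"
  have E: "(E has_real_derivative (t powr l * E t)) (at t)" if "t > 0" for t
    using that l unfolding E_def by (auto intro!: derivative_eq_intros)
  have B: "(B has_real_derivative (t powr (2 * l) * A t)) (at t)" if "t > 0" for t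
  proof -
    have "(B has_real_derivative (l / 2 * t powr (l / 2 - 1)) * E t + t powr l * E t * t powr (l / 2)) (at t)"
      unfolding B_def using that by (auto intro!: derivative_eq_intros E)
    moreover have "t powr (2 * l) * t powr (- (3 * l / 2) - 1) = t powr (l / 2 - 1)"
      "t powr (2 * l) * t powr (- (l / 2)) = t powr l * t powr (l / 2)"
      by (simp_all add: powr_add[symmetric])
    ultimately show ?thesis by (simp add: A_def algebra_simps)
  qed
  have A: "(A has_real_derivative (B t - l / 2 * (3 * l / 2 + 1) * t powr (- (3 * l / 2) - 2) * E t)) (at t)" if "t > 0" for t
  proof -
    define c where "c = t powr (- (3 * l / 2) - 2)"
    have c: "t powr (- 2 - 3 * l / 2) = c"
      unfolding c_def by (rule arg_cong[where f = "(powr) t"]) linarith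
    have "(A has_real_derivative (l / 2 * ((- (3 * l / 2) - 1) * c) + - (l / 2) * t powr (- (l / 2) - 1)) * E t
        + t powr l * E t * (l / 2 * t powr (- (3 * l / 2) - 1) + t powr (- (l / 2)))) (at t)"
      unfolding A_def using that by (auto intro!: derivative_eq_intros E simp: c)
    moreover have "t powr l * t powr (- (3 * l / 2) - 1) = t powr (- (l / 2) - 1)"
      "t powr l * t powr (- (l / 2)) = t powr (l / 2)"
      by (simp_all add: powr_add[symmetric])
    ultimately show ?thesis unfolding c_def[symmetric] by (simp add: B_def algebra_simps)
  qed
  have Bcont: "continuous_on {x..y} A" "continuous_on {x..y} B" if "x > 0" for x y
    using that by (auto intro!: continuous_at_imp_continuous_on DERIV_isCont[OF A] DERIV_isCont[OF B])
  have kA: "k * A 1 \<le> a + b" and kB: "k * B 1 \<le> b + a / (2 * l + 1)" and k0: "k \<ge> 0"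
  proof -
    have 1: "k * ((l / 2 + 2) * exp (1 / (l + 1))) = b + a / (2 * l + 1)"
      using l by (simp add: k_def)
    show k0: "k \<ge> 0" using l a b by (auto simp: k_def)
    have "a / (2 * l + 1) \<le> a"
      using l a by (simp add: divide_le_eq mult_le_cancel_left1)
    moreover have "k * A 1 \<le> k * ((l / 2 + 2) * exp (1 / (l + 1)))" "k * B 1 \<le> k * ((l / 2 + 2) * exp (1 / (l + 1)))"
      using k0 l by (auto intro!: mult_left_mono simp: A_def B_def E_def)
    ultimately show "k * A 1 \<le> a + b" "k * B 1 \<le> b + a / (2 * l + 1)" using 1 by auto
  qed
  \<comment> \<open>The summand with \<open>a\<close> is the integral of
    \<open>s powr (2 * l) * a\<close> over the unit interval. It keeps the bound positive when the
    initial velocity vanishes.\<close>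
  have Vlow: "b + a / (2 * l + 1) + integral {1..r} (\<lambda>s. s powr (2 * l) * U s) \<le> V r" if "1 \<le> r" "r \<le> \<tau>" for r
  proof -
    have "((\<lambda>s. s powr (2 * l)) has_integral (1 powr (2 * l + 1) / (2 * l + 1))) {0..1}"
      using l by (intro has_integral_powr_from_0) auto
    from integral_unique[OF has_integral_mult_left[OF this, of a]]
    have "a / (2 * l + 1) = integral {0..1} (\<lambda>s. s powr (2 * l) * a)"
      by simp
    also have "\<dots> \<le> integral {0..1} (\<lambda>s. s powr (2 * l) * U s)"
    proof (rule int_mono)
      fix s :: real assume "0 \<le> s" "s \<le> 1"
      then show "a \<le> U s" using lower[of s] b that by (auto intro: order_trans[rotated])
    qed (use that sub in auto)
    also have "\<dots> + integral {1..r} (\<lambda>s. s powr (2 * l) * U s) = integral {0..r} (\<lambda>s. s powr (2 * l) * U s)"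
      using that by (intro Henstock_Kurzweil_Integration.integral_combine int[OF _ _ sub]) auto
    finally show ?thesis using V[of r] that by simp
  qed
  have Bint: "integral {1..r} (\<lambda>s. s powr (2 * l) * A s) = B r - B 1" if "1 \<le> r" for r
    using that B by (intro integral_unique fundamental_theorem_of_calculus)
      (auto simp: has_real_derivative_iff_has_vector_derivative[symmetric] intro: has_field_derivative_at_within)
  have UA: "k * A s \<le> U s" if "s \<in> {1..\<tau>}" for s
  proof -
    have "0 \<le> U s - k * A s"
    proof (rule integral_comparison_nonneg[where D = "\<lambda>s. U s - k * A s" and a = 1 and \<tau> = \<tau> and w = "\<lambda>s. s powr (2 * l)"
        and d = "\<lambda>t. V t - k * (B t - l / 2 * (3 * l / 2 + 1) * t powr (- (3 * l / 2) - 2) * E t)"])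
      fix r assume r: "1 < r" "r < \<tau>"
      show "((\<lambda>s. U s - k * A s) has_real_derivative V r - k * (B r - l / 2 * (3 * l / 2 + 1) * r powr (- (3 * l / 2) - 2) * E r)) (at r)"
        using r by (intro DERIV_diff U DERIV_cmult A) auto
      have "integral {1..r} (\<lambda>s. s powr (2 * l) * (U s - k * A s)) =
          integral {1..r} (\<lambda>s. s powr (2 * l) * U s - k * (s powr (2 * l) * A s))"
        by (simp add: algebra_simps)
      also have "\<dots> = integral {1..r} (\<lambda>s. s powr (2 * l) * U s) - k * integral {1..r} (\<lambda>s. s powr (2 * l) * A s)"
        using r by (subst Henstock_Kurzweil_Integration.integral_diff)
          (auto intro!: int[OF _ _ sub] integrable_on_mult_right[OF int[OF _ _ Bcont(1)]])
      also have "\<dots> \<le> V r - k * B r"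
        using Vlow[of r] kB r by (simp add: Bint right_diff_distrib)
      also have "\<dots> \<le> V r - k * (B r - l / 2 * (3 * l / 2 + 1) * r powr (- (3 * l / 2) - 2) * E r)"
        using k0 l by (intro diff_left_mono mult_left_mono) (auto simp: E_def)
      finally show "integral {1..r} (\<lambda>s. s powr (2 * l) * (U s - k * A s)) \<le> \<dots>" .
    next
      show "0 \<le> U 1 - k * A 1" using lower[of 1] that kA by auto
    qed (use that in \<open>auto intro!: continuous_intros sub wcont Bcont\<close>)
    then show ?thesis by simp
  qed
  \<comment> \<open>The comparison concerned \<open>U\<close> alone. It passes to \<open>V\<close>
    because \<open>B\<close> is a primitive of \<open>s powr (2 * l) * A s\<close>.\<close>
  have "k * B t = k * B 1 + integral {1..t} (\<lambda>s. s powr (2 * l) * (k * A s))"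
    using t by (simp add: Bint right_diff_distrib mult.left_commute[of _ k])
  also have "\<dots> \<le> b + a / (2 * l + 1) + integral {1..t} (\<lambda>s. s powr (2 * l) * U s)"
    using t UA by (intro add_mono kB int_mono continuous_on_mult_left Bcont sub) auto
  also have "\<dots> \<le> V t" by (rule Vlow[OF t])
  finally show ?thesis by (simp add: k_def B_def E_def)
qed

text \<open>The absolute value allows exponents of either sign, as \<mu> is negative for some
  parameters and positive for others.\<close>

lemma powr_ge_four:
  fixes y \<gamma> :: real
  assumes "1 / 4 \<le> y" "y \<le> 1"
  shows "4 powr (- \<bar>\<gamma>\<bar>) \<le> y powr \<gamma>"
proof (cases "\<gamma> \<ge> 0")
  case True
  have "4 powr (- \<gamma>) = (1 / 4) powr \<gamma>" by (simp add: powr_minus_divide powr_divide)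
  also have "\<dots> \<le> y powr \<gamma>" using assms True by (intro powr_mono2) auto
  finally show ?thesis using True by simp
next
  case False
  have "4 powr (- \<bar>\<gamma>\<bar>) \<le> (4::real) powr 0" by (intro powr_mono) auto
  also have "\<dots> = 1 powr \<gamma>" by simp
  also have "\<dots> \<le> y powr \<gamma>" using assms False by (intro powr_mono2') auto
  finally show ?thesis .
qed

text \<open>As \<open>\<tau> \<ge> 4\<close>, the interval from \<open>\<tau> / 4\<close> to \<tau>
  lies in the range of the lower bounds, and powers of \<open>s\<close> are comparable there to
  powers of \<tau>. An eighth of \<tau> builds up the velocity, giving
  \<open>V \<ge> \<kappa> * \<tau> / 8\<close> at \<open>3 * \<tau> / 8\<close>; the next eighth
  gives \<open>U \<ge> \<kappa> * \<tau>\<^sup>2 / 64\<close> at \<open>\<tau> / 2\<close>. The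
  second half must then be shorter than a blow-up time, and squaring this gives the constant
  8.\<close>

lemma power_source_lifespan:
  fixes U V P :: "real \<Rightarrow> real"
  assumes q: "q > 1" and e: "e > 0" and k: "k > 0" and \<tau>: "4 \<le> \<tau>"
    and cont: "continuous_on {0..\<tau>} U" and U0: "0 \<le> U 0" and v: "0 \<le> v"
    and U: "\<And>t. 0 < t \<Longrightarrow> t \<le> \<tau> \<Longrightarrow> (U has_real_derivative V t) (at t)"
    and V: "\<And>t. 0 < t \<Longrightarrow> t \<le> \<tau> \<Longrightarrow> V t = v + (LINT s:{0<..<t}|lborel. P s)"
    and P: "set_integrable lborel {0<..<\<tau>} P" "\<And>s. 0 \<le> P s"
    and lower: "AE s in lborel. 1 \<le> s \<and> s < \<tau> \<longrightarrow> e * s powr \<mu> \<le> P s \<and> k * s powr (- \<beta>) * \<bar>U s\<bar> powr q \<le> P s"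
  shows "\<tau> powr (2 - \<beta> + (\<mu> + 2) * (q - 1)) * e powr (q - 1) \<le>
    8 / (1 - 2 powr (- (q - 1) / 2))\<^sup>2 / (k * 4 powr (- \<bar>\<beta>\<bar>) * (4 powr (- \<bar>\<mu>\<bar>) / 64) powr (q - 1))"
proof -
  \<comment> \<open>\<open>P\<close> is integrable but need not be continuous, so
    \<open>V' = P\<close> is available through increments only.\<close>
  have Vdiff: "c * (t - s) \<le> V t - V s" if "0 < s" "s \<le> t" "t \<le> \<tau>" "AE r in lborel. s < r \<and> r < t \<longrightarrow> c \<le> P r" for s t c
  proof -
    have i: "integrable lborel (\<lambda>r. indicator {0<..<t} r * P r)" if "t \<le> \<tau>" for t
    proof -
      have "{0<..<t} \<subseteq> {0<..<\<tau>}" using that by auto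
      from set_integrable_subset[OF P(1) _ this] show ?thesis by (simp add: set_integrable_def)
    qed
    have "(LINT r|lborel. indicator {0<..<s} r * P r + c * indicator {s<..<t} r) \<le> (LINT r|lborel. indicator {0<..<t} r * P r)"
    proof (rule integral_mono_AE)
      show "AE r in lborel. indicator {0<..<s} r * P r + c * indicator {s<..<t} r \<le> indicator {0<..<t} r * P r"
        using that(4)
      proof eventually_elim
        case (elim r)
        then show ?case using that(1-3) P(2)[of r] by (auto simp: indicator_def)
      qed
    qed (use i that in auto)
    also have "(LINT r|lborel. indicator {0<..<s} r * P r + c * indicator {s<..<t} r) =
      (LINT r|lborel. indicator {0<..<s} r * P r) + c * (t - s)"
      using i[of s] that by (subst Bochner_Integration.integral_add) auto
    finally show ?thesis using V[of s] V[of t] that by (simp add: set_lebesgue_integral_def)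
  qed
  have V0: "0 \<le> V t" if "0 < t" "t \<le> \<tau>" for t
    using V[OF that] v P(2) by (simp add: set_lebesgue_integral_def)
  have Vmono: "V s \<le> V t" if "0 < s" "s \<le> t" "t \<le> \<tau>" for s t
    using Vdiff[OF that, of 0] P(2) by simp
  have Umono: "U s \<le> U t" if "0 \<le> s" "s \<le> t" "t \<le> \<tau>" for s t
  proof (rule DERIV_nonneg_imp_increasing_open[OF that(2)])
    show "\<exists>y. (U has_real_derivative y) (at x) \<and> 0 \<le> y" if "s < x" "x < t" for x
      using U[of x] V0[of x] that \<open>0 \<le> s\<close> \<open>t \<le> \<tau>\<close> by auto
    show "continuous_on {s..t} U" using that by (intro continuous_on_subset[OF cont]) auto
  qed
  have scale: "4 powr (- \<bar>\<gamma>\<bar>) * \<tau> powr \<gamma> \<le> s powr \<gamma>" if "\<tau> / 4 \<le> s" "s \<le> \<tau>" for s \<gamma>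
  proof -
    have "4 powr (- \<bar>\<gamma>\<bar>) \<le> (s / \<tau>) powr \<gamma>"
      using \<tau> that by (intro powr_ge_four) (auto simp: field_simps)
    then show ?thesis using \<tau> that by (simp add: powr_divide field_simps)
  qed
  \<comment> \<open>\<kappa> and \<open>K\<close> bound \<open>e * s powr \<mu>\<close> and
    \<open>k * s powr (- \<beta>)\<close> from below for all \<open>s\<close> between
    \<open>\<tau> / 4\<close> and \<tau>.\<close>
  define \<kappa> where "\<kappa> = e * (4 powr (- \<bar>\<mu>\<bar>) * \<tau> powr \<mu>)"
  define A where "A = \<kappa> * \<tau>\<^sup>2 / 64"
  define K where "K = k * (4 powr (- \<bar>\<beta>\<bar>) * \<tau> powr (- \<beta>))"
  have pos: "\<kappa> > 0" "A > 0" "K > 0" using e k \<tau> by (auto simp: \<kappa>_def A_def K_def)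
  have "\<kappa> * (3 * \<tau> / 8 - \<tau> / 4) \<le> V (3 * \<tau> / 8) - V (\<tau> / 4)"
  proof (rule Vdiff)
    show "AE r in lborel. \<tau> / 4 < r \<and> r < 3 * \<tau> / 8 \<longrightarrow> \<kappa> \<le> P r"
      using lower
    proof eventually_elim
      case (elim r)
      show ?case
      proof
        assume r: "\<tau> / 4 < r \<and> r < 3 * \<tau> / 8"
        then have "\<kappa> \<le> e * r powr \<mu>"
          unfolding \<kappa>_def using scale[of r \<mu>] e \<tau> by (intro mult_left_mono) auto
        also have "\<dots> \<le> P r" using elim r \<tau> by auto
        finally show "\<kappa> \<le> P r" .
      qed
    qed
  qed (use \<tau> in auto)
  then have V38: "\<kappa> * \<tau> / 8 \<le> V (3 * \<tau> / 8)" using V0[of "\<tau> / 4"] \<tau> by (simp add: field_simps)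
  have "U (3 * \<tau> / 8) - \<kappa> * \<tau> / 8 * (3 * \<tau> / 8) \<le> U (\<tau> / 2) - \<kappa> * \<tau> / 8 * (\<tau> / 2)"
  proof (rule DERIV_nonneg_imp_nondecreasing[where f = "\<lambda>t. U t - \<kappa> * \<tau> / 8 * t"])
    fix t assume t: "3 * \<tau> / 8 \<le> t" "t \<le> \<tau> / 2"
    have "((\<lambda>t. U t - \<kappa> * \<tau> / 8 * t) has_real_derivative V t - \<kappa> * \<tau> / 8) (at t)"
      using t \<tau> by (auto intro!: derivative_eq_intros U)
    moreover have "\<kappa> * \<tau> / 8 \<le> V t" using V38 Vmono[of "3 * \<tau> / 8" t] t \<tau> by simp
    ultimately show "\<exists>y. ((\<lambda>t. U t - \<kappa> * \<tau> / 8 * t) has_real_derivative y) (at t) \<and> 0 \<le> y"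
      by (intro exI[of _ "V t - \<kappa> * \<tau> / 8"]) auto
  qed (use \<tau> in auto)
  moreover have "0 \<le> U (3 * \<tau> / 8)" using Umono[of 0 "3 * \<tau> / 8"] U0 \<tau> by simp
  ultimately have UA: "A \<le> U (\<tau> / 2)" by (simp add: A_def power2_eq_square field_simps)
  define x where "x = 1 - 2 powr (- (q - 1) / 2 :: real)"
  have x: "0 < x" using q by (auto simp: x_def powr_less_one)
  have "\<tau> - \<tau> / 2 \<le> sqrt (2 / (K * A powr (q - 1))) / x"
    unfolding x_def
  proof (rule superlinear_lifespan[where U = U and V = V and a = "\<tau> / 2" and b = \<tau>, OF q pos(3,2) UA])
    fix s t assume st: "\<tau> / 2 \<le> s" "s \<le> t" "t \<le> \<tau>"
    show "K * U s powr q * (t - s) \<le> V t - V s"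
    proof (rule Vdiff)
      show "AE r in lborel. s < r \<and> r < t \<longrightarrow> K * U s powr q \<le> P r"
        using lower
      proof eventually_elim
        case (elim r)
        show ?case
        proof
          assume r: "s < r \<and> r < t"
          have "0 \<le> U s" using Umono[of 0 s] U0 st \<tau> by simp
          have "K * U s powr q \<le> k * r powr (- \<beta>) * \<bar>U r\<bar> powr q"
          proof (rule mult_mono)
            show "K \<le> k * r powr (- \<beta>)"
              unfolding K_def using scale[of r "- \<beta>"] k r st \<tau> by (intro mult_left_mono) auto
            show "U s powr q \<le> \<bar>U r\<bar> powr q"
              using Umono[of s r] r st \<tau> q \<open>0 \<le> U s\<close> by (intro powr_mono2) auto
          qed (use k in auto)
          also have "\<dots> \<le> P r" using elim r st \<tau> by auto
          finally show "K * U s powr q \<le> P r" .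
        qed
      qed
    qed (use st \<tau> in auto)
  qed (use \<tau> U V0 in auto)
  then have "\<tau> / 2 * x \<le> sqrt (2 / (K * A powr (q - 1)))"
    using x by (simp add: field_simps)
  then have "(\<tau> / 2 * x)\<^sup>2 \<le> (sqrt (2 / (K * A powr (q - 1))))\<^sup>2"
    using x \<tau> by (intro power_mono) auto
  also have "\<dots> = 2 / (K * A powr (q - 1))" using pos by simp
  finally have "\<tau>\<^sup>2 * (K * A powr (q - 1)) \<le> 8 / x\<^sup>2"
    using pos x by (simp add: power_mult_distrib power_divide field_simps)
  also have "\<tau>\<^sup>2 * (K * A powr (q - 1)) = \<tau> powr (2 - \<beta> + (\<mu> + 2) * (q - 1)) * e powr (q - 1) *
     (k * 4 powr (- \<bar>\<beta>\<bar>) * (4 powr (- \<bar>\<mu>\<bar>) / 64) powr (q - 1))"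
  proof -
    have t2: "\<tau>\<^sup>2 = \<tau> powr 2" using \<tau> by (simp flip: powr_numeral)
    have Aeq: "A = e * (4 powr (- \<bar>\<mu>\<bar>) / 64) * \<tau> powr (\<mu> + 2)"
      unfolding A_def \<kappa>_def t2 powr_add by simp
    have gen: "(e * d * \<tau> powr (\<mu> + 2)) powr (q - 1) = e powr (q - 1) * d powr (q - 1) * \<tau> powr ((\<mu> + 2) * (q - 1))"
      if "d > 0" for d
      using e that by (simp add: powr_mult powr_powr)
    have "A powr (q - 1) = e powr (q - 1) * (4 powr (- \<bar>\<mu>\<bar>) / 64) powr (q - 1) * \<tau> powr ((\<mu> + 2) * (q - 1))"
      unfolding Aeq by (rule gen) simp
    moreover have "\<tau> powr (2 - \<beta> + (\<mu> + 2) * (q - 1)) = \<tau> powr 2 * \<tau> powr (- \<beta>) * \<tau> powr ((\<mu> + 2) * (q - 1))"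
      by (simp flip: powr_add)
    ultimately show ?thesis unfolding K_def t2 by (simp add: mult_ac)
  qed
  finally show ?thesis
    unfolding x_def[symmetric] using k by (subst pos_le_divide_eq) auto
qed

section \<open>Moments of energy solutions\<close>

lemma L2_real_iff: "(f :: 'a::euclidean_space \<Rightarrow> real) \<in> L2 \<longleftrightarrow> f \<in> borel_measurable lborel \<and> integrable lborel (\<lambda>x. (f x)\<^sup>2)"
  by (simp add: L2_def)

lemma L2_diff:
  fixes f g :: "'a::euclidean_space \<Rightarrow> real"
  assumes "f \<in> L2" "g \<in> L2"
  shows "(\<lambda>x. f x - g x) \<in> L2"
proof -
  have [measurable]: "f \<in> borel_measurable lborel" "g \<in> borel_measurable lborel"
    using assms by (auto simp: L2_real_iff)
  have sq: "(f x - g x)\<^sup>2 \<le> 2 * (f x)\<^sup>2 + 2 * (g x)\<^sup>2" for x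
    using zero_le_power2[of "f x + g x"] by (simp add: power2_eq_square algebra_simps)
  have "integrable lborel (\<lambda>x. (f x - g x)\<^sup>2)"
  proof (rule Bochner_Integration.integrable_bound)
    show "integrable lborel (\<lambda>x. 2 * (f x)\<^sup>2 + 2 * (g x)\<^sup>2)"
      using assms by (simp add: L2_real_iff)
    show "AE x in lborel. norm ((f x - g x)\<^sup>2) \<le> norm (2 * (f x)\<^sup>2 + 2 * (g x)\<^sup>2)"
      using sq by (intro AE_I2) (simp only: real_norm_def abs_of_nonneg zero_le_power2 add_nonneg_nonneg
          mult_nonneg_nonneg zero_le_numeral)
  qed measurable
  then show ?thesis by (simp add: L2_real_iff)
qed

lemma L2_divide: "(f :: 'a::euclidean_space \<Rightarrow> real) \<in> L2 \<Longrightarrow> (\<lambda>x. f x / c) \<in> L2"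
  by (auto simp: L2_real_iff power_divide)

lemma L2_mult_integrable:
  fixes f g :: "'a::euclidean_space \<Rightarrow> real"
  shows "f \<in> L2 \<Longrightarrow> g \<in> L2 \<Longrightarrow> integrable lborel (\<lambda>x. f x * g x)"
  using L2_integrable_scaleR[of g f] by (simp add: mult.commute)

lemma L2_norm_sq: "(L2_norm f)\<^sup>2 = (LINT x|lborel. (norm (f x))\<^sup>2)"
  by (simp add: L2_norm_def)

lemma C1_in_L2_moment:
  fixes u :: "real \<Rightarrow> 'a::euclidean_space \<Rightarrow> real"
  assumes C1: "C1_in_L2 I u ut" and g: "g \<in> L2" and t: "t \<in> I"
  shows "((\<lambda>s. LINT x|lborel. u s x * g x) has_real_derivative (LINT x|lborel. ut t x * g x)) (at t within I)"
  unfolding has_field_derivative_iff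
proof (rule Lim_null[THEN iffD2], rule Lim_null_comparison)
  let ?q = "\<lambda>s x. (u s x - u t x) / (s - t) - ut t x"
  have L: "u s \<in> L2" "ut s \<in> L2" if "s \<in> I" for s
    using C1 that by (auto simp: C1_in_L2_def continuous_in_L2_def)
  show "\<forall>\<^sub>F s in at t within I. norm (((LINT x|lborel. u s x * g x) - (LINT x|lborel. u t x * g x)) / (s - t) - (LINT x|lborel. ut t x * g x))
      \<le> L2_norm (?q s) * L2_norm g"
    unfolding eventually_at_filter
  proof (intro always_eventually allI impI)
    fix s assume s: "s \<noteq> t" "s \<in> I"
    have q: "?q s \<in> L2" by (intro L2_diff L2_divide L s t)
    have "((LINT x|lborel. u s x * g x) - (LINT x|lborel. u t x * g x)) / (s - t) - (LINT x|lborel. ut t x * g x)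
        = (LINT x|lborel. (u s x * g x - u t x * g x) / (s - t) - ut t x * g x)"
      using L2_mult_integrable[OF L(1) g] L2_mult_integrable[OF L(2) g] s t by simp
    also have "\<dots> = (LINT x|lborel. ?q s x *\<^sub>R g x)"
      by (intro Bochner_Integration.integral_cong refl) (simp add: algebra_simps diff_divide_distrib)
    finally show "norm (((LINT x|lborel. u s x * g x) - (LINT x|lborel. u t x * g x)) / (s - t) - (LINT x|lborel. ut t x * g x))
      \<le> L2_norm (?q s) * L2_norm g"
      using L2_Cauchy_Schwarz[OF g q] by simp
  qed
  have "((\<lambda>s. L2_norm (?q s)) \<longlongrightarrow> 0) (at t within I)"
    using C1 t by (simp add: C1_in_L2_def)
  from tendsto_mult_left_zero[OF this]
  show "((\<lambda>s. L2_norm (?q s) * L2_norm g) \<longlongrightarrow> 0) (at t within I)" .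
qed

text \<open>On \<open>S\<close> the difference quotients vanish, so \<open>ut t\<close> is there the
  L^2 limit of 0. Only quotients from the left are used: the supports of \<open>u s\<close> grow,
  and after time \<open>t\<close> the solution may be nonzero on \<open>S\<close>.\<close>

lemma C1_in_L2_derivative_support:
  fixes u :: "real \<Rightarrow> 'a::euclidean_space \<Rightarrow> real"
  assumes C1: "C1_in_L2 I u ut" and t: "t \<in> I" and I: "{a<..<t} \<subseteq> I" "a < t" and S: "S \<in> sets lborel"
    and u: "\<And>s. a < s \<Longrightarrow> s \<le> t \<Longrightarrow> AE x in lborel. x \<in> S \<longrightarrow> u s x = 0"
  shows "AE x in lborel. x \<in> S \<longrightarrow> ut t x = 0"
proof -
  let ?q = "\<lambda>s x. (u s x - u t x) / (s - t) - ut t x"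
  let ?J = "LINT x|lborel. indicator S x * (ut t x)\<^sup>2"
  have L: "u s \<in> L2" "ut s \<in> L2" if "s \<in> I" for s
    using C1 that by (auto simp: C1_in_L2_def continuous_in_L2_def)
  have [measurable]: "ut t \<in> borel_measurable lborel" "S \<in> sets lborel"
    using L(2)[OF t] S by (auto simp: L2_real_iff)
  have int: "integrable lborel (\<lambda>x. indicator S x * (ut t x)\<^sup>2)"
    using integrable_real_mult_indicator[OF S, of "\<lambda>x. (ut t x)\<^sup>2"] L(2)[OF t]
    by (simp add: L2_real_iff mult.commute)
  have "((\<lambda>s. L2_norm (?q s)) \<longlongrightarrow> 0) (at t within I)"
    using C1 t by (simp add: C1_in_L2_def)
  then have "((\<lambda>s. L2_norm (?q s)) \<longlongrightarrow> 0) (at t within {a<..<t})"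
    using I(1) by (rule tendsto_within_subset)
  from tendsto_power[OF this, of 2]
  have lim: "((\<lambda>s. (L2_norm (?q s))\<^sup>2) \<longlongrightarrow> 0) (at t within {a<..<t})" by simp
  have "?J \<le> 0"
  proof (rule tendsto_lowerbound[OF lim])
    show "at t within {a<..<t} \<noteq> bot"
      using I(2) by (simp add: trivial_limit_within islimpt_greaterThanLessThan2)
    show "\<forall>\<^sub>F s in at t within {a<..<t}. ?J \<le> (L2_norm (?q s))\<^sup>2"
      unfolding eventually_at_filter
    proof (intro always_eventually allI impI)
      fix s assume s: "s \<in> {a<..<t}"
      have q: "?q s \<in> L2" by (intro L2_diff L2_divide L) (use s t I in auto)
      have "?J \<le> (LINT x|lborel. (?q s x)\<^sup>2)"
      proof (rule integral_mono_AE[OF int])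
        show "integrable lborel (\<lambda>x. (?q s x)\<^sup>2)" using q by (simp add: L2_real_iff)
        show "AE x in lborel. indicator S x * (ut t x)\<^sup>2 \<le> (?q s x)\<^sup>2"
          using u[of s] u[of t] s I(2) by (auto simp: indicator_def elim!: AE_mp)
      qed
      then show "?J \<le> (L2_norm (?q s))\<^sup>2" by (simp add: L2_norm_sq)
    qed
  qed
  then have "?J = 0" by (intro antisym) auto
  then have "AE x in lborel. indicator S x * (ut t x)\<^sup>2 = 0"
    using int by (subst (asm) integral_nonneg_eq_0_iff_AE) auto
  then show ?thesis by (auto simp: indicator_def elim!: AE_mp)
qed

section \<open>The equation tested with radial functions\<close>

locale supported_solution =
  fixes l p q R \<epsilon> :: real and u0 u1 :: "real ^ 'n::finite \<Rightarrow> real" and T :: ereal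
    and u ut :: "real \<Rightarrow> real ^ 'n \<Rightarrow> real"
  assumes l: "l > 0" and p: "p > 1" and q: "q > 1" and R: "R > 0" and \<epsilon>: "\<epsilon> > 0"
    and u0: "u0 \<in> L2" "ess_support u0 \<subseteq> cball 0 R"
    and u1: "u1 \<in> L2" "ess_support u1 \<subseteq> cball 0 R"
    and nonneg: "AE x in lborel. u0 x \<ge> 0" "AE x in lborel. u1 x \<ge> 0"
    and H1: "continuous_in_H1 (half_open_interval T) u"
    and C1: "C1_in_L2 (half_open_interval T) u ut"
    and u_0: "AE x in lborel. u 0 x = \<epsilon> * u0 x"
    and supp: "\<And>t. t \<in> open_interval T \<Longrightarrow> ess_support (u t) \<subseteq> cball 0 (R + t powr (l + 1) / (l + 1))"
    and weak: "\<And>\<psi> t. \<psi> \<in> test_functions (half_open_interval T \<times> UNIV) \<Longrightarrow> t \<in> open_interval T \<Longrightarrow>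
           set_integrable lborel ({0<..<t} \<times> UNIV)
             (\<lambda>(s, x). (\<bar>ut s x\<bar> powr p + \<bar>u s x\<bar> powr q) * \<psi> (s, x)) \<and>
           (LINT x|lborel. ut t x * \<psi> (t, x))
           - (LINT s:{0<..<t}|lborel. LINT x|lborel. ut s x * deriv (\<lambda>\<tau>. \<psi> (\<tau>, x)) s)
           + (LINT s:{0<..<t}|lborel. LINT x|lborel.
                s powr (2 * l) * (weak_grad (u s) x \<bullet> grad (\<lambda>y. \<psi> (s, y)) x))
           = \<epsilon> * (LINT x|lborel. u1 x * \<psi> (0, x))
           + (LINT s:{0<..<t}|lborel. LINT x|lborel.
                (\<bar>ut s x\<bar> powr p + \<bar>u s x\<bar> powr q) * \<psi> (s, x))"
begin

definition radius :: "real \<Rightarrow> real" where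
  "radius t = R + t powr (l + 1) / (l + 1)"

lemma radius_mono: "0 \<le> s \<Longrightarrow> s \<le> t \<Longrightarrow> radius s \<le> radius t"
  using l by (auto simp: radius_def intro!: divide_right_mono powr_mono2)

lemma radius_pos: "radius t > 0"
  using l R by (simp add: radius_def add_pos_nonneg)

lemma interval_down: "0 \<le> s \<Longrightarrow> s \<le> t \<Longrightarrow> ereal t < T \<Longrightarrow> s \<in> half_open_interval T"
  using ereal_le_less_trans by (auto simp: half_open_interval_def)

lemma open_interval_down: "0 < s \<Longrightarrow> s \<le> t \<Longrightarrow> ereal t < T \<Longrightarrow> s \<in> open_interval T"
  using ereal_le_less_trans by (auto simp: open_interval_def)

lemma AE_data_outside: "AE x in lborel. R < norm x \<longrightarrow> u0 x = 0" "AE x in lborel. R < norm x \<longrightarrow> u1 x = 0"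
  using AE_zero_outside_ess_support[OF u0(2)] AE_zero_outside_ess_support[OF u1(2)] by (auto simp: not_le)

lemma AE_u_outside:
  assumes "0 \<le> t" "t \<le> \<tau>" "ereal \<tau> < T"
  shows "AE x in lborel. radius \<tau> < norm x \<longrightarrow> u t x = 0"
\<comment> \<open>The support condition speaks of positive times; at time 0 the data take its
  place.\<close>
proof (cases "t = 0")
  case True
  have "R \<le> radius \<tau>" using l by (simp add: radius_def)
  show ?thesis unfolding True using u_0 AE_data_outside(1)
    by eventually_elim (use \<open>R \<le> radius \<tau>\<close> in auto)
next
  case False
  then have t: "t \<in> open_interval T" using assms open_interval_down by auto
  have "AE x in lborel. x \<notin> cball 0 (radius t) \<longrightarrow> u t x = 0"
    by (rule AE_zero_outside_ess_support) (use supp[OF t] in \<open>auto simp: radius_def\<close>)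
  then show ?thesis
    by eventually_elim (use radius_mono[OF assms(1,2)] in auto)
qed

lemma AE_ut_outside:
  assumes "0 < t" "t \<le> \<tau>" "ereal \<tau> < T"
  shows "AE x in lborel. radius \<tau> < norm x \<longrightarrow> ut t x = 0"
proof -
  have "AE x in lborel. x \<in> - cball 0 (radius \<tau>) \<longrightarrow> ut t x = 0"
  proof (rule C1_in_L2_derivative_support[OF C1])
    show "AE x in lborel. x \<in> - cball 0 (radius \<tau>) \<longrightarrow> u s x = 0" if "0 < s" "s \<le> t" for s
      using AE_u_outside[of s \<tau>] that assms by (auto simp: not_le)
  qed (use assms in \<open>auto intro!: interval_down[of _ \<tau>]\<close>)
  then show ?thesis by (auto simp: not_le)
qed

lemma u_L2: "s \<in> half_open_interval T \<Longrightarrow> u s \<in> L2" and ut_L2: "s \<in> half_open_interval T \<Longrightarrow> ut s \<in> L2"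
  using C1 by (auto simp: C1_in_L2_def continuous_in_L2_def)

lemma u_H1: "s \<in> half_open_interval T \<Longrightarrow> u s \<in> H1"
  using H1 by (auto simp: continuous_in_H1_def)

abbreviation N :: "real \<Rightarrow> real ^ 'n \<Rightarrow> real" where
  "N s x \<equiv> \<bar>ut s x\<bar> powr p + \<bar>u s x\<bar> powr q"

text \<open>\<open>G (x \<bullet> x)\<close> is an eigenfunction of the Laplacian with eigenvalue
  \<open>c\<close>, but not a test function; \<open>g\<close> is its truncation. The eigenvalue
  equation fails only outside the ball of radius \<open>radius \<tau>\<close>, where
  \<open>u s\<close> vanishes almost everywhere, and the time cutoff is constant before \<tau>, so
  the term with the time derivative drops out. Since \<open>g\<close> stays in the source term, its
  sign is part of the result.\<close>

lemma radial_test_function: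
  assumes \<tau>: "0 < \<tau>" "ereal \<tau> < T"
    and G: "\<And>k. Ck_on k UNIV G" "\<And>s. (G has_real_derivative G1 s) (at s)"
      "\<And>s. (G1 has_real_derivative G2 s) (at s)"
    and eig: "\<And>s. 2 * real CARD('n) * G1 s + 4 * s * G2 s = c * G s"
    and pos: "\<And>s. 0 \<le> s \<Longrightarrow> 0 \<le> G s"
  obtains g :: "real ^ 'n \<Rightarrow> real" where "g \<in> L2"
    "\<And>x. norm x \<le> radius \<tau> \<Longrightarrow> g x = G (x \<bullet> x)" "\<And>x. 0 \<le> g x"
    "\<And>t. 0 < t \<Longrightarrow> t \<le> \<tau> \<Longrightarrow> set_integrable lborel ({0<..<t} \<times> UNIV) (\<lambda>(s, x). N s x * g x)"
    "\<And>t. 0 < t \<Longrightarrow> t \<le> \<tau> \<Longrightarrow> (LINT x|lborel. ut t x * g x) =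
       \<epsilon> * (LINT x|lborel. u1 x * g x)
       + (LINT s:{0<..<t}|lborel. c * (s powr (2 * l) * (LINT x|lborel. u s x * g x)))
       + (LINT s:{0<..<t}|lborel. LINT x|lborel. N s x * g x)"
proof -
  define b where "b = (radius \<tau>)\<^sup>2"
  \<comment> \<open>The cutoff acts on the squared radius. The margin 1 makes \<open>H\<close> and
    \<open>G\<close> agree on an open set around the ball, hence together with two
    derivatives.\<close>
  obtain \<zeta> :: "real \<Rightarrow> real" where \<zeta>: "\<And>k. Ck_on k UNIV \<zeta>" "\<And>s. s \<le> b + 1 \<Longrightarrow> \<zeta> s = 1"
    "\<And>s. b + 2 \<le> s \<Longrightarrow> \<zeta> s = 0" "\<And>s. 0 \<le> \<zeta> s" "\<And>s. \<zeta> s \<le> 1"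
    by (rule smooth_cutoff[of "b + 1" "b + 2"]) (simp, rule that)
  obtain \<tau>' where \<tau>': "\<tau> < \<tau>'" "ereal \<tau>' < T"
    using ereal_dense2[OF \<tau>(2)] by auto
  obtain \<eta> :: "real \<Rightarrow> real" where \<eta>: "\<And>k. Ck_on k UNIV \<eta>" "\<And>s. s \<le> \<tau> \<Longrightarrow> \<eta> s = 1" "\<And>s. \<tau>' \<le> s \<Longrightarrow> \<eta> s = 0"
      "\<And>s. 0 \<le> \<eta> s" "\<And>s. \<eta> s \<le> 1"
    by (rule smooth_cutoff[OF \<tau>'(1)]) (rule that)
  define H where "H = (\<lambda>s. G s * \<zeta> s)"
  define H1 where "H1 = (\<lambda>s. frechet_derivative H (at s) 1)"
  define H2 where "H2 = (\<lambda>s. frechet_derivative H1 (at s) 1)"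
  have frechet: "(F has_real_derivative frechet_derivative F (at s) 1) (at s)"
    if "\<And>k. Ck_on k UNIV F" for F :: "real \<Rightarrow> real" and s
  proof -
    have d: "(F has_derivative frechet_derivative F (at s)) (at s)"
      by (rule Ck_on_SucD(1)[OF that[of "Suc 0"]])
    have "frechet_derivative F (at s) = (\<lambda>h. frechet_derivative F (at s) 1 * h)"
    proof
      show "frechet_derivative F (at s) h = frechet_derivative F (at s) 1 * h" for h
        using linear_scale[OF has_derivative_linear[OF d], of h 1] by simp
    qed
    with d show ?thesis unfolding has_field_derivative_def by metis
  qed
  have HC: "Ck_on k UNIV H" for k unfolding H_def by (intro Ck_on_mult G \<zeta>)
  have H1: "(H has_real_derivative H1 s) (at s)" for s unfolding H1_def by (rule frechet[OF HC])
  have H1C: "Ck_on k UNIV H1" for k by (rule Ck_on_real_derivative[OF HC H1])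
  have H2: "(H1 has_real_derivative H2 s) (at s)" for s unfolding H2_def by (rule frechet[OF H1C])
  have HG: "H s = G s" if "s < b + 1" for s using that \<zeta>(2) by (simp add: H_def)
  have HG1: "H1 s = G1 s" if "s < b + 1" for s
    by (rule DERIV_eq_on_open[OF H1 G(2), of "{..<b + 1}"]) (use that HG in auto)
  have HG2: "H2 s = G2 s" if "s < b + 1" for s
    by (rule DERIV_eq_on_open[OF H2 G(3), of "{..<b + 1}"]) (use that HG1 in auto)
  have Hsupp: "H s = 0" if "b + 2 < s" for s using that \<zeta>(3) by (simp add: H_def)
  have b: "0 \<le> b" by (simp add: b_def)
  define g where "g = (\<lambda>x::real^'n. H (x \<bullet> x))"
  have gC: "Ck_on k UNIV g" for k unfolding g_def by (rule Ck_on_radial[OF HC])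
  have inner_b: "x \<bullet> x < b + 1" if "norm x \<le> radius \<tau>" for x :: "real ^ 'n"
    using power_mono[OF that, of 2] by (simp add: b_def power2_norm_eq_inner)
  have gout: "g x = 0" if "sqrt (b + 2) < norm x" for x
    using power_strict_mono[OF that, of 2] b Hsupp by (simp add: g_def power2_norm_eq_inner)
  have gL2: "g \<in> L2"
    using continuous_compact_support_L2[of g "sqrt (b + 2)"] gC[of 0] gout by auto
  have geq: "g x = G (x \<bullet> x)" if "norm x \<le> radius \<tau>" for x
    using HG inner_b[OF that] by (simp add: g_def)
  have gpos: "0 \<le> g x" for x
    using pos[of "x \<bullet> x"] \<zeta>(4) by (simp add: g_def H_def)
  let ?\<psi> = "\<lambda>z::real \<times> (real^'n). \<eta> (fst z) * g (snd z)"
  have \<psi>: "?\<psi> \<in> test_functions (half_open_interval T \<times> UNIV)"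
    by (rule test_functions_cylinder_I[OF \<eta>(1,3) \<tau>'(2) gC gout])
  have time: "(LINT x|lborel. ut s x * deriv (\<lambda>\<tau>. ?\<psi> (\<tau>, x)) s) = 0" if "s < \<tau>" for s
  proof -
    have "((\<lambda>\<tau>. ?\<psi> (\<tau>, x)) has_real_derivative 0) (at s)" for x
      by (rule has_field_derivative_transform_within_open[OF DERIV_const[of "g x"], of "{..<\<tau>}"])
        (use that \<eta>(2) in auto)
    then have "deriv (\<lambda>\<tau>. ?\<psi> (\<tau>, x)) s = 0" for x
      by (rule DERIV_imp_deriv)
    then show ?thesis by simp
  qed
  have space: "(LINT x|lborel. s powr (2 * l) * (weak_grad (u s) x \<bullet> grad (\<lambda>y. ?\<psi> (s, y)) x)) =
      - (c * (s powr (2 * l) * (LINT x|lborel. u s x * g x)))" if s: "0 < s" "s \<le> \<tau>" for s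
  proof -
    have sI: "s \<in> half_open_interval T" using s \<tau> interval_down by auto
    have [measurable]: "u s \<in> borel_measurable lborel" using u_L2[OF sI] by (simp add: L2_real_iff)
    have meas: "g \<in> borel_measurable lborel" "(\<lambda>x::real^'n. H1 (x \<bullet> x)) \<in> borel_measurable lborel"
      "(\<lambda>x::real^'n. H2 (x \<bullet> x)) \<in> borel_measurable lborel"
      using gC[of 0] Ck_on_radial[OF H1C, of 0] Ck_on_radial[OF Ck_on_real_derivative[OF H1C H2], of 0]
      by (auto intro!: borel_measurable_continuous_onI)
    note [measurable] = meas
    have "(LINT x|lborel. s powr (2 * l) * (weak_grad (u s) x \<bullet> grad (\<lambda>y. ?\<psi> (s, y)) x)) =
        s powr (2 * l) * (LINT x|lborel. weak_grad (u s) x \<bullet> grad (\<lambda>y. H (y \<bullet> y)) x)"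
      using \<eta>(2) s by (simp add: g_def)
    also have "(LINT x|lborel. weak_grad (u s) x \<bullet> grad (\<lambda>y. H (y \<bullet> y)) x) =
        - (LINT x|lborel. u s x * (2 * CARD('n) * H1 (x \<bullet> x) + 4 * (x \<bullet> x) * H2 (x \<bullet> x)))"
      by (rule weak_grad_radial[OF u_H1[OF sI] HC H1 H2 Hsupp]) (use b in auto)
    also have "(LINT x|lborel. u s x * (2 * CARD('n) * H1 (x \<bullet> x) + 4 * (x \<bullet> x) * H2 (x \<bullet> x))) =
        (LINT x|lborel. c * (u s x * g x))"
    proof (rule integral_cong_AE)
      have eq: "2 * real CARD('n) * H1 (x \<bullet> x) + 4 * (x \<bullet> x) * H2 (x \<bullet> x) = c * g x" if "norm x \<le> radius \<tau>" for x :: "real^'n"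
        using HG1[OF inner_b[OF that]] HG2[OF inner_b[OF that]] geq[OF that] eig[of "x \<bullet> x"] by simp
      show "AE x in lborel. u s x * (2 * CARD('n) * H1 (x \<bullet> x) + 4 * (x \<bullet> x) * H2 (x \<bullet> x)) = c * (u s x * g x)"
        using AE_u_outside[OF less_imp_le[OF s(1)] s(2) \<tau>(2)]
      proof eventually_elim
        case (elim x)
        then show ?case using eq[of x] by (cases "norm x \<le> radius \<tau>") auto
      qed
    qed measurable
    finally show ?thesis by simp
  qed
  show thesis
  proof
    fix t assume t: "0 < t" "t \<le> \<tau>"
    then have tI: "t \<in> open_interval T" using \<tau> open_interval_down by auto
    note W = weak[OF \<psi> tI]
    have "set_integrable lborel ({0<..<t} \<times> UNIV) (\<lambda>(s, x). N s x * ?\<psi> (s, x))" using W by blast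
    then show "set_integrable lborel ({0<..<t} \<times> UNIV) (\<lambda>(s, x). N s x * g x)"
      by (rule set_integrable_cong[THEN iffD1, rotated -1]) (use t \<eta>(2) in auto)
    have 1: "(LINT s:{0<..<t}|lborel. LINT x|lborel. ut s x * deriv (\<lambda>\<tau>. ?\<psi> (\<tau>, x)) s) = (LINT s:{0<..<t}|lborel. 0)"
      by (rule set_lebesgue_integral_cong) (use time t in auto)
    have 2: "(LINT s:{0<..<t}|lborel. LINT x|lborel. s powr (2 * l) * (weak_grad (u s) x \<bullet> grad (\<lambda>y. ?\<psi> (s, y)) x)) =
       (LINT s:{0<..<t}|lborel. - (c * (s powr (2 * l) * (LINT x|lborel. u s x * g x))))"
      by (rule set_lebesgue_integral_cong) (use space t in auto)
    have 3: "(LINT s:{0<..<t}|lborel. LINT x|lborel. N s x * ?\<psi> (s, x)) = (LINT s:{0<..<t}|lborel. LINT x|lborel. N s x * g x)"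
      by (rule set_lebesgue_integral_cong) (use \<eta>(2) t in auto)
    have 4: "?\<psi> (t, x) = g x" "?\<psi> (0, x) = g x" for x using t \<eta>(2) \<tau> by auto
    have 5: "(LINT s:{0<..<t}|lborel. - (c * (s powr (2 * l) * (LINT x|lborel. u s x * g x)))) =
      - (LINT s:{0<..<t}|lborel. c * (s powr (2 * l) * (LINT x|lborel. u s x * g x)))"
      by (simp add: set_lebesgue_integral_def mult.left_commute[of _ c])
    show "(LINT x|lborel. ut t x * g x) = \<epsilon> * (LINT x|lborel. u1 x * g x)
       + (LINT s:{0<..<t}|lborel. c * (s powr (2 * l) * (LINT x|lborel. u s x * g x)))
       + (LINT s:{0<..<t}|lborel. LINT x|lborel. N s x * g x)"
      using W unfolding 1 2 3 4 5 by simp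
  qed (use gL2 geq gpos in auto)
qed

end

text \<open>Used twice: for \<open>u\<close> the weight is the indicator itself, for
  \<open>ut\<close> it decays exponentially from the edge inwards.\<close>

lemma ball_power_mean:
  fixes f w :: "'a::euclidean_space \<Rightarrow> real"
  assumes r: "r > 1" and f: "f \<in> L2"
    and fr: "integrable lborel (\<lambda>x. indicator (cball 0 \<rho>) x * \<bar>f x\<bar> powr r)"
    and w: "w \<in> borel_measurable lborel" "\<And>x. 0 \<le> w x" "\<And>x. w x \<le> indicator (cball 0 \<rho>) x"
  shows "integrable lborel (\<lambda>x. \<bar>f x\<bar> * w x)"
    and "(LINT x|lborel. \<bar>f x\<bar> * w x) powr r \<le>
      (LINT x|lborel. indicator (cball 0 \<rho>) x * \<bar>f x\<bar> powr r) * (LINT x|lborel. w x) powr (r - 1)"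
proof -
  let ?i = "indicator (cball (0::'a) \<rho>) :: 'a \<Rightarrow> real"
  have [measurable]: "f \<in> borel_measurable lborel" "w \<in> borel_measurable lborel"
    using f w by (auto simp: L2_real_iff)
  have i: "integrable lborel ?i"
    using emeasure_bounded_finite[of "cball (0::'a) \<rho>"] by (intro integrable_real_indicator) auto
  have "(\<lambda>x. (?i x)\<^sup>2) = ?i" by (auto simp: indicator_def fun_eq_iff)
  then have iL: "?i \<in> L2" using i by (simp add: L2_real_iff)
  have wi: "integrable lborel w"
    by (rule Bochner_Integration.integrable_bound[OF i]) (use w in auto)
  show fw: "integrable lborel (\<lambda>x. \<bar>f x\<bar> * w x)"
    by (rule Bochner_Integration.integrable_bound[OF L2_mult_integrable[OF f iL]])
      (use w in \<open>auto simp: abs_mult intro!: mult_left_mono\<close>)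
  have le: "\<bar>f x\<bar> powr r * w x \<le> ?i x * \<bar>f x\<bar> powr r" for x
    using mult_left_mono[OF w(3)[of x], of "\<bar>f x\<bar> powr r"] by (simp add: mult.commute)
  have fwr: "integrable lborel (\<lambda>x. \<bar>f x\<bar> powr r * w x)"
    by (rule Bochner_Integration.integrable_bound[OF fr]) (use w le in \<open>auto simp: abs_mult\<close>)
  have "(LINT x|lborel. \<bar>f x\<bar> * w x) powr r \<le> (LINT x|lborel. \<bar>f x\<bar> powr r * w x) * (LINT x|lborel. w x) powr (r - 1)"
    by (rule weighted_power_mean[OF r w(2) _ wi fw fwr]) simp
  also have "\<dots> \<le> (LINT x|lborel. ?i x * \<bar>f x\<bar> powr r) * (LINT x|lborel. w x) powr (r - 1)"
    by (intro mult_right_mono integral_mono fwr fr le) auto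
  finally show "(LINT x|lborel. \<bar>f x\<bar> * w x) powr r \<le>
      (LINT x|lborel. ?i x * \<bar>f x\<bar> powr r) * (LINT x|lborel. w x) powr (r - 1)" .
qed

text \<open>The root of \<open>bessel_growth\<close>, factored for its use:
  \<open>exp \<rho>\<close> will cancel against the growth of the moment, and the last factor is the
  weight of \<open>exp_shell_integral\<close>.\<close>

lemma bessel_upper:
  assumes "0 \<le> r" "r \<le> \<rho>" "0 < \<rho>"
  shows "bessel m (r\<^sup>2) \<le> sqrt (2 ^ (m + 1) * fact m) * \<rho> powr (- (real m / 2)) * exp \<rho> * exp (- (\<rho> - r) / 2)"
proof -
  have F: "0 \<le> bessel m (r\<^sup>2)" using bessel_ge_1[of "r\<^sup>2" m] by simp
  have "(\<rho> powr (real m / 2) * bessel m (r\<^sup>2))\<^sup>2 = \<rho> ^ m * (bessel m (r\<^sup>2))\<^sup>2"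
    using assms by (simp add: power_mult_distrib power2_eq_square powr_realpow flip: powr_add)
  also have "\<dots> \<le> 2 ^ (m + 1) * fact m * exp (\<rho> + r)"
    by (rule bessel_growth[OF assms(1,2)])
  also have "\<dots> = (sqrt (2 ^ (m + 1) * fact m) * exp ((\<rho> + r) / 2))\<^sup>2"
    by (simp add: power_mult_distrib power2_eq_square[of "exp _"] mult_exp_exp)
  finally have "\<rho> powr (real m / 2) * bessel m (r\<^sup>2) \<le> sqrt (2 ^ (m + 1) * fact m) * exp ((\<rho> + r) / 2)"
    by (rule power2_le_imp_le) simp
  then have "\<rho> powr (- (real m / 2)) * (\<rho> powr (real m / 2) * bessel m (r\<^sup>2)) \<le>
      \<rho> powr (- (real m / 2)) * (sqrt (2 ^ (m + 1) * fact m) * exp ((\<rho> + r) / 2))"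
    by (intro mult_left_mono) auto
  moreover have "\<rho> powr (- (real m / 2)) * \<rho> powr (real m / 2) = 1"
    using assms by (simp flip: powr_add)
  moreover have "exp ((\<rho> + r) / 2) = exp \<rho> * exp (- (\<rho> - r) / 2)"
    by (simp add: mult_exp_exp field_simps)
  ultimately show ?thesis by (simp add: mult_ac flip: mult.assoc[of "\<rho> powr (- (real m / 2))" "\<rho> powr (real m / 2)"])
qed

lemma set_lebesgue_integral_open_eq_integral:
  fixes f :: "real \<Rightarrow> real"
  assumes "continuous_on {a..b} f"
  shows "(LINT s:{a<..<b}|lborel. f s) = integral {a..b} f"
proof -
  have "set_integrable lborel {a..b} f" by (rule borel_integrable_atLeastAtMost'[OF assms])
  then have "set_integrable lborel {a<..<b} f" by (rule set_integrable_subset) auto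
  then show ?thesis
    by (simp add: set_borel_integral_eq_integral(2) integral_open_interval_real)
qed

lemma integrable_L2_compact_support:
  fixes f h :: "'a::euclidean_space \<Rightarrow> real"
  assumes f: "f \<in> L2" "AE x in lborel. r < norm x \<longrightarrow> f x = 0" and h: "continuous_on UNIV h"
  shows "integrable lborel (\<lambda>x. f x * h x)"
proof -
  have [measurable]: "f \<in> borel_measurable lborel" "h \<in> borel_measurable lborel"
    using f h by (auto simp: L2_real_iff intro: borel_measurable_continuous_onI)
  have "integrable lborel (\<lambda>x. indicator (cball 0 r) x *\<^sub>R (h x)\<^sup>2)"
    by (intro borel_integrable_compact continuous_intros continuous_on_subset[OF h]) auto
  moreover have "(\<lambda>x. indicator (cball 0 r) x *\<^sub>R (h x)\<^sup>2) = (\<lambda>x. (indicator (cball 0 r) x * h x)\<^sup>2)"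
    by (auto simp: indicator_def fun_eq_iff)
  moreover have "(\<lambda>x. indicator (cball 0 r) x * h x) \<in> borel_measurable lborel"
    using borel_measurable_continuous_onI[OF h] by (intro borel_measurable_times borel_measurable_indicator) auto
  ultimately have "(\<lambda>x. indicator (cball 0 r) x * h x) \<in> L2"
    unfolding L2_real_iff by metis
  then have i: "integrable lborel (\<lambda>x. f x * (indicator (cball 0 r) x * h x))"
    by (rule L2_mult_integrable[OF f(1)])
  have ae: "AE x in lborel. f x * (indicator (cball 0 r) x * h x) = f x * h x"
    using f(2) by eventually_elim (auto simp: indicator_def)
  have "(\<lambda>x. f x * h x) \<in> borel_measurable lborel"
    by (intro borel_measurable_times) simp_all
  from integrable_cong_AE[THEN iffD1, OF borel_measurable_integrable[OF i] this ae i] show ?thesis .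
qed

section \<open>Lower bounds for the source and the lifespan estimate\<close>

context supported_solution
begin

lemma moment_DERIV:
  assumes "g \<in> L2" "0 < t" "ereal t < T"
  shows "((\<lambda>s. LINT x|lborel. u s x * g x) has_real_derivative (LINT x|lborel. ut t x * g x)) (at t)"
proof -
  obtain t' where t': "t < t'" "ereal t' < T" using ereal_dense2[OF assms(3)] by auto
  have "at t within half_open_interval T = at t"
    by (rule at_within_open_subset[of t "{0<..<t'}"])
      (use assms t' interval_down[of _ t'] in auto)
  then show ?thesis
    using C1_in_L2_moment[OF C1 assms(1) interval_down[of t t]] assms by simp
qed

lemma moment_continuous:
  assumes "g \<in> L2" "ereal \<tau> < T"
  shows "continuous_on {0..\<tau>} (\<lambda>s. LINT x|lborel. u s x * g x)"
proof -
  have "continuous_on (half_open_interval T) (\<lambda>s. LINT x|lborel. u s x * g x)"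
    by (rule DERIV_continuous_on[OF C1_in_L2_moment[OF C1 assms(1)]])
  then show ?thesis
    by (rule continuous_on_subset) (use assms interval_down[of _ \<tau>] in auto)
qed

text \<open>Since \<open>g0\<close> is 1 on the ball and nonnegative elsewhere, the integral of
  \<open>N s x * g0 x\<close> dominates both power integrals over the ball. The two bounds differ in
  the mass of the weight: the volume of the ball for \<open>u\<close>, only a boundary layer for
  \<open>ut\<close>.\<close>

lemma source_mean_bounds:
  assumes s: "0 < s" "s \<le> \<tau>" "ereal \<tau> < T"
    and g0: "g0 \<in> L2" "\<And>x. norm x \<le> radius \<tau> \<Longrightarrow> g0 x = 1" "\<And>x. 0 \<le> g0 x"
    and int: "integrable lborel (\<lambda>x. N s x * g0 x)"
    and g1: "g1 \<in> L2" "\<And>x. norm x \<le> radius \<tau> \<Longrightarrow> g1 x = bessel m (x \<bullet> x)" and m: "CARD('n) = Suc m"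
  shows "\<bar>LINT x|lborel. u s x * g0 x\<bar> powr q \<le>
      (LINT x|lborel. N s x * g0 x) * (unit_ball_vol CARD('n) * radius s ^ CARD('n)) powr (q - 1)"
    and "(\<bar>LINT x|lborel. ut s x * g1 x\<bar> / (sqrt (2 ^ (m + 1) * fact m) * radius s powr (- (real m / 2)) * exp (radius s))) powr p \<le>
      (LINT x|lborel. N s x * g0 x) * (unit_ball_vol (Suc m) * Suc m / (1 - exp (- 1 / 2)) * radius s ^ m) powr (p - 1)"
proof -
  let ?\<rho> = "radius s" and ?i = "indicator (cball 0 (radius s)) :: real ^ 'n \<Rightarrow> real"
  have sI: "s \<in> half_open_interval T" using s interval_down by auto
  have sT: "ereal s < T" using s ereal_le_less_trans by auto
  have \<rho>: "0 < ?\<rho>" "?\<rho> \<le> radius \<tau>" using radius_pos radius_mono s by auto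
  have meas [measurable]: "u s \<in> borel_measurable lborel" "ut s \<in> borel_measurable lborel"
    using u_L2[OF sI] ut_L2[OF sI] by (auto simp: L2_real_iff)
  have le: "?i x * \<bar>ut s x\<bar> powr p \<le> N s x * g0 x" "?i x * \<bar>u s x\<bar> powr q \<le> N s x * g0 x" for x
    using g0(2,3)[of x] \<rho> by (auto simp: indicator_def)
  have iut: "integrable lborel (\<lambda>x. ?i x * \<bar>ut s x\<bar> powr p)"
  proof (rule Bochner_Integration.integrable_bound[OF int])
    show "(\<lambda>x. ?i x * \<bar>ut s x\<bar> powr p) \<in> borel_measurable lborel"
      by (intro borel_measurable_times borel_measurable_indicator powr_real_measurable borel_measurable_const borel_measurable_abs meas) auto
  qed (use le g0(3) in auto)
  have iu: "integrable lborel (\<lambda>x. ?i x * \<bar>u s x\<bar> powr q)"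
  proof (rule Bochner_Integration.integrable_bound[OF int])
    show "(\<lambda>x. ?i x * \<bar>u s x\<bar> powr q) \<in> borel_measurable lborel"
      by (intro borel_measurable_times borel_measurable_indicator powr_real_measurable borel_measurable_const borel_measurable_abs meas) auto
  qed (use le g0(3) in auto)
  have uout: "AE x in lborel. ?\<rho> < norm x \<longrightarrow> u s x = 0"
    by (rule AE_u_outside) (use s sT in auto)
  have utout: "AE x in lborel. ?\<rho> < norm x \<longrightarrow> ut s x = 0"
    by (rule AE_ut_outside) (use s sT in auto)
  have i: "?i \<in> borel_measurable lborel" by (intro borel_measurable_indicator) auto
  note mean = ball_power_mean[OF q u_L2[OF sI] iu i]
  have "\<bar>LINT x|lborel. u s x * g0 x\<bar> \<le> (LINT x|lborel. \<bar>u s x * g0 x\<bar>)"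
    by (rule integral_abs_bound)
  also have "\<dots> = (LINT x|lborel. \<bar>u s x\<bar> * ?i x)"
  proof (rule integral_cong_AE)
    show "AE x in lborel. \<bar>u s x * g0 x\<bar> = \<bar>u s x\<bar> * ?i x"
      using uout by eventually_elim (use g0(2) \<rho> in \<open>auto simp: indicator_def abs_mult\<close>)
  qed (use g0(1) i in \<open>auto simp: L2_real_iff\<close>)
  finally have "\<bar>LINT x|lborel. u s x * g0 x\<bar> powr q \<le> (LINT x|lborel. \<bar>u s x\<bar> * ?i x) powr q"
    using q by (intro powr_mono2) auto
  also have "\<dots> \<le> (LINT x|lborel. ?i x * \<bar>u s x\<bar> powr q) * (LINT x|lborel. ?i x) powr (q - 1)"
    by (rule mean) auto
  also have "\<dots> \<le> (LINT x|lborel. N s x * g0 x) * (LINT x|lborel. ?i x) powr (q - 1)"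
    by (intro mult_right_mono integral_mono iu int le) auto
  also have "(LINT x|lborel. ?i x) = unit_ball_vol CARD('n) * ?\<rho> ^ CARD('n)"
    using \<rho> measure_cball_0[of ?\<rho>, where 'a = "real ^ 'n"] by simp
  finally show "\<bar>LINT x|lborel. u s x * g0 x\<bar> powr q \<le>
      (LINT x|lborel. N s x * g0 x) * (unit_ball_vol CARD('n) * radius s ^ CARD('n)) powr (q - 1)" .
  define w where "w = (\<lambda>x::real^'n. ?i x * exp (- (?\<rho> - norm x) / 2))"
  define M where "M = sqrt (2 ^ (m + 1) * fact m) * ?\<rho> powr (- (real m / 2)) * exp ?\<rho>"
  have M: "M > 0" using \<rho> by (auto simp: M_def)
  have w: "w \<in> borel_measurable lborel" "\<And>x. 0 \<le> w x" "\<And>x. w x \<le> ?i x"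
    by (auto simp: w_def indicator_def)
  note mean = ball_power_mean[OF p ut_L2[OF sI] iut w]
  have "\<bar>LINT x|lborel. ut s x * g1 x\<bar> \<le> (LINT x|lborel. \<bar>ut s x * g1 x\<bar>)"
    by (rule integral_abs_bound)
  also have "\<dots> \<le> (LINT x|lborel. M * (\<bar>ut s x\<bar> * w x))"
  proof (rule integral_mono_AE)
    show "integrable lborel (\<lambda>x. \<bar>ut s x * g1 x\<bar>)"
      by (intro integrable_abs L2_mult_integrable ut_L2 sI g1)
    show "integrable lborel (\<lambda>x. M * (\<bar>ut s x\<bar> * w x))" using mean(1) by simp
    show "AE x in lborel. \<bar>ut s x * g1 x\<bar> \<le> M * (\<bar>ut s x\<bar> * w x)"
      using utout
    proof eventually_elim
      case (elim x)
      show ?case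
      proof (cases "norm x \<le> ?\<rho>")
        case True
        have "bessel m (x \<bullet> x) \<le> M * w x"
          using bessel_upper[OF norm_ge_zero True \<rho>(1), of m] True
          by (simp add: M_def w_def power2_norm_eq_inner)
        moreover have "1 \<le> bessel m (x \<bullet> x)" by (rule bessel_ge_1) simp
        moreover have "g1 x = bessel m (x \<bullet> x)" using g1(2) True \<rho> by simp
        ultimately have "\<bar>ut s x\<bar> * \<bar>g1 x\<bar> \<le> \<bar>ut s x\<bar> * (M * w x)" by (intro mult_left_mono) auto
        then show ?thesis by (simp add: abs_mult mult_ac)
      next
        case False
        then show ?thesis using elim by simp
      qed
    qed
  qed
  finally have "\<bar>LINT x|lborel. ut s x * g1 x\<bar> / M \<le> (LINT x|lborel. \<bar>ut s x\<bar> * w x)"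
    using M by (simp add: divide_le_eq mult.commute)
  then have "(\<bar>LINT x|lborel. ut s x * g1 x\<bar> / M) powr p \<le> (LINT x|lborel. \<bar>ut s x\<bar> * w x) powr p"
    using p M by (intro powr_mono2) auto
  also have "\<dots> \<le> (LINT x|lborel. ?i x * \<bar>ut s x\<bar> powr p) * (LINT x|lborel. w x) powr (p - 1)"
    by (rule mean)
  also have "\<dots> \<le> (LINT x|lborel. N s x * g0 x) * (unit_ball_vol (Suc m) * Suc m / (1 - exp (- 1 / 2)) * ?\<rho> ^ m) powr (p - 1)"
  proof (rule mult_mono[OF integral_mono[OF iut int le(1)] powr_mono2])
    show "(LINT x|lborel. w x) \<le> unit_ball_vol (Suc m) * Suc m / (1 - exp (- 1 / 2)) * ?\<rho> ^ m"
      unfolding w_def by (rule exp_shell_integral(2)) (use \<rho> m in auto)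
  qed (use p w g0(3) in \<open>auto intro!: Bochner_Integration.integral_nonneg\<close>)
  finally show "(\<bar>LINT x|lborel. ut s x * g1 x\<bar> / (sqrt (2 ^ (m + 1) * fact m) * radius s powr (- (real m / 2)) * exp (radius s))) powr p \<le>
      (LINT x|lborel. N s x * g0 x) * (unit_ball_vol (Suc m) * Suc m / (1 - exp (- 1 / 2)) * radius s ^ m) powr (p - 1)"
    by (simp add: M_def)
qed

text \<open>For \<open>s \<ge> 1\<close> the quotient of \<open>radius s\<close> and
  \<open>s powr (l + 1)\<close> lies between \<open>1 / (l + 1)\<close> and
  \<open>R + 1 / (l + 1)\<close>; the minimum serves both signs of \<gamma>.\<close>

lemma radius_powr_lower:
  assumes "1 \<le> s"
  shows "min ((1 / (l + 1)) powr \<gamma>) ((R + 1 / (l + 1)) powr \<gamma>) * s powr ((l + 1) * \<gamma>) \<le> radius s powr \<gamma>"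
proof -
  define y where "y = radius s / s powr (l + 1)"
  have s1: "1 \<le> s powr (l + 1)" using assms l by (intro ge_one_powr_ge_zero) auto
  have "y = R / s powr (l + 1) + 1 / (l + 1)"
    using s1 assms by (simp add: y_def radius_def add_divide_distrib)
  moreover have "0 \<le> R / s powr (l + 1)" "R / s powr (l + 1) \<le> R"
    using s1 R by (auto simp: divide_le_eq mult_le_cancel_left1)
  ultimately have y: "1 / (l + 1) \<le> y" "y \<le> R + 1 / (l + 1)" by auto
  have "min ((1 / (l + 1)) powr \<gamma>) ((R + 1 / (l + 1)) powr \<gamma>) \<le> y powr \<gamma>"
  proof (cases "\<gamma> \<ge> 0")
    case True
    have "(1 / (l + 1)) powr \<gamma> \<le> y powr \<gamma>" using y l True by (intro powr_mono2) auto
    then show ?thesis by simp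
  next
    case False
    have "0 < y" using y(1) l by (auto intro: less_le_trans[rotated])
    then have "(R + 1 / (l + 1)) powr \<gamma> \<le> y powr \<gamma>" using y False by (intro powr_mono2') auto
    then show ?thesis by simp
  qed
  then have "min ((1 / (l + 1)) powr \<gamma>) ((R + 1 / (l + 1)) powr \<gamma>) * s powr ((l + 1) * \<gamma>) \<le> y powr \<gamma> * (s powr (l + 1)) powr \<gamma>"
    by (simp add: powr_powr mult_right_mono)
  also have "\<dots> = radius s powr \<gamma>"
    using s1 assms radius_pos[of s] by (simp add: y_def flip: powr_mult)
  finally show ?thesis .
qed

end

text \<open>The factor \<open>exp E\<close> in \<open>V\<close> against
  \<open>exp \<rho> = exp (R + E)\<close> leaves \<open>exp (- R)\<close>. The mean contributes
  \<open>\<rho> powr (m * p / 2)\<close> and costs \<open>\<rho> powr (m * (p - 1))\<close>, whence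
  the exponent \<open>m * (1 - p / 2)\<close>.\<close>

lemma powr_source_lower:
  fixes \<epsilon> c s l p \<rho> P D R :: real and m :: nat
  assumes pos: "\<epsilon> > 0" "c > 0" "s > 0" "\<rho> > 0" "B > 0" "D > 0" and p: "p > 1"
    and \<rho>: "\<rho> = R + E"
    and V: "\<epsilon> * c * (s powr (l / 2) * exp E) \<le> V"
    and P: "(\<bar>V\<bar> / (B * \<rho> powr (- (real m / 2)) * exp \<rho>)) powr p \<le> P * (D * \<rho> ^ m) powr (p - 1)"
  shows "\<epsilon> powr p * ((c * exp (- R) / B) powr p / D powr (p - 1)) * s powr (l * p / 2) * \<rho> powr (real m * (1 - p / 2)) \<le> P"
proof -
  define X where "X = \<epsilon> * (c * exp (- R) / B) * s powr (l / 2) * \<rho> powr (real m / 2)"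
  have "X = \<epsilon> * c * (s powr (l / 2) * exp E) / (B * \<rho> powr (- (real m / 2)) * exp \<rho>)"
    using pos by (simp add: X_def \<rho> exp_add exp_minus powr_minus field_simps)
  also have "\<dots> \<le> \<bar>V\<bar> / (B * \<rho> powr (- (real m / 2)) * exp \<rho>)"
    using pos V by (intro divide_right_mono) auto
  finally have X: "X \<le> \<bar>V\<bar> / (B * \<rho> powr (- (real m / 2)) * exp \<rho>)" .
  have gen: "(\<epsilon> * z * s powr (l / 2) * \<rho> powr (real m / 2)) powr p =
      \<epsilon> powr p * z powr p * s powr (l * p / 2) * \<rho> powr (real m * p / 2)" if "z > 0" for z
    using pos that by (simp add: powr_mult powr_powr)
  have "X powr p = \<epsilon> powr p * (c * exp (- R) / B) powr p * s powr (l * p / 2) * \<rho> powr (real m * p / 2)"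
    unfolding X_def by (rule gen) (use pos in simp)
  moreover have "X powr p \<le> P * (D * \<rho> ^ m) powr (p - 1)"
    using pos p by (intro order_trans[OF powr_mono2[OF _ _ X] P]) (auto simp: X_def)
  moreover have "(D * \<rho> ^ m) powr (p - 1) = D powr (p - 1) * \<rho> powr (real m * (p - 1))"
    using pos by (simp add: powr_mult powr_powr flip: powr_realpow)
  moreover have "\<rho> powr (real m * p / 2) = \<rho> powr (real m * (1 - p / 2)) * \<rho> powr (real m * (p - 1))"
    by (simp add: field_simps flip: powr_add)
  ultimately have "(\<epsilon> powr p * (c * exp (- R) / B) powr p * s powr (l * p / 2) * \<rho> powr (real m * (1 - p / 2))) * \<rho> powr (real m * (p - 1))
      \<le> (P * D powr (p - 1)) * \<rho> powr (real m * (p - 1))"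
    by (simp add: mult_ac)
  then have "\<epsilon> powr p * (c * exp (- R) / B) powr p * s powr (l * p / 2) * \<rho> powr (real m * (1 - p / 2)) \<le> P * D powr (p - 1)"
    using pos by simp
  then show ?thesis
    using pos by (simp add: pos_divide_le_eq mult_ac)
qed

text \<open>The constants enter through equations that mention neither \<epsilon> nor \<tau> nor the
  solution. This is how the final constant becomes uniform.\<close>

lemma (in supported_solution) lifespan_bound:
  assumes \<tau>: "4 \<le> \<tau>" "ereal \<tau> < T" and m: "CARD('n) = Suc m"
    and a: "a = (LINT x|lborel. u0 x * bessel m (x \<bullet> x))" and b: "b = (LINT x|lborel. u1 x * bessel m (x \<bullet> x))"
    and ab: "0 \<le> a" "0 \<le> b" "0 < a + b"
    and c: "c = (b + a / (2 * l + 1)) / ((l / 2 + 2) * exp (1 / (l + 1)))"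
    and D: "D = unit_ball_vol (Suc m) * Suc m / (1 - exp (- 1 / 2))"
    and \<kappa>: "\<kappa> = (c * exp (- R) / sqrt (2 ^ (m + 1) * fact m)) powr p / D powr (p - 1) *
      min ((1 / (l + 1)) powr (real m * (1 - p / 2))) ((R + 1 / (l + 1)) powr (real m * (1 - p / 2)))"
    and k: "k = min ((1 / (l + 1)) powr (- (CARD('n) * (q - 1)))) ((R + 1 / (l + 1)) powr (- (CARD('n) * (q - 1)))) /
      unit_ball_vol CARD('n) powr (q - 1)"
    and \<beta>: "\<beta> = (l + 1) * (CARD('n) * (q - 1))"
    and \<mu>: "\<mu> = l * p / 2 + (l + 1) * (real m * (1 - p / 2))"
  shows "\<kappa> > 0" and "\<tau> powr (2 - \<beta> + (\<mu> + 2) * (q - 1)) * (\<kappa> * \<epsilon> powr p) powr (q - 1) \<le>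
    8 / (1 - 2 powr (- (q - 1) / 2))\<^sup>2 / (k * 4 powr (- \<bar>\<beta>\<bar>) * (4 powr (- \<bar>\<mu>\<bar>) / 64) powr (q - 1))"
proof -
  have "0 < b + a / (2 * l + 1)"
    using ab l by (cases "a = 0") (auto intro!: add_nonneg_pos)
  then have c0: "c > 0" using l unfolding c by (intro divide_pos_pos mult_pos_pos) auto
  have D0: "D > 0" unfolding D by (intro divide_pos_pos mult_pos_pos) auto
  have l1: "0 < 1 / (l + 1)" "0 < R + 1 / (l + 1)" using l R by (auto intro: add_pos_pos)
  show \<kappa>0: "\<kappa> > 0" using c0 D0 l1 unfolding \<kappa> by (intro mult_pos_pos divide_pos_pos) auto
  have "unit_ball_vol CARD('n) \<noteq> 0" using unit_ball_vol_pos[of "CARD('n)"] by linarith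
  then have k0: "k > 0" using l1 unfolding k by (intro divide_pos_pos) auto
  have \<tau>0: "0 < \<tau>" using \<tau> by simp
  \<comment> \<open>\<open>g0\<close> truncates the constant 1, with eigenvalue 0, so the gradient
    term disappears; \<open>g1\<close> below truncates \<phi>, with eigenvalue 1.\<close>
  obtain g0 :: "real ^ 'n \<Rightarrow> real" where g0: "g0 \<in> L2"
    "\<And>x. norm x \<le> radius \<tau> \<Longrightarrow> g0 x = 1" "\<And>x. 0 \<le> g0 x"
    "\<And>t. 0 < t \<Longrightarrow> t \<le> \<tau> \<Longrightarrow> set_integrable lborel ({0<..<t} \<times> UNIV) (\<lambda>(s, x). N s x * g0 x)"
    "\<And>t. 0 < t \<Longrightarrow> t \<le> \<tau> \<Longrightarrow> (LINT x|lborel. ut t x * g0 x) =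
       \<epsilon> * (LINT x|lborel. u1 x * g0 x)
       + (LINT s:{0<..<t}|lborel. 0 * (s powr (2 * l) * (LINT x|lborel. u s x * g0 x)))
       + (LINT s:{0<..<t}|lborel. LINT x|lborel. N s x * g0 x)"
    by (rule radial_test_function[OF \<tau>0 \<tau>(2), of "\<lambda>_. 1" "\<lambda>_. 0" "\<lambda>_. 0" 0]) (auto intro: that)
  obtain F1 F2 where F: "\<And>s. (bessel m has_real_derivative F1 s) (at s)"
    "\<And>s. (F1 has_real_derivative F2 s) (at s)" "\<And>s. 2 * real (m + 1) * F1 s + 4 * s * F2 s = bessel m s"
    by (rule bessel_ODE[of m]) (rule that)
  obtain g1 :: "real ^ 'n \<Rightarrow> real" where g1: "g1 \<in> L2"
    "\<And>x. norm x \<le> radius \<tau> \<Longrightarrow> g1 x = bessel m (x \<bullet> x)" "\<And>x. 0 \<le> g1 x"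
    "\<And>t. 0 < t \<Longrightarrow> t \<le> \<tau> \<Longrightarrow> set_integrable lborel ({0<..<t} \<times> UNIV) (\<lambda>(s, x). N s x * g1 x)"
    "\<And>t. 0 < t \<Longrightarrow> t \<le> \<tau> \<Longrightarrow> (LINT x|lborel. ut t x * g1 x) =
       \<epsilon> * (LINT x|lborel. u1 x * g1 x)
       + (LINT s:{0<..<t}|lborel. 1 * (s powr (2 * l) * (LINT x|lborel. u s x * g1 x)))
       + (LINT s:{0<..<t}|lborel. LINT x|lborel. N s x * g1 x)"
  proof (rule radial_test_function[OF \<tau>0 \<tau>(2) Ck_on_bessel[of _ m] F(1,2), of 1])
    show "2 * real CARD('n) * F1 s + 4 * s * F2 s = 1 * bessel m s" for s
      using F(3)[of s] m by simp
    show "0 \<le> bessel m s" if "0 \<le> s" for s using bessel_ge_1[OF that, of m] by simp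
  qed (rule that)
  define U0 where "U0 = (\<lambda>s. LINT x|lborel. u s x * g0 x)"
  define V0 where "V0 = (\<lambda>s. LINT x|lborel. ut s x * g0 x)"
  define U1 where "U1 = (\<lambda>s. LINT x|lborel. u s x * g1 x)"
  define V1 where "V1 = (\<lambda>s. LINT x|lborel. ut s x * g1 x)"
  define P where "P = (\<lambda>s. LINT x|lborel. N s x * g0 x)"
  have R\<tau>: "R \<le> radius \<tau>" using l by (simp add: radius_def)
  have meas: "u0 \<in> borel_measurable lborel" "u1 \<in> borel_measurable lborel" "u 0 \<in> borel_measurable lborel"
    "g0 \<in> borel_measurable lborel" "g1 \<in> borel_measurable lborel"
    using u0 u1 u_L2[OF interval_down[of 0 \<tau>]] g0 g1 \<tau> by (auto simp: L2_real_iff)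
  have bmeas: "(\<lambda>x::real^'n. bessel m (x \<bullet> x)) \<in> borel_measurable lborel"
    using Ck_on_radial[OF Ck_on_bessel, of 0 m] by (auto intro: borel_measurable_continuous_onI)
  have U10: "U1 0 = \<epsilon> * a"
  proof -
    have "U1 0 = (LINT x|lborel. \<epsilon> * (u0 x * bessel m (x \<bullet> x)))"
      unfolding U1_def
    proof (rule integral_cong_AE)
      show "AE x in lborel. u 0 x * g1 x = \<epsilon> * (u0 x * bessel m (x \<bullet> x))"
        using u_0 AE_data_outside(1)
      proof eventually_elim
        case (elim x)
        then show ?case using g1(2)[of x] R\<tau> by (cases "norm x \<le> R") auto
      qed
    qed (intro borel_measurable_times borel_measurable_const meas bmeas)+
    then show ?thesis by (simp add: a)
  qed
  have u1g1: "(LINT x|lborel. u1 x * g1 x) = b"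
    unfolding b
  proof (rule integral_cong_AE)
    show "AE x in lborel. u1 x * g1 x = u1 x * bessel m (x \<bullet> x)"
      using AE_data_outside(2)
    proof eventually_elim
      case (elim x)
      then show ?case using g1(2)[of x] R\<tau> by (cases "norm x \<le> R") auto
    qed
  qed (intro borel_measurable_times meas bmeas)+
  have U00: "0 \<le> U0 0" unfolding U0_def
  proof (rule integral_nonneg_AE)
    show "AE x in lborel. 0 \<le> u 0 x * g0 x"
      using u_0 nonneg(1) by eventually_elim (use \<epsilon> g0(3) in auto)
  qed
  have v0: "0 \<le> \<epsilon> * (LINT x|lborel. u1 x * g0 x)"
  proof (intro mult_nonneg_nonneg integral_nonneg_AE)
    show "AE x in lborel. 0 \<le> u1 x * g0 x"
      using nonneg(2) by eventually_elim (use g0(3) in auto)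
  qed (use \<epsilon> in simp)
  have V1: "\<epsilon> * c * (s powr (l / 2) * exp (s powr (l + 1) / (l + 1))) \<le> V1 s" if s: "1 \<le> s" "s \<le> \<tau>" for s
  proof -
    have "(\<epsilon> * b + \<epsilon> * a / (2 * l + 1)) / ((l / 2 + 2) * exp (1 / (l + 1))) *
        (s powr (l / 2) * exp (s powr (l + 1) / (l + 1))) \<le> V1 s"
    proof (rule tricomi_growth[where U = U1 and V = V1 and \<tau> = \<tau>, OF l _ U10 _ _ _ _ s])
      show "continuous_on {0..\<tau>} U1" unfolding U1_def by (rule moment_continuous[OF g1(1) \<tau>(2)])
      show "(U1 has_real_derivative V1 t) (at t)" if "0 < t" "t < \<tau>" for t
        unfolding U1_def V1_def
        by (rule moment_DERIV[OF g1(1) that(1)]) (use that \<tau> ereal_le_less_trans[of t \<tau>] in auto)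
      fix t assume t: "0 < t" "t \<le> \<tau>"
      have "continuous_on {0..t} U1"
        unfolding U1_def by (rule moment_continuous[OF g1(1)]) (use t \<tau> ereal_le_less_trans in auto)
      moreover have "continuous_on {0..t} (\<lambda>s. s powr (2 * l))"
        using l by (intro continuous_on_powr' continuous_intros) auto
      ultimately have "continuous_on {0..t} (\<lambda>s. s powr (2 * l) * U1 s)"
        by (rule continuous_on_mult[rotated])
      from set_lebesgue_integral_open_eq_integral[OF this]
      have "V1 t = \<epsilon> * b + integral {0..t} (\<lambda>s. s powr (2 * l) * U1 s) + (LINT s:{0<..<t}|lborel. LINT x|lborel. N s x * g1 x)"
        using g1(5)[OF t] u1g1 by (simp add: V1_def U1_def)
      \<comment> \<open>For the moment with \<phi> the source is merely dropped: only its sign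
        matters.\<close>
      moreover have "0 \<le> (LINT s:{0<..<t}|lborel. LINT x|lborel. N s x * g1 x)"
        unfolding set_lebesgue_integral_def
        by (intro Bochner_Integration.integral_nonneg scaleR_nonneg_nonneg mult_nonneg_nonneg g1(3)) auto
      ultimately show "\<epsilon> * b + integral {0..t} (\<lambda>s. s powr (2 * l) * U1 s) \<le> V1 t" by simp
    qed (use \<epsilon> ab in auto)
    moreover have "(\<epsilon> * b + \<epsilon> * a / (2 * l + 1)) / ((l / 2 + 2) * exp (1 / (l + 1))) = \<epsilon> * c"
      by (simp add: c add_divide_distrib distrib_left)
    ultimately show ?thesis by simp
  qed
  \<comment> \<open>Fubini's theorem gives integrability in space for almost every time only, so the
    lower bounds for \<open>P\<close> hold almost everywhere.\<close>
  have "integrable (lborel \<Otimes>\<^sub>M lborel) (\<lambda>(s, x). indicator {0<..<\<tau>} s * (N s x * g0 x))"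
    using g0(4)[OF \<tau>0 order_refl] unfolding set_integrable_def lborel_prod[symmetric]
    by (simp add: case_prod_beta' indicator_times)
  from lborel_pair.AE_integrable_fst[OF this] lborel_pair.integrable_fst[OF this]
  have AEint: "AE s in lborel. integrable lborel (\<lambda>x. indicator {0<..<\<tau>} s * (N s x * g0 x))"
    and Pint: "set_integrable lborel {0<..<\<tau>} P"
    by (simp_all add: set_integrable_def P_def)
  have P0: "0 \<le> P s" for s
    unfolding P_def by (intro Bochner_Integration.integral_nonneg mult_nonneg_nonneg g0(3)) auto
  show "\<tau> powr (2 - \<beta> + (\<mu> + 2) * (q - 1)) * (\<kappa> * \<epsilon> powr p) powr (q - 1) \<le>
    8 / (1 - 2 powr (- (q - 1) / 2))\<^sup>2 / (k * 4 powr (- \<bar>\<beta>\<bar>) * (4 powr (- \<bar>\<mu>\<bar>) / 64) powr (q - 1))"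
  proof (rule power_source_lifespan[where U = U0 and V = V0 and P = P and \<tau> = \<tau>, OF q _ k0 \<tau>(1) _ U00 v0 _ _ Pint P0])
    show "0 < \<kappa> * \<epsilon> powr p" using \<kappa>0 \<epsilon> by simp
    show "continuous_on {0..\<tau>} U0" unfolding U0_def by (rule moment_continuous[OF g0(1) \<tau>(2)])
    show "(U0 has_real_derivative V0 t) (at t)" if "0 < t" "t \<le> \<tau>" for t
      unfolding U0_def V0_def
      by (rule moment_DERIV[OF g0(1) that(1)]) (use that \<tau> ereal_le_less_trans[of t \<tau>] in auto)
    show "V0 t = \<epsilon> * (LINT x|lborel. u1 x * g0 x) + (LINT s:{0<..<t}|lborel. P s)" if "0 < t" "t \<le> \<tau>" for t
      using g0(5)[OF that] by (simp add: V0_def P_def)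
    show "AE s in lborel. 1 \<le> s \<and> s < \<tau> \<longrightarrow> \<kappa> * \<epsilon> powr p * s powr \<mu> \<le> P s \<and> k * s powr (- \<beta>) * \<bar>U0 s\<bar> powr q \<le> P s"
      using AEint
    proof eventually_elim
      case (elim s)
      show ?case
      proof
        assume s: "1 \<le> s \<and> s < \<tau>"
        then have int: "integrable lborel (\<lambda>x. N s x * g0 x)" using elim by simp
        have s0: "0 < s" "s \<le> \<tau>" using s by auto
        note mean = source_mean_bounds[OF s0 \<tau>(2) g0(1-3) int g1(1,2) m]
        have \<rho>: "0 < radius s" by (rule radius_pos)
        have "\<epsilon> powr p * ((c * exp (- R) / sqrt (2 ^ (m + 1) * fact m)) powr p / D powr (p - 1)) * s powr (l * p / 2) *
            radius s powr (real m * (1 - p / 2)) \<le> P s"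
          by (rule powr_source_lower[OF \<epsilon> c0 s0(1) \<rho> _ D0 p radius_def V1[of s, unfolded V1_def]])
            (use mean(2) s in \<open>auto simp: D P_def\<close>)
        moreover have "s powr \<mu> = s powr (l * p / 2) * s powr ((l + 1) * (real m * (1 - p / 2)))"
          by (simp add: \<mu> powr_add)
        moreover have "(\<epsilon> powr p * ((c * exp (- R) / sqrt (2 ^ (m + 1) * fact m)) powr p / D powr (p - 1)) * s powr (l * p / 2)) *
           (min ((1 / (l + 1)) powr (real m * (1 - p / 2))) ((R + 1 / (l + 1)) powr (real m * (1 - p / 2))) * s powr ((l + 1) * (real m * (1 - p / 2))))
           \<le> (\<epsilon> powr p * ((c * exp (- R) / sqrt (2 ^ (m + 1) * fact m)) powr p / D powr (p - 1)) * s powr (l * p / 2)) *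
            radius s powr (real m * (1 - p / 2))"
          using s by (intro mult_left_mono radius_powr_lower) auto
        ultimately have 1: "\<kappa> * \<epsilon> powr p * s powr \<mu> \<le> P s"
          unfolding \<kappa> by (simp only: mult_ac)
        let ?\<omega> = "unit_ball_vol CARD('n)" and ?n = "CARD('n)"
        have w: "?\<omega> > 0" by simp
        have "(?\<omega> * radius s ^ ?n) powr (q - 1) = ?\<omega> powr (q - 1) * radius s powr (?n * (q - 1))"
          using \<rho> w by (simp add: powr_mult powr_powr flip: powr_realpow)
        then have "\<bar>U0 s\<bar> powr q \<le> P s * (?\<omega> powr (q - 1) * radius s powr (?n * (q - 1)))"
          using mean(1) by (simp add: U0_def P_def)
        then have "radius s powr (- (?n * (q - 1))) / ?\<omega> powr (q - 1) * \<bar>U0 s\<bar> powr q \<le>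
            radius s powr (- (?n * (q - 1))) / ?\<omega> powr (q - 1) * (P s * (?\<omega> powr (q - 1) * radius s powr (?n * (q - 1))))"
          by (intro mult_left_mono) auto
        also have "\<dots> = (radius s powr (- (?n * (q - 1))) * radius s powr (?n * (q - 1))) * (?\<omega> powr (q - 1) / ?\<omega> powr (q - 1)) * P s"
          by (simp only: times_divide_eq_left times_divide_eq_right mult_ac)
        also have "\<dots> = P s"
          using \<rho> less_imp_neq[OF w] by (simp only: powr_add[symmetric]) simp
        finally have "radius s powr (- (?n * (q - 1))) / ?\<omega> powr (q - 1) * \<bar>U0 s\<bar> powr q \<le> P s" .
        moreover have "k * s powr (- \<beta>) * \<bar>U0 s\<bar> powr q \<le> radius s powr (- (?n * (q - 1))) / ?\<omega> powr (q - 1) * \<bar>U0 s\<bar> powr q"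
        proof (rule mult_right_mono)
          have "(l + 1) * (- (?n * (q - 1))) = - \<beta>" by (simp add: \<beta>)
          then show "k * s powr (- \<beta>) \<le> radius s powr (- (?n * (q - 1))) / ?\<omega> powr (q - 1)"
            using divide_right_mono[OF radius_powr_lower[of s "- (?n * (q - 1))"], of "?\<omega> powr (q - 1)"] s
            by (simp add: k)
        qed simp
        ultimately show "\<kappa> * \<epsilon> powr p * s powr \<mu> \<le> P s \<and> k * s powr (- \<beta>) * \<bar>U0 s\<bar> powr q \<le> P s"
          using 1 by simp
      qed
    qed
  qed
qed

theorem theorem1p2:
  fixes l p q R :: real and u0 u1 :: "real ^ 'n::finite \<Rightarrow> real"
  assumes "l > 0" and "p > 1" and "q > 1"
    and "(((l + 1) * real CARD('n) - 1) * p - 2 * l * (p - 1) - 2) * (q - 1) < 4"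
    and "u0 \<in> H1" and "u1 \<in> L2"
    and "AE x in lborel. u0 x \<ge> 0" and "AE x in lborel. u1 x \<ge> 0"
    and "\<not> ((AE x in lborel. u0 x = 0) \<and> (AE x in lborel. u1 x = 0))"
    and "R > 0" and "ess_support u0 \<subseteq> cball 0 R" and "ess_support u1 \<subseteq> cball 0 R"
  shows "\<exists>\<epsilon>0>0. \<exists>C>0. \<forall>\<epsilon>. 0 < \<epsilon> \<and> \<epsilon> \<le> \<epsilon>0 \<longrightarrow>
    (\<forall>T u. energy_solution_with_lifespan l p q \<epsilon> u0 u1 T u \<longrightarrow>
       (\<forall>t\<in>open_interval T. ess_support (u t) \<subseteq> cball 0 (R + t powr (l + 1) / (l + 1))) \<longrightarrow>
       T < \<infinity> \<and>
       T \<le> ereal (C * \<epsilon> powr (- (p * (q - 1) / theta CARD('n) l p q))))"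
proof -
  note l = \<open>l > 0\<close> and p = \<open>p > 1\<close> and q = \<open>q > 1\<close>
  obtain m where m: "CARD('n) = Suc m" by (metis gr0_implies_Suc zero_less_card_finite)
  have u0L: "u0 \<in> L2" using \<open>u0 \<in> H1\<close> by (simp add: H1_def)
  define \<theta> where "\<theta> = theta CARD('n) l p q"
  have \<theta>: "\<theta> > 0" using assms(4) by (simp add: \<theta>_def theta_def)
  let ?\<phi> = "\<lambda>x::real^'n. bessel m (x \<bullet> x)"
  have \<phi>1: "1 \<le> ?\<phi> x" for x by (rule bessel_ge_1) simp
  have \<phi>c: "continuous_on UNIV ?\<phi>" using Ck_on_radial[OF Ck_on_bessel, of 0 m] by simp
  define a where "a = (LINT x|lborel. u0 x * ?\<phi> x)"
  define b where "b = (LINT x|lborel. u1 x * ?\<phi> x)"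
  \<comment> \<open>As \<phi> is at least 1, a nonnegative function with zero moment vanishes almost
    everywhere; data that are not both trivial thus give \<open>0 < a + b\<close>.\<close>
  have moment: "0 \<le> (LINT x|lborel. f x * ?\<phi> x)" "(LINT x|lborel. f x * ?\<phi> x) = 0 \<Longrightarrow> AE x in lborel. f x = 0"
    if f: "f \<in> L2" "AE x in lborel. f x \<ge> 0" "ess_support f \<subseteq> cball 0 R" for f
  proof -
    have nn: "AE x in lborel. 0 \<le> f x * ?\<phi> x"
      using f(2) by eventually_elim (use \<phi>1 in \<open>meson mult_nonneg_nonneg order_trans zero_le_one\<close>)
    then show "0 \<le> (LINT x|lborel. f x * ?\<phi> x)" by (rule integral_nonneg_AE)
    have "AE x in lborel. R < norm x \<longrightarrow> f x = 0"
      using AE_zero_outside_ess_support[OF f(3)] by (simp add: not_le)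
    then have int: "integrable lborel (\<lambda>x. f x * ?\<phi> x)"
      by (rule integrable_L2_compact_support[OF f(1) _ \<phi>c])
    assume "(LINT x|lborel. f x * ?\<phi> x) = 0"
    then have "AE x in lborel. f x * ?\<phi> x = 0"
      using integral_nonneg_eq_0_iff_AE[OF int nn] by simp
    then show "AE x in lborel. f x = 0"
    proof eventually_elim
      case (elim x)
      then show ?case using \<phi>1[of x] by auto
    qed
  qed
  have ab: "0 \<le> a" "0 \<le> b" "0 < a + b"
    using moment[OF u0L assms(7,11)] moment[OF assms(6,8,12)] assms(9) unfolding a_def b_def
    by (auto simp: less_le add_nonneg_eq_0_iff)
  define c where "c = (b + a / (2 * l + 1)) / ((l / 2 + 2) * exp (1 / (l + 1)))"
  define D where "D = unit_ball_vol (Suc m) * Suc m / (1 - exp (- 1 / 2))"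
  define \<kappa> where "\<kappa> = (c * exp (- R) / sqrt (2 ^ (m + 1) * fact m)) powr p / D powr (p - 1) *
      min ((1 / (l + 1)) powr (real m * (1 - p / 2))) ((R + 1 / (l + 1)) powr (real m * (1 - p / 2)))"
  define k where "k = min ((1 / (l + 1)) powr (- (CARD('n) * (q - 1)))) ((R + 1 / (l + 1)) powr (- (CARD('n) * (q - 1)))) /
      unit_ball_vol CARD('n) powr (q - 1)"
  define \<beta> where "\<beta> = (l + 1) * (CARD('n) * (q - 1))"
  define \<mu> where "\<mu> = l * p / 2 + (l + 1) * (real m * (1 - p / 2))"
  define K where "K = 8 / (1 - 2 powr (- (q - 1) / 2))\<^sup>2 / (k * 4 powr (- \<bar>\<beta>\<bar>) * (4 powr (- \<bar>\<mu>\<bar>) / 64) powr (q - 1))"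
  have exponent: "2 - \<beta> + (\<mu> + 2) * (q - 1) = \<theta>"
    by (simp add: \<theta>_def theta_def \<beta>_def \<mu>_def m field_simps)
  \<comment> \<open>The 4 meets the requirement \<open>4 \<le> \<tau>\<close> of
    \<open>lifespan_bound\<close>: for \<open>\<epsilon> \<le> 1\<close> every \<tau> beyond the
    claimed bound exceeds 4. Hence 1 can serve as the threshold for \<epsilon>.\<close>
  define C where "C = max 4 ((K / \<kappa> powr (q - 1)) powr (1 / \<theta>))"
  define e where "e = p * (q - 1) / \<theta>"
  have e: "e > 0" using p q \<theta> by (simp add: e_def)
  have bound_T: "T \<le> ereal (C * \<epsilon> powr (- e))"
    if small: "0 < \<epsilon>" "\<epsilon> \<le> 1" and sol: "energy_solution_with_lifespan l p q \<epsilon> u0 u1 T u"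
      and supp: "\<forall>t\<in>open_interval T. ess_support (u t) \<subseteq> cball 0 (R + t powr (l + 1) / (l + 1))" for \<epsilon> T u
  proof (rule ccontr)
    assume "\<not> ?thesis"
    \<comment> \<open>A real \<tau> exists here whether \<open>T\<close> is finite or not, so the
      bound yields finiteness as well.\<close>
    then obtain \<tau> where \<tau>: "C * \<epsilon> powr (- e) < \<tau>" "ereal \<tau> < T"
      using ereal_dense2[of "ereal (C * \<epsilon> powr (- e))" T] by (auto simp: not_le)
    obtain ut where ut: "supported_solution l p q R \<epsilon> u0 u1 T u ut"
      using sol unfolding energy_solution_with_lifespan_def energy_solution_def supported_solution_def
      using l p q \<open>R > 0\<close> small u0L assms(6-8,11,12) supp by blast
    interpret supported_solution l p q R \<epsilon> u0 u1 T u ut by (rule ut)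
    have "1 = \<epsilon> powr 0" using small by simp
    also have "\<dots> \<le> \<epsilon> powr (- e)" using small e by (intro powr_mono') auto
    finally have "C * 1 \<le> C * \<epsilon> powr (- e)" by (intro mult_left_mono) (auto simp: C_def)
    then have \<tau>4: "4 \<le> \<tau>" using \<tau> by (simp add: C_def)
    note bound = lifespan_bound[OF \<tau>4 \<tau>(2) m a_def b_def ab c_def D_def \<kappa>_def k_def \<beta>_def \<mu>_def]
    have \<kappa>: "\<kappa> > 0" by (rule bound(1))
    have "\<tau> powr \<theta> * (\<kappa> powr (q - 1) * \<epsilon> powr (p * (q - 1))) \<le> K"
      using bound(2) \<kappa> small unfolding exponent K_def[symmetric] by (simp add: powr_mult powr_powr)
    then have "\<tau> powr \<theta> \<le> K / \<kappa> powr (q - 1) * \<epsilon> powr (- (p * (q - 1)))"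
      unfolding powr_minus_divide times_divide_times_eq mult_1_right
      using \<kappa> small by (subst pos_le_divide_eq) auto
    then have "(\<tau> powr \<theta>) powr (1 / \<theta>) \<le> (K / \<kappa> powr (q - 1) * \<epsilon> powr (- (p * (q - 1)))) powr (1 / \<theta>)"
      using \<theta> by (intro powr_mono2) auto
    moreover have "(K / \<kappa> powr (q - 1) * \<epsilon> powr (- (p * (q - 1)))) powr (1 / \<theta>) =
        (K / \<kappa> powr (q - 1)) powr (1 / \<theta>) * (\<epsilon> powr (- (p * (q - 1)))) powr (1 / \<theta>)"
      by (rule powr_mult)
    moreover have "(\<epsilon> powr (- (p * (q - 1)))) powr (1 / \<theta>) = \<epsilon> powr (- e)"
      by (simp add: powr_powr e_def)
    moreover have "(\<tau> powr \<theta>) powr (1 / \<theta>) = \<tau>"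
      using \<theta> \<tau>4 by (simp add: powr_powr)
    ultimately have "\<tau> \<le> (K / \<kappa> powr (q - 1)) powr (1 / \<theta>) * \<epsilon> powr (- e)"
      by simp
    also have "\<dots> \<le> C * \<epsilon> powr (- e)" by (intro mult_right_mono) (auto simp: C_def)
    finally show False using \<tau> by simp
  qed
  have bound: "T < \<infinity> \<and> T \<le> ereal (C * \<epsilon> powr (- e))"
    if "0 < \<epsilon> \<and> \<epsilon> \<le> 1" "energy_solution_with_lifespan l p q \<epsilon> u0 u1 T u"
      "\<forall>t\<in>open_interval T. ess_support (u t) \<subseteq> cball 0 (R + t powr (l + 1) / (l + 1))" for \<epsilon> T u
  proof -
    have "T \<le> ereal (C * \<epsilon> powr (- e))" using bound_T that by blast
    moreover have "\<dots> < \<infinity>" by simp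
    ultimately show ?thesis by (blast intro: le_less_trans)
  qed
  have "C > 0" by (simp add: C_def)
  show ?thesis
    unfolding \<theta>_def[symmetric] e_def[symmetric]
    by (rule exI[of _ "1 :: real"], rule conjI[OF zero_less_one], rule exI[of _ C])
      (use bound \<open>C > 0\<close> in blast)
qed

end
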